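(* Let $H$ be a finite dimensional Hopf algebra over $\mathbb{C}$ and let $V$ be a simple vertex operator algebra which is an inner faithful $H$-module VOA and is semisimple as an $H$-module. Then $H$ acts on $V$ faithfully. In particular, $H$ is a group algebra, i.e. $H\cong\mathbb{C}[G]$ as Hopf algebras for some finite group $G$.
   Context: Everything is over $\mathbb{C}$. A Hopf algebra $H$ has comultiplication $\Delta(h)=\sum h_1\otimes h_2$ (Sweedler notation), counit $\epsilon$ and antipode $S$. The group algebra $\mathbb{C}[G]$ carries the Hopf structure $\Delta(g)=g\otimes g$, $\epsilon(g)=1$, $S(g)=g^{-1}$ for $g\in G$. A vertex operator algebra (VOA) is $(V,Y,\mathbf 1,\omega)$ with $V=\bigoplus_{n\in\mathbb{Z}}V_n$, $\dim V_n<\infty$, $V_n=0$ for $n\ll 0$, $\mathbf 1\in V_0$, $\omega\in V_2$, and a linear map $u\mapsto Y(u,z)=\sum_{n\in\mathbb{Z}}u_nz^{-n-1}\in \mathrm{End}(V)[[z,z^{-1}]]$ such that: $u_nv=0$ for $n\gg0$; $Y(\mathbf 1,z)v=v$ and $\lim_{z\to0}Y(v,z)\mathbf 1=v$; writing $Y(\omega,z)=\sum_n L(n)z^{-n-2}$, one has $V_n=\{v\mid L(0)v=nv\}$, $Y(L(-1)v,z)=\frac{d}{dz}Y(v,z)$ and $[L(n),L(m)]=(n-m)L(n+m)+\delta_{n+m,0}\frac{n^3-n}{12}c$ for some $c\in\mathbb{C}$; and the Jacobi identity holds: $$z_0^{-1}\delta\!\left(\tfrac{z_1-z_2}{z_0}\right)Y(u,z_1)Y(v,z_2)-z_0^{-1}\delta\!\left(\tfrac{-z_2+z_1}{z_0}\right)Y(v,z_2)Y(u,z_1)=z_1^{-1}\delta\!\left(\tfrac{z_2+z_0}{z_1}\right)Y(Y(u,z_0)v,z_2),$$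 where $\delta(z)=\sum_{n\in\mathbb{Z}}z^n$ and $(z_1+z_2)^n=\sum_{i\ge0}\binom{n}{i}z_1^iz_2^{n-i}$. $V$ is simple if it is nonzero and has no nontrivial ideals. $V$ is an $H$-module VOA if: (i) $V$ is an $H$-module; (ii) $h\omega=\epsilon(h)\omega$ for all $h\in H$; (iii) $hY(u,z)v=\sum Y(h_1u,z)h_2v$ for all $h\in H$, $u,v\in V$. The action is faithful if no nonzero $h\in H$ satisfies $hV=0$. A Hopf ideal of $H$ is a subspace $I\subseteq H$ which is a two-sided ideal ($IH\subseteq I$, $HI\subseteq I$), a coideal ($\Delta(I)\subseteq H\otimes I+I\otimes H$ and $\epsilon(I)=0$), and satisfies $S(I)\subseteq I$. The action of $H$ on $V$ is inner faithful if $IV\neq0$ for every nonzero Hopf ideal $I$ of $H$.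
   Formalization: In the Jacobi identity, (z_1+z_2)^n is expanded in nonnegative powers of the second summand (the standard convention); the printed expansion, in nonnegative powers of the first summand, would leave the products in the identity undefined. *)

theory Defs
  imports Complex_Main "HOL-Library.Poly_Mapping" "HOL-Algebra.Group"
begin

section \<open>Linear algebra over the complex numbers\<close>

definition linear_on ::
  "'a set \<Rightarrow> (complex \<Rightarrow> 'a \<Rightarrow> 'a) \<Rightarrow> (complex \<Rightarrow> 'b \<Rightarrow> 'b) \<Rightarrow>
    ('a::ab_group_add \<Rightarrow> 'b::ab_group_add) \<Rightarrow> bool"
  where "linear_on A s s' f \<longleftrightarrow>
    (\<forall>x\<in>A. \<forall>y\<in>A. f (x + y) = f x + f y) \<and> (\<forall>c. \<forall>x\<in>A. f (s c x) = s' c (f x))"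

definition finite_dim :: "(complex \<Rightarrow> 'a \<Rightarrow> 'a) \<Rightarrow> 'a::ab_group_add set \<Rightarrow> bool"
  where "finite_dim s A \<longleftrightarrow> (\<exists>B. finite B \<and> B \<subseteq> A \<and> module.span s B = A)"

text \<open>The whole space is the internal direct sum of the family \<open>W i\<close>, \<open>i \<in> I\<close>.\<close>

definition is_direct_sum :: "'i set \<Rightarrow> ('i \<Rightarrow> 'v::ab_group_add set) \<Rightarrow> bool"
  where "is_direct_sum I W \<longleftrightarrow>
    (\<forall>v. \<exists>!f. finite {i. f i \<noteq> 0} \<and> (\<forall>i\<in>I. f i \<in> W i) \<and> (\<forall>i. i \<notin> I \<longrightarrow> f i = 0) \<and>
      v = Sum_any f)"

text \<open>\<open>'b \<Rightarrow>\<^sub>0 complex\<close> is the free vector space on the set of all elements of \<open>'b\<close>;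
  \<open>lin_ext s f\<close> is the linear extension of a map \<open>f\<close> from the basis to a space with scaling \<open>s\<close>.\<close>

definition free_scale :: "complex \<Rightarrow> ('b \<Rightarrow>\<^sub>0 complex) \<Rightarrow> ('b \<Rightarrow>\<^sub>0 complex)"
  where "free_scale c t = Poly_Mapping.map ((*) c) t"

abbreviation free_gen :: "'b \<Rightarrow> ('b \<Rightarrow>\<^sub>0 complex)"
  where "free_gen x \<equiv> Poly_Mapping.single x 1"

definition lin_ext ::
  "(complex \<Rightarrow> 'a \<Rightarrow> 'a::ab_group_add) \<Rightarrow> ('b \<Rightarrow> 'a) \<Rightarrow> ('b \<Rightarrow>\<^sub>0 complex) \<Rightarrow> 'a"
  where "lin_ext s f t = (\<Sum>k\<in>Poly_Mapping.keys t. s (Poly_Mapping.lookup t k) (f k))"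

section \<open>Tensor products\<close>

text \<open>For a subspace \<open>A\<close>, the space \<open>A \<otimes> A\<close> is the free vector space on \<open>A \<times> A\<close> modulo the
  span of the bilinearity relations; its elements are cosets. Likewise for \<open>A \<otimes> A \<otimes> A\<close> and
  the trilinearity relations. A member \<open>t\<close> of a coset is a way to write the tensor as
  a linear combination of pure tensors, and \<open>free_gen (a, b)\<close> represents the
  pure tensor \<open>a \<otimes> b\<close>.\<close>

definition rels2 ::
  "(complex \<Rightarrow> 'a \<Rightarrow> 'a) \<Rightarrow> 'a::ab_group_add set \<Rightarrow> ('a \<times> 'a \<Rightarrow>\<^sub>0 complex) set"
  where "rels2 s A =
    {free_gen (a + a', b) - free_gen (a, b) - free_gen (a', b) | a a' b. a \<in> A \<and> a' \<in> A \<and> b \<in> A} \<union>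
    {free_gen (a, b + b') - free_gen (a, b) - free_gen (a, b') | a b b'. a \<in> A \<and> b \<in> A \<and> b' \<in> A} \<union>
    {free_gen (s c a, b) - free_scale c (free_gen (a, b)) | c a b. a \<in> A \<and> b \<in> A} \<union>
    {free_gen (a, s c b) - free_scale c (free_gen (a, b)) | c a b. a \<in> A \<and> b \<in> A}"

definition rels3 ::
  "(complex \<Rightarrow> 'a \<Rightarrow> 'a) \<Rightarrow> 'a::ab_group_add set \<Rightarrow> ('a \<times> 'a \<times> 'a \<Rightarrow>\<^sub>0 complex) set"
  where "rels3 s A =
    {free_gen (x + x', y, z) - free_gen (x, y, z) - free_gen (x', y, z) | x x' y z.
       x \<in> A \<and> x' \<in> A \<and> y \<in> A \<and> z \<in> A} \<union>
    {free_gen (x, y + y', z) - free_gen (x, y, z) - free_gen (x, y', z) | x y y' z.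
       x \<in> A \<and> y \<in> A \<and> y' \<in> A \<and> z \<in> A} \<union>
    {free_gen (x, y, z + z') - free_gen (x, y, z) - free_gen (x, y, z') | x y z z'.
       x \<in> A \<and> y \<in> A \<and> z \<in> A \<and> z' \<in> A} \<union>
    {free_gen (s c x, y, z) - free_scale c (free_gen (x, y, z)) | c x y z.
       x \<in> A \<and> y \<in> A \<and> z \<in> A} \<union>
    {free_gen (x, s c y, z) - free_scale c (free_gen (x, y, z)) | c x y z.
       x \<in> A \<and> y \<in> A \<and> z \<in> A} \<union>
    {free_gen (x, y, s c z) - free_scale c (free_gen (x, y, z)) | c x y z.
       x \<in> A \<and> y \<in> A \<and> z \<in> A}"

definition tensor2 ::
  "(complex \<Rightarrow> 'a \<Rightarrow> 'a) \<Rightarrow> 'a::ab_group_add set \<Rightarrow> ('a \<times> 'a \<Rightarrow>\<^sub>0 complex) \<Rightarrow>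
    ('a \<times> 'a \<Rightarrow>\<^sub>0 complex) set"
  where "tensor2 s A t = {u. u - t \<in> module.span free_scale (rels2 s A)}"

definition tensor3 ::
  "(complex \<Rightarrow> 'a \<Rightarrow> 'a) \<Rightarrow> 'a::ab_group_add set \<Rightarrow> ('a \<times> 'a \<times> 'a \<Rightarrow>\<^sub>0 complex) \<Rightarrow>
    ('a \<times> 'a \<times> 'a \<Rightarrow>\<^sub>0 complex) set"
  where "tensor3 s A t = {u. u - t \<in> module.span free_scale (rels3 s A)}"

definition tensor_square ::
  "(complex \<Rightarrow> 'a \<Rightarrow> 'a) \<Rightarrow> 'a::ab_group_add set \<Rightarrow> ('a \<times> 'a \<Rightarrow>\<^sub>0 complex) set set"
  where "tensor_square s A = tensor2 s A ` {t. Poly_Mapping.keys t \<subseteq> A \<times> A}"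

section \<open>Hopf algebras\<close>

text \<open>The underlying vector space is a subspace \<open>carrier H\<close> of an ambient vector space on the
  type \<open>'h\<close>; addition is that of \<open>'h\<close>. Carriers are needed because the group algebra of a group
  given by its carrier set does not fill a type. The comultiplication takes values in
  cosets, so \<open>t \<in> comult H h\<close> says that \<open>t\<close> is a Sweedler expression for the comultiplication
  of \<open>h\<close>: a linear combination of pairs \<open>(h\<^sub>1, h\<^sub>2)\<close>.\<close>

record 'h hopf = "'h monoid" +
  hscale :: "complex \<Rightarrow> 'h \<Rightarrow> 'h"
  comult :: "'h \<Rightarrow> ('h \<times> 'h \<Rightarrow>\<^sub>0 complex) set"
  counit :: "'h \<Rightarrow> complex"
  antipode :: "'h \<Rightarrow> 'h"

locale hopf_algebra = monoid H for H :: "('h::ab_group_add, 'z) hopf_scheme" (structure) +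
  assumes vector_space_scale: "vector_space (hscale H)"
    and subspace_carrier: "module.subspace (hscale H) (carrier H)"
    and mult_linear_left: "y \<in> carrier H \<Longrightarrow> linear_on (carrier H) (hscale H) (hscale H) (\<lambda>x. x \<otimes> y)"
    and mult_linear_right: "x \<in> carrier H \<Longrightarrow> linear_on (carrier H) (hscale H) (hscale H) (\<lambda>y. x \<otimes> y)"
    and comult_closed: "h \<in> carrier H \<Longrightarrow> comult H h \<in> tensor_square (hscale H) (carrier H)"
    and comult_add: "\<lbrakk>h \<in> carrier H; k \<in> carrier H; t \<in> comult H h; u \<in> comult H k\<rbrakk> \<Longrightarrow>
      t + u \<in> comult H (h + k)"
    and comult_scale: "\<lbrakk>h \<in> carrier H; t \<in> comult H h\<rbrakk> \<Longrightarrow>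
      free_scale c t \<in> comult H (hscale H c h)"
    and counit_linear: "linear_on (carrier H) (hscale H) (*) (counit H)"
    \<comment> \<open>\<open>r\<close> chooses a Sweedler expression for the comultiplication of each element\<close>
    and coassoc: "\<lbrakk>h \<in> carrier H; t \<in> comult H h; \<And>a. a \<in> carrier H \<Longrightarrow> r a \<in> comult H a\<rbrakk> \<Longrightarrow>
      tensor3 (hscale H) (carrier H)
        (lin_ext free_scale (\<lambda>(a, b). lin_ext free_scale (\<lambda>(a1, a2). free_gen (a1, a2, b)) (r a)) t) =
      tensor3 (hscale H) (carrier H)
        (lin_ext free_scale (\<lambda>(a, b). lin_ext free_scale (\<lambda>(b1, b2). free_gen (a, b1, b2)) (r b)) t)"
    and counit_left: "\<lbrakk>h \<in> carrier H; t \<in> comult H h\<rbrakk> \<Longrightarrow>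
      lin_ext (hscale H) (\<lambda>(a, b). hscale H (counit H a) b) t = h"
    and counit_right: "\<lbrakk>h \<in> carrier H; t \<in> comult H h\<rbrakk> \<Longrightarrow>
      lin_ext (hscale H) (\<lambda>(a, b). hscale H (counit H b) a) t = h"
    and comult_mult: "\<lbrakk>h \<in> carrier H; k \<in> carrier H; t \<in> comult H h; u \<in> comult H k\<rbrakk> \<Longrightarrow>
      lin_ext free_scale (\<lambda>(a, b). lin_ext free_scale (\<lambda>(a', b'). free_gen (a \<otimes> a', b \<otimes> b')) u) t
        \<in> comult H (h \<otimes> k)"
    and comult_one: "free_gen (\<one>, \<one>) \<in> comult H \<one>"
    and counit_mult: "\<lbrakk>h \<in> carrier H; k \<in> carrier H\<rbrakk> \<Longrightarrow> counit H (h \<otimes> k) = counit H h * counit H k"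
    and counit_one: "counit H \<one> = 1"
    and antipode_closed: "h \<in> carrier H \<Longrightarrow> antipode H h \<in> carrier H"
    and antipode_linear: "linear_on (carrier H) (hscale H) (hscale H) (antipode H)"
    and antipode_left: "\<lbrakk>h \<in> carrier H; t \<in> comult H h\<rbrakk> \<Longrightarrow>
      lin_ext (hscale H) (\<lambda>(a, b). antipode H a \<otimes> b) t = hscale H (counit H h) \<one>"
    and antipode_right: "\<lbrakk>h \<in> carrier H; t \<in> comult H h\<rbrakk> \<Longrightarrow>
      lin_ext (hscale H) (\<lambda>(a, b). a \<otimes> antipode H b) t = hscale H (counit H h) \<one>"

text \<open>In the coideal condition, a tensor lies in \<open>H \<otimes> I + I \<otimes> H\<close> iff it has an expression all of
  whose pure tensors lie in \<open>H \<times> I \<union> I \<times> H\<close>.\<close>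

definition hopf_ideal :: "('h::ab_group_add, 'z) hopf_scheme \<Rightarrow> 'h set \<Rightarrow> bool"
  where "hopf_ideal H I \<longleftrightarrow>
    I \<subseteq> carrier H \<and> module.subspace (hscale H) I \<and>
    (\<forall>x\<in>I. \<forall>h\<in>carrier H. x \<otimes>\<^bsub>H\<^esub> h \<in> I \<and> h \<otimes>\<^bsub>H\<^esub> x \<in> I) \<and>
    (\<forall>x\<in>I. \<exists>t\<in>comult H x. Poly_Mapping.keys t \<subseteq> carrier H \<times> I \<union> I \<times> carrier H) \<and>
    (\<forall>x\<in>I. counit H x = 0) \<and>
    (\<forall>x\<in>I. antipode H x \<in> I)"

definition hopf_iso ::
  "('h::ab_group_add, 'y) hopf_scheme \<Rightarrow> ('k::ab_group_add, 'z) hopf_scheme \<Rightarrow> ('h \<Rightarrow> 'k) \<Rightarrow> bool"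
  where "hopf_iso H K \<phi> \<longleftrightarrow>
    \<phi> \<in> iso H K \<and> \<phi> \<one>\<^bsub>H\<^esub> = \<one>\<^bsub>K\<^esub> \<and>
    linear_on (carrier H) (hscale H) (hscale K) \<phi> \<and>
    (\<forall>h\<in>carrier H. \<forall>t\<in>comult H h.
       lin_ext free_scale (\<lambda>(a, b). free_gen (\<phi> a, \<phi> b)) t \<in> comult K (\<phi> h)) \<and>
    (\<forall>h\<in>carrier H. counit K (\<phi> h) = counit H h) \<and>
    (\<forall>h\<in>carrier H. \<phi> (antipode H h) = antipode K (\<phi> h))"

text \<open>The group algebra: the free vector space on \<open>carrier G\<close>, where \<open>free_gen g\<close> is the basis
  element \<open>g\<close>.\<close>

definition group_algebra :: "('g, 'z) monoid_scheme \<Rightarrow> ('g \<Rightarrow>\<^sub>0 complex) hopf"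
  where "group_algebra G =
    \<lparr>carrier = {f. Poly_Mapping.keys f \<subseteq> carrier G},
     mult = (\<lambda>f f'. lin_ext free_scale (\<lambda>g. lin_ext free_scale (\<lambda>g'. free_gen (g \<otimes>\<^bsub>G\<^esub> g')) f') f),
     one = free_gen \<one>\<^bsub>G\<^esub>,
     hscale = free_scale,
     comult = (\<lambda>f. tensor2 free_scale {f. Poly_Mapping.keys f \<subseteq> carrier G}
       (lin_ext free_scale (\<lambda>g. free_gen (free_gen g, free_gen g)) f)),
     counit = lin_ext (*) (\<lambda>g. 1),
     antipode = lin_ext free_scale (\<lambda>g. free_gen (inv\<^bsub>G\<^esub> g))\<rparr>"

section \<open>Vertex operator algebras\<close>

text \<open>\<open>mode V u n\<close> is the coefficient \<open>u\<^sub>n\<close> of \<open>z\<close> to the power \<open>- n - 1\<close> in \<open>Y(u, z)\<close>, and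
  \<open>grade V n\<close> is the homogeneous subspace \<open>V\<^sub>n\<close>. The underlying vector space is
  the whole type \<open>'v\<close>.\<close>

record 'v voa_data =
  vscale :: "complex \<Rightarrow> 'v \<Rightarrow> 'v"
  grade :: "int \<Rightarrow> 'v set"
  mode :: "'v \<Rightarrow> int \<Rightarrow> 'v \<Rightarrow> 'v"
  vac :: 'v
  conf :: 'v

text \<open>\<open>Y(\<omega>, z)\<close> is both the sum of \<open>\<omega>\<^sub>n\<close> times \<open>z\<close> to the power \<open>- n - 1\<close> and the sum of \<open>L(n)\<close> times
  \<open>z\<close> to the power \<open>- n - 2\<close>.\<close>

definition Vir :: "('v, 'z) voa_data_scheme \<Rightarrow> int \<Rightarrow> 'v \<Rightarrow> 'v"
  where "Vir V n = mode V (conf V) (n + 1)"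

text \<open>The Jacobi identity is stated as the equality, for all integers \<open>l\<close>, \<open>m\<close>, \<open>n\<close>, of the
  coefficients of \<open>z\<^sub>0\<close>, \<open>z\<^sub>1\<close>, \<open>z\<^sub>2\<close> to the powers \<open>- l - 1\<close>, \<open>- m - 1\<close>, \<open>- n - 1\<close> on both sides,
  applied to \<open>w\<close>. The three binomials \<open>(z\<^sub>1 - z\<^sub>2)\<close>, \<open>(- z\<^sub>2 + z\<^sub>1)\<close>, \<open>(z\<^sub>2 + z\<^sub>0)\<close> to an integer power
  are expanded in nonnegative powers of their second summand, so that by
  truncation each of the three sums over \<open>i :: nat\<close> has only finitely many nonzero terms, as
  \<open>Sum_any\<close> requires.\<close>

locale voa =
  fixes V :: "('v::ab_group_add, 'z) voa_data_scheme"
  assumes vector_space_scale: "vector_space (vscale V)"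
    and grade_subspace: "module.subspace (vscale V) (grade V n)"
    and grade_direct_sum: "is_direct_sum UNIV (grade V)"
    and grade_finite_dim: "finite_dim (vscale V) (grade V n)"
    and grade_bounded_below: "\<exists>N. \<forall>n<N. grade V n = {0}"
    and mode_linear: "linear_on UNIV (vscale V) (vscale V) (mode V u n)"
    and state_linear: "linear_on UNIV (vscale V) (vscale V) (\<lambda>u. mode V u n v)"
    and truncation: "\<exists>N. \<forall>n\<ge>N. mode V u n v = 0"
    and vac_grade: "vac V \<in> grade V 0"
    and conf_grade: "conf V \<in> grade V 2"
    and vacuum: "mode V (vac V) n v = (if n = - 1 then v else 0)"
    and creation_regular: "n \<ge> 0 \<Longrightarrow> mode V v n (vac V) = 0"
    and creation: "mode V v (- 1) (vac V) = v"
    and grade_eq: "grade V n = {v. Vir V 0 v = vscale V (of_int n) v}"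
    and L_derivative: "mode V (Vir V (- 1) u) n v = vscale V (- of_int n) (mode V u (n - 1) v)"
    and virasoro: "\<exists>c. \<forall>m n v. Vir V n (Vir V m v) - Vir V m (Vir V n v) =
      vscale V (of_int (n - m)) (Vir V (n + m) v) +
      vscale V (if n + m = 0 then (of_int n ^ 3 - of_int n) / 12 * c else 0) v"
    and jacobi: "Sum_any (\<lambda>i::nat. vscale V ((of_int l gchoose i) * (- 1) ^ i)
          (mode V u (m + l - int i) (mode V v (n + int i) w))) -
        Sum_any (\<lambda>i::nat. vscale V ((of_int l gchoose i) * (- 1) powi (l - int i))
          (mode V v (n + l - int i) (mode V u (m + int i) w))) =
        Sum_any (\<lambda>i::nat. vscale V (of_int m gchoose i)
          (mode V (mode V u (l + int i) v) (m + n - int i) w))"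

definition voa_ideal :: "('v::ab_group_add, 'z) voa_data_scheme \<Rightarrow> 'v set \<Rightarrow> bool"
  where "voa_ideal V I \<longleftrightarrow> module.subspace (vscale V) I \<and>
    (\<forall>u. \<forall>w\<in>I. \<forall>n. mode V u n w \<in> I \<and> mode V w n u \<in> I)"

definition simple_voa :: "('v::ab_group_add, 'z) voa_data_scheme \<Rightarrow> bool"
  where "simple_voa V \<longleftrightarrow>
    (UNIV :: 'v set) \<noteq> {0} \<and> (\<forall>I. voa_ideal V I \<longrightarrow> I = {0} \<or> I = UNIV)"

section \<open>Hopf actions\<close>

locale hopf_module = hopf_algebra H for H :: "('h::ab_group_add, 'z) hopf_scheme" (structure) +
  fixes s :: "complex \<Rightarrow> 'v \<Rightarrow> 'v::ab_group_add" and act :: "'h \<Rightarrow> 'v \<Rightarrow> 'v"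
  assumes module_vector_space: "vector_space s"
    and act_linear_left: "linear_on (carrier H) (hscale H) s (\<lambda>h. act h v)"
    and act_linear_right: "h \<in> carrier H \<Longrightarrow> linear_on UNIV s s (act h)"
    and act_one: "act \<one> v = v"
    and act_mult: "\<lbrakk>h \<in> carrier H; k \<in> carrier H\<rbrakk> \<Longrightarrow> act (h \<otimes> k) v = act h (act k v)"

locale hopf_module_voa = voa V + hopf_module H "vscale V" act
  for H :: "('h::ab_group_add, 'y) hopf_scheme" (structure)
    and V :: "('v::ab_group_add, 'z) voa_data_scheme"
    and act :: "'h \<Rightarrow> 'v \<Rightarrow> 'v" +
  assumes act_conf: "h \<in> carrier H \<Longrightarrow> act h (conf V) = vscale V (counit H h) (conf V)"
    and act_mode: "\<lbrakk>h \<in> carrier H; t \<in> comult H h\<rbrakk> \<Longrightarrow>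
      act h (mode V u n v) = lin_ext (vscale V) (\<lambda>(a, b). mode V (act a u) n (act b v)) t"

definition faithful_action :: "('h::ab_group_add, 'z) hopf_scheme \<Rightarrow> ('h \<Rightarrow> 'v::zero \<Rightarrow> 'v) \<Rightarrow> bool"
  where "faithful_action H act \<longleftrightarrow> \<not> (\<exists>h\<in>carrier H. h \<noteq> 0 \<and> (\<forall>v. act h v = 0))"

definition inner_faithful :: "('h::ab_group_add, 'z) hopf_scheme \<Rightarrow> ('h \<Rightarrow> 'v::zero \<Rightarrow> 'v) \<Rightarrow> bool"
  where "inner_faithful H act \<longleftrightarrow>
    (\<forall>I. hopf_ideal H I \<and> I \<noteq> {0} \<longrightarrow> (\<exists>h\<in>I. \<exists>v. act h v \<noteq> 0))"

definition submodule ::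
  "('h, 'z) hopf_scheme \<Rightarrow> (complex \<Rightarrow> 'v \<Rightarrow> 'v::ab_group_add) \<Rightarrow> ('h \<Rightarrow> 'v \<Rightarrow> 'v) \<Rightarrow> 'v set \<Rightarrow> bool"
  where "submodule H s act W \<longleftrightarrow>
    module.subspace s W \<and> (\<forall>h\<in>carrier H. \<forall>w\<in>W. act h w \<in> W)"

definition simple_submodule ::
  "('h, 'z) hopf_scheme \<Rightarrow> (complex \<Rightarrow> 'v \<Rightarrow> 'v::ab_group_add) \<Rightarrow> ('h \<Rightarrow> 'v \<Rightarrow> 'v) \<Rightarrow> 'v set \<Rightarrow> bool"
  where "simple_submodule H s act W \<longleftrightarrow>
    submodule H s act W \<and> W \<noteq> {0} \<and>
    (\<forall>W'. submodule H s act W' \<and> W' \<subseteq> W \<longrightarrow> W' = {0} \<or> W' = W)"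

definition semisimple_module ::
  "('h, 'z) hopf_scheme \<Rightarrow> (complex \<Rightarrow> 'v \<Rightarrow> 'v::ab_group_add) \<Rightarrow> ('h \<Rightarrow> 'v \<Rightarrow> 'v) \<Rightarrow> bool"
  where "semisimple_module H s act \<longleftrightarrow>
    (\<exists>\<S>. (\<forall>W\<in>\<S>. simple_submodule H s act W) \<and> is_direct_sum \<S> (\<lambda>W. W))"

end

theory Submission
  imports Defs "HOL-Computational_Algebra.Fundamental_Theorem_Algebra"
begin

text \<open>Let \<open>K\<close> be the annihilator of \<open>V\<close> in \<open>H\<close>. Since \<open>V\<close> is simple, \<open>\<Sum> Y(u\<^sub>k, z) v\<^sub>k = 0\<close> forces
  \<open>\<Sum> u\<^sub>k \<otimes> v\<^sub>k = 0\<close> (Dong and Mason). Applied to \<open>h Y(u, z) v = \<Sum> Y(h\<^sub>1 u, z) h\<^sub>2 v\<close> with \<open>h \<in> K\<close>, this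
  shows that \<open>\<Delta>(K)\<close> is contained in \<open>H \<otimes> K + K \<otimes> H\<close>. In finite dimension the convolution powers
  \<open>h \<mapsto> \<Sum> h\<^sub>1 \<cdots> h\<^sub>n\<close> of the identity satisfy a linear relation in which \<open>n = 0\<close> occurs. It expresses
  \<open>\<epsilon>(h) 1\<close> through the powers with \<open>n \<ge> 1\<close>, which preserve \<open>K\<close>, so \<open>\<epsilon>\<close> vanishes on the proper ideal
  \<open>K\<close>; convolved with \<open>S\<close> it expresses \<open>S\<close> through the powers with \<open>n \<ge> 0\<close>, so \<open>S(K) \<subseteq> K\<close>. Thus \<open>K\<close> is a
  Hopf ideal and inner faithfulness gives \<open>K = 0\<close>. Skew symmetry, together with the fact that
  \<open>H\<close> commutes with \<open>L(- 1)\<close>, shows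
  \<open>\<Sum> Y(h\<^sub>1 u, z) h\<^sub>2 v = \<Sum> Y(h\<^sub>2 u, z) h\<^sub>1 v\<close>; hence \<open>H\<close> is cocommutative. A finite dimensional
  cocommutative Hopf algebra over the complex numbers is spanned by its grouplikes, because it has
  no nonzero primitive elements.\<close>

section \<open>Linear maps on subspaces and linear extensions\<close>

text \<open>Tensors over \<open>H\<close> are handled by duality. In finite dimension an element of
  the tensor square is determined by its values under pairs of functionals, and H \<otimes> K + K
  \<otimes> H consists of the tensors killed by all pairs vanishing on \<open>K\<close>; what vertex
  operators say about the comultiplication is therefore proved for such pairs only. Slicing the
  second factor of the comultiplication by functionals makes \<open>H\<close> a module over its dual
  convolution algebra, which is commutative when \<open>H\<close> is cocommutative. A grouplike
  element is a common eigenvector of the slices whose eigenvalue is evaluation at the element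
  itself, so the search for grouplikes becomes simultaneous triangularization. The obstacle is that
  the slices might not be diagonalizable; the off-diagonal part either splits off or leaves a
  primitive element, and characteristic zero excludes the latter. On the vertex algebra side the
  obstacle is the infinite dimension of \<open>V\<close>: Schur's lemma needs an eigenvalue, and it
  is found in the weight zero space.\<close>

lemma linear_onI:
  assumes "\<And>x y. x \<in> A \<Longrightarrow> y \<in> A \<Longrightarrow> f (x + y) = f x + f y"
    and "\<And>c x. x \<in> A \<Longrightarrow> f (s c x) = s' c (f x)"
  shows "linear_on A s s' f"
  using assms by (simp add: linear_on_def)

lemma linear_on_add: "linear_on A s s' f \<Longrightarrow> x \<in> A \<Longrightarrow> y \<in> A \<Longrightarrow> f (x + y) = f x + f y"
  and linear_on_scale: "linear_on A s s' f \<Longrightarrow> x \<in> A \<Longrightarrow> f (s c x) = s' c (f x)"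
  by (simp_all add: linear_on_def)

lemma linear_on_subset: "linear_on A s s' f \<Longrightarrow> B \<subseteq> A \<Longrightarrow> linear_on B s s' f"
  unfolding linear_on_def by blast

lemma linear_imp_linear_on: "Vector_Spaces.linear s s' f \<Longrightarrow> linear_on A s s' f"
  by (auto simp: linear_on_def Vector_Spaces.linear_iff)

lemma vector_space_complex: "vector_space ((*) :: complex \<Rightarrow> complex \<Rightarrow> complex)"
  by unfold_locales (auto simp: algebra_simps)

lemma linear_on_zero:
  assumes "vector_space s" "vector_space s'" "linear_on A s s' f" "module.subspace s A"
  shows "f 0 = 0"
proof -
  interpret S: vector_space s by fact
  interpret S': vector_space s' by fact
  have "0 \<in> A" using assms(4) by (rule S.subspace_0)
  then have "f (s 0 0) = s' 0 (f 0)" using assms(3) by (rule linear_on_scale[rotated])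
  then show ?thesis by simp
qed

lemma linear_on_sum:
  assumes "vector_space s" "vector_space s'" "linear_on A s s' f" "module.subspace s A"
    and "\<And>i. i \<in> I \<Longrightarrow> g i \<in> A"
  shows "f (sum g I) = (\<Sum>i\<in>I. f (g i))"
proof -
  interpret S: vector_space s by fact
  show ?thesis using assms(5)
  proof (induction I rule: infinite_finite_induct)
    case (insert i I)
    then have "sum g I \<in> A" by (intro S.subspace_sum[OF assms(4)]) auto
    with insert show ?case using assms(3) by (simp add: linear_on_add)
  qed (simp_all add: linear_on_zero[OF assms(1-4)])
qed

lemma linear_on_diff:
  assumes "vector_space s" "vector_space s'" "linear_on A s s' f" "module.subspace s A"
    and "x \<in> A" "y \<in> A"
  shows "f (x - y) = f x - f y"
proof -
  interpret S: vector_space s by fact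
  have "f (x - y + y) = f (x - y) + f y"
    using assms S.subspace_diff by (intro linear_on_add[OF assms(3)]) auto
  then show ?thesis by simp
qed

lemma subspace_linear_on_vimage:
  assumes "vector_space s" "vector_space s'" "linear_on A s s' f" "module.subspace s A"
    and "module.subspace s' W"
  shows "module.subspace s {x \<in> A. f x \<in> W}"
proof -
  interpret S: vector_space s by fact
  interpret S': vector_space s' by fact
  show ?thesis
    using assms(3-5) linear_on_zero[OF assms(1-4)]
    by (auto simp: S.subspace_def S'.subspace_def linear_on_def)
qed

lemma lookup_free_scale: "Poly_Mapping.lookup (free_scale c t) k = c * Poly_Mapping.lookup t k"
  unfolding free_scale_def by (simp add: Poly_Mapping.map.rep_eq when_def)

lemma vector_space_free_scale: "vector_space free_scale"
  by unfold_locales (auto intro!: poly_mapping_eqI simp: lookup_free_scale lookup_add algebra_simps)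

interpretation free: vector_space "free_scale :: complex \<Rightarrow> ('b \<Rightarrow>\<^sub>0 complex) \<Rightarrow> ('b \<Rightarrow>\<^sub>0 complex)"
  by (rule vector_space_free_scale)

lemma free_scale_single: "free_scale c (Poly_Mapping.single k d) = Poly_Mapping.single k (c * d)"
  by (auto intro!: poly_mapping_eqI simp: lookup_free_scale lookup_single when_def)

lemma subspace_keys: "module.subspace free_scale {t. Poly_Mapping.keys t \<subseteq> K}"
  by (auto simp: free.subspace_def in_keys_iff lookup_free_scale lookup_add subset_iff)
    (metis add.right_neutral)


lemma lin_ext_superset:
  assumes "vector_space s" "finite S" "Poly_Mapping.keys t \<subseteq> S"
  shows "lin_ext s f t = (\<Sum>k\<in>S. s (Poly_Mapping.lookup t k) (f k))"
proof -
  interpret S: vector_space s by fact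
  show ?thesis unfolding lin_ext_def
    using assms(2,3) by (intro sum.mono_neutral_left) (auto simp: in_keys_iff)
qed

lemma lin_ext_cong: "(\<And>k. k \<in> Poly_Mapping.keys t \<Longrightarrow> f k = g k) \<Longrightarrow> lin_ext s f t = lin_ext s g t"
  unfolding lin_ext_def by (rule sum.cong) auto

lemma lin_ext_single:
  assumes "vector_space s"
  shows "lin_ext s f (Poly_Mapping.single k c) = s c (f k)"
proof -
  interpret S: vector_space s by fact
  show ?thesis by (simp add: lin_ext_superset[OF assms, of "{k}"])
qed

lemma linear_lin_ext:
  assumes "vector_space s"
  shows "Vector_Spaces.linear free_scale s (lin_ext s f)"
proof -
  interpret S: vector_space s by fact
  have "lin_ext s f (t + u) = lin_ext s f t + lin_ext s f u" for t u
  proof -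
    let ?S = "Poly_Mapping.keys t \<union> Poly_Mapping.keys u"
    have "Poly_Mapping.keys (t + u) \<subseteq> ?S" by (rule keys_add)
    then show ?thesis
      by (simp add: lin_ext_superset[OF assms, of ?S] lookup_add S.scale_left_distrib sum.distrib)
  qed
  moreover have "lin_ext s f (free_scale c t) = s c (lin_ext s f t)" for c t
  proof -
    have "Poly_Mapping.keys (free_scale c t) \<subseteq> Poly_Mapping.keys t"
      by (auto simp: in_keys_iff lookup_free_scale)
    then show ?thesis
      by (simp add: lin_ext_superset[OF assms, of "Poly_Mapping.keys t"] lookup_free_scale S.scale_sum_right)
  qed
  ultimately show ?thesis
    using assms vector_space_free_scale by (simp add: Vector_Spaces.linear_iff)
qed

lemma linear_on_lin_ext: "vector_space s \<Longrightarrow> linear_on A free_scale s (lin_ext s f)"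
  by (intro linear_imp_linear_on linear_lin_ext)

lemma lin_ext_in_subspace:
  assumes "vector_space s" "module.subspace s W" "\<And>k. k \<in> Poly_Mapping.keys t \<Longrightarrow> f k \<in> W"
  shows "lin_ext s f t \<in> W"
proof -
  interpret S: vector_space s by fact
  show ?thesis unfolding lin_ext_def
    using assms by (intro S.subspace_sum S.subspace_scale) auto
qed

lemma linear_on_lin_ext_apply:
  assumes "vector_space s" "vector_space s'" "linear_on W s s' \<phi>" "module.subspace s W"
    and "\<And>k. k \<in> Poly_Mapping.keys t \<Longrightarrow> f k \<in> W"
  shows "\<phi> (lin_ext s f t) = lin_ext s' (\<lambda>k. \<phi> (f k)) t"
proof -
  interpret S: vector_space s by fact
  show ?thesis unfolding lin_ext_def
    using assms S.subspace_scale
    by (subst linear_on_sum[OF assms(1-4)]) (auto simp: linear_on_scale[OF assms(3)])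
qed

lemma lin_ext_lin_ext:
  "vector_space s \<Longrightarrow>
    lin_ext s g (lin_ext free_scale F t) = lin_ext s (\<lambda>k. lin_ext s g (F k)) t"
  by (rule linear_on_lin_ext_apply[OF vector_space_free_scale _ linear_on_lin_ext[where A = UNIV]]) auto

lemma lin_ext_add_fun:
  assumes "vector_space s"
  shows "lin_ext s (\<lambda>k. f k + g k) t = lin_ext s f t + lin_ext s g t"
proof -
  interpret S: vector_space s by fact
  show ?thesis by (simp add: lin_ext_def S.scale_right_distrib sum.distrib)
qed

lemma lin_ext_scale_fun:
  assumes "vector_space s"
  shows "lin_ext s (\<lambda>k. s c (f k)) t = s c (lin_ext s f t)"
proof -
  interpret S: vector_space s by fact
  show ?thesis by (simp add: lin_ext_def S.scale_sum_right mult.commute)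
qed

lemma lin_ext_zero_fun:
  assumes "vector_space s"
  shows "lin_ext s (\<lambda>k. 0) t = 0"
proof -
  interpret S: vector_space s by fact
  show ?thesis by (simp add: lin_ext_def)
qed

lemma lin_ext_sum_fun:
  assumes "vector_space s"
  shows "lin_ext s (\<lambda>k. \<Sum>i\<in>I. f i k) t = (\<Sum>i\<in>I. lin_ext s (f i) t)"
proof -
  interpret S: vector_space s by fact
  show ?thesis by (simp add: lin_ext_def S.scale_sum_right) (rule sum.swap)
qed

lemma lin_ext_free_gen: "lin_ext free_scale free_gen t = t"
proof (rule poly_mapping_eqI)
  fix k
  have "(\<Sum>x\<in>Poly_Mapping.keys t. Poly_Mapping.lookup t x * (if x = k then 1 else 0)) =
      (\<Sum>x\<in>Poly_Mapping.keys t. if x = k then Poly_Mapping.lookup t x else 0)"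
    by (rule sum.cong) auto
  then show "Poly_Mapping.lookup (lin_ext free_scale free_gen t) k = Poly_Mapping.lookup t k"
    by (simp add: lin_ext_def lookup_sum lookup_free_scale lookup_single when_def in_keys_iff)
qed

section \<open>Bilinear and trilinear maps on tensors\<close>

definition bilinear_on ::
  "'a set \<Rightarrow> (complex \<Rightarrow> 'a \<Rightarrow> 'a) \<Rightarrow> (complex \<Rightarrow> 'b \<Rightarrow> 'b) \<Rightarrow>
    ('a::ab_group_add \<Rightarrow> 'a \<Rightarrow> 'b::ab_group_add) \<Rightarrow> bool"
  where "bilinear_on A s s' \<beta> \<longleftrightarrow>
    (\<forall>x\<in>A. linear_on A s s' (\<beta> x) \<and> linear_on A s s' (\<lambda>y. \<beta> y x))"

definition trilinear_on ::
  "'a set \<Rightarrow> (complex \<Rightarrow> 'a \<Rightarrow> 'a) \<Rightarrow> (complex \<Rightarrow> 'b \<Rightarrow> 'b) \<Rightarrow>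
    ('a::ab_group_add \<Rightarrow> 'a \<Rightarrow> 'a \<Rightarrow> 'b::ab_group_add) \<Rightarrow> bool"
  where "trilinear_on A s s' \<tau> \<longleftrightarrow>
    (\<forall>x\<in>A. \<forall>y\<in>A. linear_on A s s' (\<lambda>z. \<tau> z x y) \<and> linear_on A s s' (\<lambda>z. \<tau> x z y) \<and>
      linear_on A s s' (\<lambda>z. \<tau> x y z))"

text \<open>A bilinear map kills the defining relations, hence factors through the tensor square.
  This makes sums over a Sweedler expression independent of the expression.\<close>

lemma lin_ext_rels2:
  assumes "vector_space s'" "bilinear_on A s s' \<beta>" "r \<in> module.span free_scale (rels2 s A)"
  shows "lin_ext s' (\<lambda>(a, b). \<beta> a b) r = 0"
proof -
  interpret S': vector_space s' by fact
  interpret L: Vector_Spaces.linear free_scale s' "lin_ext s' (\<lambda>(a, b). \<beta> a b)" by (rule linear_lin_ext) fact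
  have "lin_ext s' (\<lambda>(a, b). \<beta> a b) x = 0" if "x \<in> rels2 s A" for x
    using that assms(2)
    by (auto simp: rels2_def bilinear_on_def linear_on_def L.diff L.scale lin_ext_single[OF assms(1)])
  then show ?thesis using L.eq_0_on_span assms(3) by blast
qed

lemma lin_ext_rels3:
  assumes "vector_space s'" "trilinear_on A s s' \<tau>" "r \<in> module.span free_scale (rels3 s A)"
  shows "lin_ext s' (\<lambda>(a, b, c). \<tau> a b c) r = 0"
proof -
  interpret S': vector_space s' by fact
  interpret L: Vector_Spaces.linear free_scale s' "lin_ext s' (\<lambda>(a, b, c). \<tau> a b c)" by (rule linear_lin_ext) fact
  have "lin_ext s' (\<lambda>(a, b, c). \<tau> a b c) x = 0" if "x \<in> rels3 s A" for x
    using that assms(2)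
    by (auto simp: rels3_def trilinear_on_def linear_on_def L.diff L.scale lin_ext_single[OF assms(1)])
  then show ?thesis using L.eq_0_on_span assms(3) by blast
qed

lemma lin_ext_tensor2:
  assumes "vector_space s'" "bilinear_on A s s' \<beta>" "u \<in> tensor2 s A t"
  shows "lin_ext s' (\<lambda>(a, b). \<beta> a b) u = lin_ext s' (\<lambda>(a, b). \<beta> a b) t"
proof -
  interpret L: Vector_Spaces.linear free_scale s' "lin_ext s' (\<lambda>(a, b). \<beta> a b)" by (rule linear_lin_ext) fact
  show ?thesis
    using lin_ext_rels2[OF assms(1,2), of "u - t"] assms(3) by (simp add: tensor2_def L.diff)
qed

lemma lin_ext_tensor3:
  assumes "vector_space s'" "trilinear_on A s s' \<tau>" "tensor3 s A u = tensor3 s A t"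
  shows "lin_ext s' (\<lambda>(a, b, c). \<tau> a b c) u = lin_ext s' (\<lambda>(a, b, c). \<tau> a b c) t"
proof -
  interpret L: Vector_Spaces.linear free_scale s' "lin_ext s' (\<lambda>(a, b, c). \<tau> a b c)" by (rule linear_lin_ext) fact
  have "u \<in> tensor3 s A u" by (simp add: tensor3_def free.span_zero)
  then have "u - t \<in> module.span free_scale (rels3 s A)"
    unfolding assms(3) by (simp add: tensor3_def)
  then show ?thesis
    using lin_ext_rels3[OF assms(1,2), of "u - t"] by (simp add: L.diff)
qed

text \<open>The relations involve only pairs from \<open>A\<close>, so passing to another member of
  a coset never leaves \<open>A \<times> A\<close>. Carrier facts thus become available for every
  Sweedler expression.\<close>

lemma keys_rels2:
  assumes "vector_space s" "module.subspace s A" "r \<in> module.span free_scale (rels2 s A)"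
  shows "Poly_Mapping.keys r \<subseteq> A \<times> A"
proof -
  interpret S: vector_space s by fact
  note [simp] = S.subspace_add[OF assms(2)] S.subspace_scale[OF assms(2)]
  have gen: "free_gen p \<in> {t. Poly_Mapping.keys t \<subseteq> A \<times> A}" if "p \<in> A \<times> A" for p
    using that by simp
  note sub = subspace_keys[of "A \<times> A"]
  have "rels2 s A \<subseteq> {t. Poly_Mapping.keys t \<subseteq> A \<times> A}"
    unfolding rels2_def
    by (intro Un_least subsetI;
        (elim CollectE exE conjE; hypsubst;
         intro free.subspace_diff[OF sub] free.subspace_scale[OF sub] gen; simp))
  then show ?thesis using free.span_minimal[OF _ sub] assms(3) by blast
qed

lemma keys_tensor2:
  assumes "vector_space s" "module.subspace s A" "Poly_Mapping.keys t \<subseteq> A \<times> A" "u \<in> tensor2 s A t"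
  shows "Poly_Mapping.keys u \<subseteq> A \<times> A"
proof -
  have "Poly_Mapping.keys (u - t) \<subseteq> A \<times> A"
    using keys_rels2[OF assms(1,2)] assms(4) by (simp add: tensor2_def)
  then have "(u - t) + t \<in> {t. Poly_Mapping.keys t \<subseteq> A \<times> A}"
    using assms(3) by (intro free.subspace_add[OF subspace_keys]) auto
  then show ?thesis by simp
qed

section \<open>Linear functionals and tensors\<close>

context vector_space
begin

text \<open>\<open>B\<close> is adapted to \<open>K\<close>: the coordinates at elements of
  \<open>B - C\<close> are functionals vanishing on \<open>K\<close>, which is what the test for
  coideals needs.\<close>

lemma finite_basis_of_finite_dim:
  assumes "subspace A" "finite T" "T \<subseteq> A" "span T = A" "K \<subseteq> A" "subspace K"
  obtains C B where "C \<subseteq> B" "finite B" "B \<subseteq> A" "independent B" "span B = A" "C \<subseteq> K" "span C = K"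
proof -
  obtain C where C: "C \<subseteq> K" "independent C" "K \<subseteq> span C"
    using maximal_independent_subset by blast
  obtain B where B: "C \<subseteq> B" "B \<subseteq> A" "independent B" "A \<subseteq> span B"
    using maximal_independent_subset_extend C assms(5) by (metis subset_trans)
  have "finite B" using independent_span_bound[OF assms(2) B(3)] B(2) assms(4) by blast
  moreover have "span B = A" using B assms(1) by (simp add: span_subspace)
  moreover have "span C = K" using C assms(6) by (simp add: span_subspace)
  ultimately show thesis using that B C by blast
qed

lemma representation_span_subset:
  assumes "independent B" "C \<subseteq> B" "x \<in> span C" "b \<notin> C"
  shows "representation B x b = 0"
proof -
  have "representation B x = representation C x"
    using assms by (intro representation_extend)
  then show ?thesis using assms(4) representation_ne_zero by metis
qed

lemma sum_representation:
  assumes "independent B" "finite B" "x \<in> span B"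
  shows "(\<Sum>b\<in>B. scale (representation B x b) b) = x"
  using sum_representation_eq[OF assms(1,3,2)] by auto

end

lemma linear_on_representation:
  assumes "vector_space s" "\<not> module.dependent s B" "module.span s B = A"
  shows "linear_on A s (*) (\<lambda>x. module.representation s B x b)"
proof -
  interpret S: vector_space s by fact
  show ?thesis
    using assms by (auto simp: linear_on_def S.representation_add S.representation_scale)
qed

lemma tensor2_expand_left:
  assumes "vector_space s" "module.subspace s A" "finite I" "I \<subseteq> A" "b \<in> A"
  shows "free_gen (\<Sum>i\<in>I. s (c i) i, b) - (\<Sum>i\<in>I. free_scale (c i) (free_gen (i, b)))
    \<in> module.span free_scale (rels2 s A)"
  using assms(3,4)
proof (induction I rule: finite_induct)
  interpret S: vector_space s by fact
  case empty
  \<comment> \<open>The homogeneity relation for the scalar \<open>0\<close> says that the pure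
    tensor of \<open>0\<close> and \<open>b\<close> is zero, which is the case of the empty
    sum.\<close>
  have "free_gen (s 0 b, b) - free_scale 0 (free_gen (b, b)) \<in> rels2 s A"
    using assms(5) unfolding rels2_def by blast
  then show ?case by (simp add: free.span_base)
next
  interpret S: vector_space s by fact
  case (insert i I)
  let ?x = "\<Sum>i\<in>I. s (c i) i"
  have i: "i \<in> A" using insert by simp
  have x: "?x \<in> A"
    using insert by (intro S.subspace_sum[OF assms(2)] S.subspace_scale[OF assms(2)]) auto
  have "free_gen (s (c i) i + ?x, b) - free_gen (s (c i) i, b) - free_gen (?x, b) \<in> rels2 s A"
    using i x assms(5) S.subspace_scale[OF assms(2)] unfolding rels2_def by blast
  moreover have "free_gen (s (c i) i, b) - free_scale (c i) (free_gen (i, b)) \<in> rels2 s A"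
    using i assms(5) unfolding rels2_def by blast
  ultimately have "(free_gen (s (c i) i + ?x, b) - free_gen (s (c i) i, b) - free_gen (?x, b)) +
      (free_gen (s (c i) i, b) - free_scale (c i) (free_gen (i, b))) +
      (free_gen (?x, b) - (\<Sum>i\<in>I. free_scale (c i) (free_gen (i, b))))
      \<in> module.span free_scale (rels2 s A)"
    using insert by (intro free.span_add) (auto intro: free.span_base)
  then show ?case using insert by (simp add: algebra_simps)
qed

lemma tensor2_expand_right:
  assumes "vector_space s" "module.subspace s A" "finite I" "I \<subseteq> A" "b \<in> A"
  shows "free_gen (b, \<Sum>i\<in>I. s (c i) i) - (\<Sum>i\<in>I. free_scale (c i) (free_gen (b, i)))
    \<in> module.span free_scale (rels2 s A)"
  using assms(3,4)
proof (induction I rule: finite_induct)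
  interpret S: vector_space s by fact
  case empty
  have "free_gen (b, s 0 b) - free_scale 0 (free_gen (b, b)) \<in> rels2 s A"
    using assms(5) unfolding rels2_def by blast
  then show ?case by (simp add: free.span_base)
next
  interpret S: vector_space s by fact
  case (insert i I)
  let ?x = "\<Sum>i\<in>I. s (c i) i"
  have i: "i \<in> A" using insert by simp
  have x: "?x \<in> A"
    using insert by (intro S.subspace_sum[OF assms(2)] S.subspace_scale[OF assms(2)]) auto
  have "free_gen (b, s (c i) i + ?x) - free_gen (b, s (c i) i) - free_gen (b, ?x) \<in> rels2 s A"
    using i x assms(5) S.subspace_scale[OF assms(2)] unfolding rels2_def by blast
  moreover have "free_gen (b, s (c i) i) - free_scale (c i) (free_gen (b, i)) \<in> rels2 s A"
    using i assms(5) unfolding rels2_def by blast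
  ultimately have "(free_gen (b, s (c i) i + ?x) - free_gen (b, s (c i) i) - free_gen (b, ?x)) +
      (free_gen (b, s (c i) i) - free_scale (c i) (free_gen (b, i))) +
      (free_gen (b, ?x) - (\<Sum>i\<in>I. free_scale (c i) (free_gen (b, i))))
      \<in> module.span free_scale (rels2 s A)"
    using insert by (intro free.span_add) (auto intro: free.span_base)
  then show ?case using insert by (simp add: algebra_simps)
qed

text \<open>Modulo the relations a tensor equals the matrix of its values under pairs of coordinate
  functionals. Both duality tests for the comultiplication rest on this.\<close>

lemma tensor2_expand:
  assumes "vector_space s" "module.subspace s A" "finite B" "B \<subseteq> A" "module.span s B = A"
    and "\<not> module.dependent s B" "Poly_Mapping.keys u \<subseteq> A \<times> A"
  defines "rep \<equiv> module.representation s B"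
  shows "u - (\<Sum>(i, j)\<in>B \<times> B.
      free_scale (lin_ext (*) (\<lambda>(a, b). rep a i * rep b j) u) (free_gen (i, j)))
    \<in> module.span free_scale (rels2 s A)"
proof -
  interpret S: vector_space s by fact
  let ?R = "module.span free_scale (rels2 s A)"
  let ?E = "\<lambda>a b. \<Sum>i\<in>B. \<Sum>j\<in>B. free_scale (rep a i * rep b j) (free_gen (i, j))"
  have pure: "free_gen (a, b) - ?E a b \<in> ?R" if ab: "a \<in> A" "b \<in> A" for a b
  proof -
    have sum: "(\<Sum>i\<in>B. s (rep x i) i) = x" if "x \<in> A" for x
      using S.sum_representation assms that by simp
    have 1: "free_gen (a, b) - (\<Sum>i\<in>B. free_scale (rep a i) (free_gen (i, b))) \<in> ?R"
      using tensor2_expand_left[OF assms(1-4) ab(2), of "rep a"] sum ab by simp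
    have "free_gen (i, b) - (\<Sum>j\<in>B. free_scale (rep b j) (free_gen (i, j))) \<in> ?R" if "i \<in> B" for i
      using tensor2_expand_right[OF assms(1-4), of i "rep b"] sum ab assms(4) that by auto
    then have "(\<Sum>i\<in>B. free_scale (rep a i)
        (free_gen (i, b) - (\<Sum>j\<in>B. free_scale (rep b j) (free_gen (i, j))))) \<in> ?R"
      by (intro free.span_sum free.span_scale)
    also have "(\<Sum>i\<in>B. free_scale (rep a i)
        (free_gen (i, b) - (\<Sum>j\<in>B. free_scale (rep b j) (free_gen (i, j))))) =
        (\<Sum>i\<in>B. free_scale (rep a i) (free_gen (i, b))) - ?E a b"
      by (simp add: free.scale_right_diff_distrib free.scale_sum_right sum_subtractf)
    finally have 2: "(\<Sum>i\<in>B. free_scale (rep a i) (free_gen (i, b))) - ?E a b \<in> ?R" .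
    show ?thesis using free.span_add[OF 1 2] by simp
  qed
  have "lin_ext free_scale (\<lambda>(a, b). free_gen (a, b) - ?E a b) u \<in> ?R"
    by (rule lin_ext_in_subspace[OF vector_space_free_scale]) (use assms(7) pure in auto)
  \<comment> \<open>The difference is written as a sum with scalar \<open>- 1\<close>, the shape in
    which linearity of \<open>lin_ext\<close> in its function argument applies.\<close>
  also have "(\<lambda>(a, b). free_gen (a, b) - ?E a b) =
      (\<lambda>k. free_gen k + free_scale (-1) (\<Sum>(i, j)\<in>B \<times> B.
         free_scale (rep (fst k) i * rep (snd k) j) (free_gen (i, j))))"
    by (auto simp: fun_eq_iff sum.cartesian_product)
  also have "lin_ext free_scale \<dots> u = u + free_scale (-1) (\<Sum>p\<in>B \<times> B.
      lin_ext free_scale (\<lambda>k. case p of (i, j) \<Rightarrow> free_scale (rep (fst k) i * rep (snd k) j) (free_gen (i, j))) u)"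
    by (simp only: lin_ext_add_fun[OF vector_space_free_scale] lin_ext_scale_fun[OF vector_space_free_scale]
        lin_ext_sum_fun[OF vector_space_free_scale] lin_ext_free_gen)
  also have "(\<Sum>p\<in>B \<times> B.
      lin_ext free_scale (\<lambda>k. case p of (i, j) \<Rightarrow> free_scale (rep (fst k) i * rep (snd k) j) (free_gen (i, j))) u) =
      (\<Sum>(i, j)\<in>B \<times> B.
      free_scale (lin_ext (*) (\<lambda>(a, b). rep a i * rep b j) u) (free_gen (i, j)))"
    by (rule sum.cong) (auto simp: lin_ext_def free.scale_sum_left case_prod_beta)
  finally show ?thesis by simp
qed

section \<open>Sweedler calculus\<close>

sublocale hopf_algebra \<subseteq> VS: vector_space "hscale H"
  by (rule vector_space_scale)

context hopf_algebra
begin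

abbreviation dual :: "('h \<Rightarrow> complex) \<Rightarrow> bool"
  where "dual \<equiv> linear_on (carrier H) (hscale H) (*)"

text \<open>The Sweedler sum \<open>\<Sum> \<beta> h\<^sub>1 h\<^sub>2\<close>. For bilinear \<open>\<beta>\<close> the chosen expression does not matter.\<close>

definition sw :: "(complex \<Rightarrow> 'b \<Rightarrow> 'b::ab_group_add) \<Rightarrow> ('h \<Rightarrow> 'h \<Rightarrow> 'b) \<Rightarrow> 'h \<Rightarrow> 'b"
  where "sw s \<beta> h = lin_ext s (\<lambda>(a, b). \<beta> a b) (SOME t. t \<in> comult H h)"

section \<open>Linear structure of the carrier and its functionals\<close>

lemma carrier_add [simp]: "x \<in> carrier H \<Longrightarrow> y \<in> carrier H \<Longrightarrow> x + y \<in> carrier H"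
  and carrier_scale [simp]: "x \<in> carrier H \<Longrightarrow> hscale H c x \<in> carrier H"
  and carrier_zero [simp]: "0 \<in> carrier H"
  and carrier_diff [simp]: "x \<in> carrier H \<Longrightarrow> y \<in> carrier H \<Longrightarrow> x - y \<in> carrier H"
  and carrier_sum: "(\<And>i. i \<in> I \<Longrightarrow> f i \<in> carrier H) \<Longrightarrow> sum f I \<in> carrier H"
  by (auto intro: VS.subspace_add[OF subspace_carrier] VS.subspace_scale[OF subspace_carrier]
      VS.subspace_0[OF subspace_carrier] VS.subspace_diff[OF subspace_carrier]
      VS.subspace_sum[OF subspace_carrier])

lemma mult_add_left [simp]:
    "\<lbrakk>x \<in> carrier H; y \<in> carrier H; z \<in> carrier H\<rbrakk> \<Longrightarrow> (x + y) \<otimes> z = x \<otimes> z + y \<otimes> z"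
  and mult_add_right [simp]:
    "\<lbrakk>x \<in> carrier H; y \<in> carrier H; z \<in> carrier H\<rbrakk> \<Longrightarrow> z \<otimes> (x + y) = z \<otimes> x + z \<otimes> y"
  and mult_scale_left [simp]:
    "\<lbrakk>x \<in> carrier H; z \<in> carrier H\<rbrakk> \<Longrightarrow> hscale H c x \<otimes> z = hscale H c (x \<otimes> z)"
  and mult_scale_right [simp]:
    "\<lbrakk>x \<in> carrier H; z \<in> carrier H\<rbrakk> \<Longrightarrow> z \<otimes> hscale H c x = hscale H c (z \<otimes> x)"
  using mult_linear_left mult_linear_right by (auto simp: linear_on_def)

lemma mult_sum_right:
    "\<lbrakk>\<And>i. i \<in> I \<Longrightarrow> f i \<in> carrier H; z \<in> carrier H\<rbrakk> \<Longrightarrow> z \<otimes> sum f I = (\<Sum>i\<in>I. z \<otimes> f i)"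
  and mult_diff_left:
    "\<lbrakk>x \<in> carrier H; y \<in> carrier H; z \<in> carrier H\<rbrakk> \<Longrightarrow> (x - y) \<otimes> z = x \<otimes> z - y \<otimes> z"
  by (auto intro: linear_on_sum[OF vector_space_scale vector_space_scale mult_linear_right subspace_carrier]
      linear_on_diff[OF vector_space_scale vector_space_scale mult_linear_left subspace_carrier])

lemma dual_zero: "dual f \<Longrightarrow> f 0 = 0"
  by (rule linear_on_zero[OF vector_space_scale vector_space_complex _ subspace_carrier])

lemma dual_sum: "dual f \<Longrightarrow> (\<And>i. i \<in> I \<Longrightarrow> g i \<in> carrier H) \<Longrightarrow> f (sum g I) = (\<Sum>i\<in>I. f (g i))"
  by (rule linear_on_sum[OF vector_space_scale vector_space_complex _ subspace_carrier])

lemma dual_diff: "dual f \<Longrightarrow> x \<in> carrier H \<Longrightarrow> y \<in> carrier H \<Longrightarrow> f (x - y) = f x - f y"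
  by (rule linear_on_diff[OF vector_space_scale vector_space_complex _ subspace_carrier])

lemma dual_add: "dual f \<Longrightarrow> x \<in> carrier H \<Longrightarrow> y \<in> carrier H \<Longrightarrow> f (x + y) = f x + f y"
  by (rule linear_on_add)

lemma dual_scale: "dual f \<Longrightarrow> x \<in> carrier H \<Longrightarrow> f (hscale H c x) = c * f x"
  by (rule linear_on_scale)

text \<open>Coordinates with respect to a basis are functionals, and they already separate
  points.\<close>

lemma dual_eqI:
  assumes "x \<in> carrier H" "y \<in> carrier H" "\<And>f. dual f \<Longrightarrow> f x = f y"
  shows "x = y"
proof -
  obtain B where B: "B \<subseteq> carrier H" "\<not> VS.dependent B" "carrier H \<subseteq> VS.span B"
    using VS.maximal_independent_subset by blast
  then have "VS.span B = carrier H"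
    by (simp add: VS.span_subspace subspace_carrier)
  then have "VS.representation B x = VS.representation B y"
    using assms(3)[OF linear_on_representation[OF vector_space_scale B(2)]] by (auto simp: fun_eq_iff)
  then show ?thesis
    using VS.sum_nonzero_representation_eq[OF B(2)] B(3) assms(1,2) by (metis subsetD)
qed

section \<open>Sweedler expressions and Sweedler sums\<close>

lemma comult_form:
  assumes "h \<in> carrier H"
  obtains t where "Poly_Mapping.keys t \<subseteq> carrier H \<times> carrier H"
    "comult H h = tensor2 (hscale H) (carrier H) t"
  using comult_closed[OF assms] by (auto simp: tensor_square_def)

lemma comult_keys:
  assumes "h \<in> carrier H" "t \<in> comult H h"
  shows "Poly_Mapping.keys t \<subseteq> carrier H \<times> carrier H"
  using comult_form[OF assms(1)] keys_tensor2[OF vector_space_scale subspace_carrier] assms(2)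
  by metis

lemma some_comult:
  assumes "h \<in> carrier H"
  shows "(SOME t. t \<in> comult H h) \<in> comult H h"
proof -
  have "t \<in> tensor2 (hscale H) (carrier H) t" for t
    by (simp add: tensor2_def free.span_zero)
  then show ?thesis using comult_form[OF assms] some_in_eq by (metis empty_iff)
qed

lemma comult_iff:
  assumes "h \<in> carrier H" "t \<in> comult H h"
  shows "u \<in> comult H h \<longleftrightarrow> u - t \<in> module.span free_scale (rels2 (hscale H) (carrier H))"
proof -
  obtain t0 where t0: "comult H h = tensor2 (hscale H) (carrier H) t0"
    by (rule comult_form[OF assms(1)])
  have "t - t0 \<in> module.span free_scale (rels2 (hscale H) (carrier H))"
    using assms(2) unfolding t0 tensor2_def by (rule CollectD)
  then have "u - t + (t - t0) \<in> module.span free_scale (rels2 (hscale H) (carrier H)) \<longleftrightarrow>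
    u - t \<in> module.span free_scale (rels2 (hscale H) (carrier H))"
    by (rule free.span_add_eq2)
  moreover have "u - t + (t - t0) = u - t0" by simp
  ultimately show ?thesis unfolding t0 tensor2_def by (simp only: mem_Collect_eq)
qed

lemma sw_eq:
  assumes "vector_space s" "bilinear_on (carrier H) (hscale H) s \<beta>" "h \<in> carrier H" "t \<in> comult H h"
  shows "lin_ext s (\<lambda>(a, b). \<beta> a b) t = sw s \<beta> h"
proof -
  have "t \<in> tensor2 (hscale H) (carrier H) (SOME t. t \<in> comult H h)"
    using comult_iff[OF assms(3) some_comult[OF assms(3)], of t] assms(4)
    unfolding tensor2_def mem_Collect_eq by (rule iffD1)
  then show ?thesis unfolding sw_def by (rule lin_ext_tensor2[OF assms(1,2)])
qed

text \<open>Both sides evaluate the same chosen expression, and all its pairs come from the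
  carrier.\<close>

lemma sw_cong:
  assumes "h \<in> carrier H"
    and "\<And>a b. a \<in> carrier H \<Longrightarrow> b \<in> carrier H \<Longrightarrow> \<beta> a b = \<beta>' a b"
  shows "sw s \<beta> h = sw s \<beta>' h"
  unfolding sw_def
  by (rule lin_ext_cong) (use comult_keys[OF assms(1) some_comult] assms in auto)

lemma sw_linear:
  assumes "vector_space s" "bilinear_on (carrier H) (hscale H) s \<beta>"
  shows "linear_on (carrier H) (hscale H) s (sw s \<beta>)"
proof (rule linear_onI)
  let ?d = "\<lambda>h. SOME t. t \<in> comult H h"
  interpret L: Vector_Spaces.linear free_scale s "lin_ext s (\<lambda>(a, b). \<beta> a b)"
    by (rule linear_lin_ext) fact
  fix x y assume "x \<in> carrier H" "y \<in> carrier H"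
  then have "sw s \<beta> (x + y) = lin_ext s (\<lambda>(a, b). \<beta> a b) (?d x + ?d y)"
    by (intro sw_eq[OF assms, symmetric] comult_add some_comult) auto
  then show "sw s \<beta> (x + y) = sw s \<beta> x + sw s \<beta> y"
    by (simp add: L.add sw_def)
next
  let ?d = "\<lambda>h. SOME t. t \<in> comult H h"
  interpret L: Vector_Spaces.linear free_scale s "lin_ext s (\<lambda>(a, b). \<beta> a b)"
    by (rule linear_lin_ext) fact
  fix c x assume "x \<in> carrier H"
  then have "sw s \<beta> (hscale H c x) = lin_ext s (\<lambda>(a, b). \<beta> a b) (free_scale c (?d x))"
    by (intro sw_eq[OF assms, symmetric] comult_scale some_comult) auto
  then show "sw s \<beta> (hscale H c x) = s c (sw s \<beta> x)"
    by (simp add: L.scale sw_def)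
qed

lemma sw_apply:
  assumes "vector_space s" "vector_space s'" "linear_on W s s' \<phi>" "module.subspace s W"
    and "\<And>a b. a \<in> carrier H \<Longrightarrow> b \<in> carrier H \<Longrightarrow> \<beta> a b \<in> W" "h \<in> carrier H"
  shows "\<phi> (sw s \<beta> h) = sw s' (\<lambda>a b. \<phi> (\<beta> a b)) h"
proof -
  have "\<phi> (sw s \<beta> h) = lin_ext s' (\<lambda>k. \<phi> (case k of (a, b) \<Rightarrow> \<beta> a b)) (SOME t. t \<in> comult H h)"
    unfolding sw_def
    by (rule linear_on_lin_ext_apply[OF assms(1-4)])
      (use comult_keys[OF assms(6) some_comult] assms(5,6) in auto)
  then show ?thesis by (simp add: sw_def case_prod_unfold)
qed

lemma sw_closed:
  assumes "vector_space s" "module.subspace s W"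
    and "\<And>a b. a \<in> carrier H \<Longrightarrow> b \<in> carrier H \<Longrightarrow> \<beta> a b \<in> W" "h \<in> carrier H"
  shows "sw s \<beta> h \<in> W"
  unfolding sw_def
  by (rule lin_ext_in_subspace[OF assms(1,2)])
    (use comult_keys[OF assms(4) some_comult] assms in auto)

lemma sw_carrier:
  assumes "\<And>a b. a \<in> carrier H \<Longrightarrow> b \<in> carrier H \<Longrightarrow> \<beta> a b \<in> carrier H" "h \<in> carrier H"
  shows "sw (hscale H) \<beta> h \<in> carrier H"
  using assms by (rule sw_closed[OF vector_space_scale subspace_carrier])

lemma sw_add_fun:
  assumes "vector_space s"
  shows "sw s (\<lambda>a b. \<beta> a b + \<beta>' a b) h = sw s \<beta> h + sw s \<beta>' h"
  by (simp add: sw_def case_prod_unfold lin_ext_add_fun[OF assms])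

lemma sw_scale_fun:
  assumes "vector_space s"
  shows "sw s (\<lambda>a b. s c (\<beta> a b)) h = s c (sw s \<beta> h)"
  by (simp add: sw_def case_prod_unfold lin_ext_scale_fun[OF assms])

lemma sw_sum_fun:
  assumes "vector_space s"
  shows "sw s (\<lambda>a b. \<Sum>i\<in>I. \<beta> i a b) h = (\<Sum>i\<in>I. sw s (\<beta> i) h)"
  by (simp add: sw_def case_prod_unfold lin_ext_sum_fun[OF assms])

lemma sw_zero_fun:
  assumes "vector_space s"
  shows "sw s (\<lambda>a b. 0) h = 0"
  by (simp add: sw_def case_prod_unfold lin_ext_zero_fun[OF assms])

lemma sw_coassoc:
  assumes "vector_space s" "trilinear_on (carrier H) (hscale H) s \<tau>" "h \<in> carrier H"
  shows "sw s (\<lambda>a b. sw s (\<lambda>a1 a2. \<tau> a1 a2 b) a) h = sw s (\<lambda>a b. sw s (\<lambda>b1 b2. \<tau> a b1 b2) b) h"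
proof -
  let ?d = "\<lambda>h. SOME t. t \<in> comult H h"
  interpret S: vector_space s by fact
  note vs = assms(1)
  have "lin_ext s (\<lambda>(a, b, c). \<tau> a b c)
      (lin_ext free_scale (\<lambda>(a, b). lin_ext free_scale (\<lambda>(a1, a2). free_gen (a1, a2, b)) (?d a)) (?d h)) =
    lin_ext s (\<lambda>(a, b, c). \<tau> a b c)
      (lin_ext free_scale (\<lambda>(a, b). lin_ext free_scale (\<lambda>(b1, b2). free_gen (a, b1, b2)) (?d b)) (?d h))"
    using coassoc[OF assms(3) some_comult[OF assms(3)] some_comult]
    by (intro lin_ext_tensor3[OF assms(1,2)]) auto
  then show ?thesis
    by (simp add: lin_ext_lin_ext[OF vs] lin_ext_single[OF vs] case_prod_unfold sw_def)
qed

lemma sw_counit_left: "h \<in> carrier H \<Longrightarrow> sw (hscale H) (\<lambda>a b. hscale H (counit H a) b) h = h"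
  and sw_counit_right: "h \<in> carrier H \<Longrightarrow> sw (hscale H) (\<lambda>a b. hscale H (counit H b) a) h = h"
  and sw_antipode_left: "h \<in> carrier H \<Longrightarrow>
    sw (hscale H) (\<lambda>a b. antipode H a \<otimes> b) h = hscale H (counit H h) \<one>"
  unfolding sw_def
  by (intro counit_left counit_right antipode_left some_comult; assumption)+

lemma sw_mult:
  assumes "vector_space s" "bilinear_on (carrier H) (hscale H) s \<beta>" "h \<in> carrier H" "k \<in> carrier H"
  shows "sw s \<beta> (h \<otimes> k) = sw s (\<lambda>a b. sw s (\<lambda>a' b'. \<beta> (a \<otimes> a') (b \<otimes> b')) k) h"
proof -
  let ?d = "\<lambda>h. SOME t. t \<in> comult H h"
  interpret S: vector_space s by fact
  note vs = assms(1)
  have "sw s \<beta> (h \<otimes> k) = lin_ext s (\<lambda>(a, b). \<beta> a b)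
      (lin_ext free_scale (\<lambda>(a, b). lin_ext free_scale (\<lambda>(a', b'). free_gen (a \<otimes> a', b \<otimes> b')) (?d k)) (?d h))"
    using assms by (intro sw_eq[symmetric] comult_mult some_comult) auto
  then show ?thesis
    by (simp add: lin_ext_lin_ext[OF vs] lin_ext_single[OF vs] case_prod_unfold sw_def)
qed

lemma sw_free_gen:
  assumes "vector_space s" "bilinear_on (carrier H) (hscale H) s \<beta>" "h \<in> carrier H"
    "free_gen (g, k) \<in> comult H h"
  shows "sw s \<beta> h = \<beta> g k"
proof -
  interpret S: vector_space s by fact
  show ?thesis using sw_eq[OF assms] by (simp add: lin_ext_single[OF assms(1)])
qed

text \<open>Coordinates are functionals, so equal values under all pairs mean equal matrices, hence
  congruent tensors. The comultiplications of grouplike and primitive elements are found in this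
  way.\<close>

lemma comult_memI:
  assumes "finite_dim (hscale H) (carrier H)" "h \<in> carrier H"
    and "Poly_Mapping.keys u \<subseteq> carrier H \<times> carrier H"
    and eq: "\<And>f f'. dual f \<Longrightarrow> dual f' \<Longrightarrow>
      lin_ext (*) (\<lambda>(a, b). f a * f' b) u = sw (*) (\<lambda>a b. f a * f' b) h"
  shows "u \<in> comult H h"
proof -
  let ?t = "SOME t. t \<in> comult H h"
  let ?R = "module.span free_scale (rels2 (hscale H) (carrier H))"
  obtain B where B: "finite B" "B \<subseteq> carrier H" "VS.independent B" "VS.span B = carrier H"
    using assms(1) VS.finite_basis_of_finite_dim[OF subspace_carrier _ _ _ _ subspace_carrier]
    by (metis finite_dim_def subset_refl)
  let ?E = "\<lambda>u. \<Sum>(i, j)\<in>B \<times> B. free_scale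
      (lin_ext (*) (\<lambda>(a, b). VS.representation B a i * VS.representation B b j) u) (free_gen (i, j))"
  note exp = tensor2_expand[OF vector_space_scale subspace_carrier B(1,2,4,3)]
  have t: "?t \<in> comult H h" by (rule some_comult) fact
  have E: "?E u = ?E ?t"
    by (rule sum.cong) (auto simp: eq linear_on_representation[OF vector_space_scale B(3,4)] sw_def)
  have "u - ?E u - (?t - ?E ?t) \<in> ?R"
    by (intro free.span_diff exp assms(3) comult_keys[OF assms(2) t])
  then have "u - ?t \<in> ?R" by (simp only: E diff_diff_eq2 diff_add_cancel)
  then show ?thesis by (rule comult_iff[OF assms(2) t, THEN iffD2])
qed

text \<open>In a basis adapted to \<open>K\<close> the coordinates at \<open>B - C\<close> vanish on
  \<open>K\<close>. The assumption \<open>zero\<close> removes every coefficient with both indices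
  outside \<open>C\<close>, and each remaining pure tensor has a factor in \<open>K\<close>.\<close>

lemma comult_coidealI:
  assumes "finite_dim (hscale H) (carrier H)" "h \<in> carrier H"
    and "K \<subseteq> carrier H" "VS.subspace K"
    and zero: "\<And>f f'. dual f \<Longrightarrow> dual f' \<Longrightarrow> \<forall>x\<in>K. f x = 0 \<Longrightarrow> \<forall>x\<in>K. f' x = 0 \<Longrightarrow>
      sw (*) (\<lambda>a b. f a * f' b) h = 0"
  shows "\<exists>t\<in>comult H h. Poly_Mapping.keys t \<subseteq> carrier H \<times> K \<union> K \<times> carrier H"
proof -
  let ?t = "SOME t. t \<in> comult H h"
  let ?R = "module.span free_scale (rels2 (hscale H) (carrier H))"
  obtain C B where B: "finite B" "B \<subseteq> carrier H" "VS.independent B" "VS.span B = carrier H"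
      "C \<subseteq> B" "C \<subseteq> K" "VS.span C = K"
    using assms(1) VS.finite_basis_of_finite_dim[OF subspace_carrier _ _ _ assms(3,4)]
    by (metis finite_dim_def)
  define c where "c = (\<lambda>(i, j). lin_ext (*) (\<lambda>(a, b). VS.representation B a i * VS.representation B b j) ?t)"
  define u where "u = (\<Sum>p\<in>B \<times> B. free_scale (c p) (free_gen p))"
  have t: "?t \<in> comult H h" by (rule some_comult) fact
  have "?t - u \<in> ?R"
    using tensor2_expand[OF vector_space_scale subspace_carrier B(1,2,4,3) comult_keys[OF assms(2) t]]
    by (simp add: u_def c_def case_prod_unfold)
  then have "- (?t - u) \<in> ?R" by (rule free.span_neg)
  then have "u - ?t \<in> ?R" by (simp only: minus_diff_eq)
  then have "u \<in> comult H h" by (rule comult_iff[OF assms(2) t, THEN iffD2])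
  have c0: "c (i, j) = 0" if "i \<in> B" "j \<in> B" "i \<notin> C" "j \<notin> C" for i j
    using zero[OF linear_on_representation[OF vector_space_scale B(3,4)]
        linear_on_representation[OF vector_space_scale B(3,4)], of i j]
      VS.representation_span_subset[OF B(3,5)] B(7) that
    by (simp add: c_def sw_def)
  have "free_scale (c p) (free_gen p) \<in> {t. Poly_Mapping.keys t \<subseteq> carrier H \<times> K \<union> K \<times> carrier H}"
    if p: "p \<in> B \<times> B" for p
  proof (cases p)
    case (Pair i j)
    then show ?thesis
    proof (cases "i \<in> C \<or> j \<in> C")
      case True
      then show ?thesis using p Pair B(2,6) by (auto simp: free_scale_single split: if_splits)
    next
      case False
      then show ?thesis using p Pair c0 by simp
    qed
  qed
  then have "u \<in> {t. Poly_Mapping.keys t \<subseteq> carrier H \<times> K \<union> K \<times> carrier H}"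
    unfolding u_def by (intro free.subspace_sum[OF subspace_keys]) auto
  with \<open>u \<in> comult H h\<close> show ?thesis by blast
qed

end

section \<open>Eigenvectors modulo an invariant subspace\<close>

context vector_space
begin

text \<open>Coefficients are attached to positions, not to vectors, because the sequence
  \<open>v\<close> may repeat values.\<close>

lemma in_span_image_lessThan:
  assumes "x \<in> span (v ` {..<n::nat})"
  obtains c where "x = (\<Sum>i<n. scale (c i) (v i))"
  using assms
proof (induction n arbitrary: x thesis)
  case (Suc n)
  have "v ` {..<Suc n} = insert (v n) (v ` {..<n})" by (auto simp: lessThan_Suc)
  then obtain k where "x - scale k (v n) \<in> span (v ` {..<n})"
    using Suc.prems(2) by (auto simp: span_breakdown_eq)
  then obtain c where "x - scale k (v n) = (\<Sum>i<n. scale (c i) (v i))"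
    using Suc.IH by metis
  then have "x = (\<Sum>i<Suc n. scale ((c(n := k)) i) (v i))"
    by (simp add: algebra_simps)
  then show ?case by (rule Suc.prems(1))
qed simp

text \<open>Without a relation every initial segment would consist of \<open>n\<close> distinct
  independent vectors, too many for \<open>n = card B + 1\<close>. The relation has leading
  coefficient one; it serves minimal polynomials, convolution powers and powers of a primitive
  element alike.\<close>

lemma finite_dim_imp_relation:
  assumes "finite B" "\<And>n. v n \<in> span B"
  shows "\<exists>n::nat. v n \<in> span (v ` {..<n})"
proof (rule ccontr)
  assume *: "\<not> ?thesis"
  have ind: "independent (v ` {..<n}) \<and> card (v ` {..<n}) = n" for n
  proof (induction n)
    case (Suc n)
    have "v n \<notin> span (v ` {..<n})" using * by blast
    moreover from this have "v n \<notin> v ` {..<n}" by (metis span_base)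
    moreover have "v ` {..<Suc n} = insert (v n) (v ` {..<n})" by (auto simp: lessThan_Suc)
    ultimately show ?case using Suc by (simp add: independent_insertI)
  qed (simp add: independent_empty)
  have "card (v ` {..<Suc (card B)}) \<le> card B"
    using independent_span_bound[OF assms(1), of "v ` {..<Suc (card B)}"] ind assms(2)
    by (simp add: image_subset_iff)
  then show False using ind[of "Suc (card B)"] by simp
qed

lemma dim_strict_mono:
  assumes "subspace W" "subspace W'" "W' \<subset> W" "finite B" "W \<subseteq> span B"
  shows "dim W' < dim W"
proof -
  obtain C where C: "C \<subseteq> W'" "independent C" "W' \<subseteq> span C"
    using maximal_independent_subset by blast
  obtain E where E: "C \<subseteq> E" "E \<subseteq> W" "independent E" "W \<subseteq> span E"
    using maximal_independent_subset_extend C assms(3) by (metis psubset_imp_subset subset_trans)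
  have "finite E" using independent_span_bound[OF assms(4) E(3)] E(2) assms(5) by blast
  moreover have "C \<noteq> E"
    using C E assms(1-3) by (metis psubset_eq span_subspace)
  ultimately have "card C < card E" using E(1) by (simp add: psubset_card_mono psubset_eq)
  then show ?thesis
    using C E by (metis basis_card_eq_dim)
qed

end

text \<open>This is \<open>p(T) x\<close> in Horner form, so that its recursion follows the
  constructor \<open>pCons\<close>.\<close>

definition poly_op :: "(complex \<Rightarrow> 'a \<Rightarrow> 'a) \<Rightarrow> ('a \<Rightarrow> 'a) \<Rightarrow> complex poly \<Rightarrow> 'a \<Rightarrow> 'a::ab_group_add"
  where "poly_op s T p x = fold_coeffs (\<lambda>a y. s a x + T y) p 0"

text \<open>Take \<open>p\<close> of least degree among the nonzero polynomials with
  \<open>p(T) x\<close> in \<open>D\<close>, and split off a linear factor: p = (X - z) q. Then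
  \<open>q(T) x\<close> lies outside \<open>D\<close> by minimality, and \<open>T - z\<close> moves
  it into \<open>D\<close>. The relative form replaces a quotient space; with \<open>D = {0}\<close>
  it gives ordinary eigenvectors.\<close>

lemma eigenvector_mod:
  assumes "vector_space s" "module.subspace s U" "module.subspace s D" "D \<subset> U"
    and "finite B" "U \<subseteq> module.span s B"
    and T: "linear_on U s s T" "\<And>x. x \<in> U \<Longrightarrow> T x \<in> U" "\<And>x. x \<in> D \<Longrightarrow> T x \<in> D"
  shows "\<exists>y z. y \<in> U \<and> y \<notin> D \<and> T y - s z y \<in> D"
proof -
  interpret S: vector_space s by fact
  note UI = S.subspace_add[OF assms(2)] S.subspace_scale[OF assms(2)] S.subspace_0[OF assms(2)]
  obtain x where x: "x \<in> U" "x \<notin> D" using assms(4) by blast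
  let ?e = "\<lambda>p. poly_op s T p x"
  have T0: "T 0 = 0" by (rule linear_on_zero[OF assms(1,1) T(1) assms(2)])
  have e0: "?e 0 = 0" by (simp add: poly_op_def)
  have eC: "?e (pCons a p) = s a x + T (?e p)" for a p
    by (cases "a = 0 \<and> p = 0") (auto simp: poly_op_def T0)
  have eU: "?e p \<in> U" for p
    by (induction p) (auto simp: e0 eC UI x T(2))
  have eadd: "?e (p + q) = ?e p + ?e q" for p q
    by (induction p q rule: poly_induct2)
      (auto simp: e0 eC S.scale_left_distrib linear_on_add[OF T(1)] eU algebra_simps)
  have escale: "?e (smult c p) = s c (?e p)" for c p
    by (induction p) (auto simp: e0 eC S.scale_right_distrib linear_on_scale[OF T(1)] eU)
  have emonom: "?e (monom 1 n) = (T ^^ n) x" for n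
    by (induction n) (auto simp: monom_0 monom_Suc eC e0 T0)
  obtain n where "(T ^^ n) x \<in> S.span ((\<lambda>n. (T ^^ n) x) ` {..<n})"
    using S.finite_dim_imp_relation[OF assms(5), of "\<lambda>n. (T ^^ n) x"] assms(6) eU
    by (metis emonom subset_eq)
  then obtain c where c: "(T ^^ n) x = (\<Sum>i<n. s (c i) ((T ^^ i) x))"
    by (rule S.in_span_image_lessThan)
  have esum: "?e (sum f I) = (\<Sum>i\<in>I. ?e (f i))" for f :: "nat \<Rightarrow> complex poly" and I
    by (induction I rule: infinite_finite_induct) (auto simp: e0 eadd)
  \<comment> \<open>The linear relation between the iterates of \<open>T\<close>, read as a nonzero
    polynomial annihilating \<open>x\<close>.\<close>
  define p0 where "p0 = monom 1 n - (\<Sum>i<n. smult (c i) (monom 1 i))"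
  have "coeff p0 n = 1" by (simp add: p0_def coeff_sum)
  moreover have "?e p0 = ?e (monom 1 n + smult (-1) (\<Sum>i<n. smult (c i) (monom 1 i)))"
    by (simp add: p0_def)
  then have "?e p0 = 0"
    unfolding eadd escale esum emonom by (simp add: c)
  ultimately have "p0 \<noteq> 0 \<and> ?e p0 \<in> D"
    using S.subspace_0[OF assms(3)] by auto
  then obtain p where p: "p \<noteq> 0 \<and> ?e p \<in> D"
    and min: "\<And>q. q \<noteq> 0 \<and> ?e q \<in> D \<Longrightarrow> degree p \<le> degree q"
    using ex_has_least_nat[of "\<lambda>q. q \<noteq> 0 \<and> ?e q \<in> D" p0 degree] by blast
  \<comment> \<open>A nonzero constant would put \<open>x\<close> itself into
    \<open>D\<close>.\<close>
  have "degree p \<noteq> 0"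
  proof
    assume "degree p = 0"
    then obtain a where a: "p = [:a:]" by (rule degree_eq_zeroE)
    then have "s a x \<in> D" "a \<noteq> 0" using p by (auto simp: eC e0 T0)
    then have "s (inverse a) (s a x) \<in> D" using S.subspace_scale[OF assms(3)] by blast
    then show False using \<open>a \<noteq> 0\<close> x by simp
  qed
  then obtain z where "poly p z = 0"
    using fundamental_theorem_of_algebra[of p] by (auto simp: constant_degree)
  then obtain q where q: "p = [:- z, 1:] * q" by (auto simp: poly_eq_0_iff_dvd dvd_def)
  then have "q \<noteq> 0" using p by auto
  then have "degree p = Suc (degree q)" unfolding q by (subst degree_mult_eq) auto
  then have "?e q \<notin> D" using min[of q] \<open>q \<noteq> 0\<close> by auto
  moreover have "p = pCons 0 q + smult (- z) q" by (simp add: q)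
  then have "?e p = T (?e q) - s z (?e q)"
    by (simp only: eadd escale eC) simp
  ultimately show ?thesis using eU p by metis
qed

text \<open>Let \<open>W\<close> be an invariant subspace of least dimension strictly above
  \<open>D\<close>. For each \<open>f\<close>, the vectors of \<open>W\<close> that are eigenvectors
  of \<open>T f\<close> modulo \<open>D\<close> for one suitable \<open>z\<close> form a subspace of
  the same kind, because the operators commute; so they are all of \<open>W\<close>. Any vector of
  \<open>W\<close> outside \<open>D\<close> then works for all \<open>f\<close> at once, even for
  infinite \<open>F\<close>.\<close>

lemma common_eigenvector_mod:
  assumes "vector_space s" "module.subspace s U" "module.subspace s D" "D \<subset> U"
    and "finite B" "U \<subseteq> module.span s B"
    and T: "\<And>f. f \<in> F \<Longrightarrow> linear_on U s s (T f)" "\<And>f x. f \<in> F \<Longrightarrow> x \<in> U \<Longrightarrow> T f x \<in> U"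
      "\<And>f x. f \<in> F \<Longrightarrow> x \<in> D \<Longrightarrow> T f x \<in> D"
    and comm: "\<And>f g x. f \<in> F \<Longrightarrow> g \<in> F \<Longrightarrow> x \<in> U \<Longrightarrow> T f (T g x) = T g (T f x)"
  shows "\<exists>x. x \<in> U \<and> x \<notin> D \<and> (\<forall>f\<in>F. \<exists>z. T f x - s z x \<in> D)"
proof -
  interpret S: vector_space s by fact
  define P where "P W \<longleftrightarrow> S.subspace W \<and> D \<subset> W \<and> W \<subseteq> U \<and> (\<forall>f\<in>F. \<forall>x\<in>W. T f x \<in> W)" for W
  have "P U" using assms by (auto simp: P_def)
  then obtain W where W: "P W" and min: "\<And>W'. P W' \<Longrightarrow> S.dim W \<le> S.dim W'"
    using ex_has_least_nat[of P U S.dim] by blast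
  have sub: "S.subspace W" "D \<subset> W" "W \<subseteq> U" "W \<subseteq> S.span B"
    using W assms(6) by (auto simp: P_def)
  obtain x where x: "x \<in> W" "x \<notin> D" using sub by blast
  have "\<exists>z. T f x - s z x \<in> D" if f: "f \<in> F" for f
  proof -
    have lin: "linear_on W s s (T f)" by (rule linear_on_subset[OF T(1)[OF f] sub(3)])
    obtain y z where y: "y \<in> W" "y \<notin> D" "T f y - s z y \<in> D"
      using eigenvector_mod[OF assms(1) sub(1) assms(3) sub(2) assms(5) sub(4) lin] W T(3) f
      by (auto simp: P_def)
    define W' where "W' = {u \<in> W. T f u - s z u \<in> D}"
    have lin': "linear_on W s s (\<lambda>u. T f u - s z u)"
      using lin by (auto simp: linear_on_def algebra_simps)
    have "P W'"
      unfolding P_def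
    proof (intro conjI ballI)
      show "S.subspace W'"
        unfolding W'_def by (rule subspace_linear_on_vimage[OF assms(1,1) lin' sub(1) assms(3)])
      have "D \<subseteq> W'"
        using sub T(3)[OF f] S.subspace_diff[OF assms(3)] S.subspace_scale[OF assms(3)]
        by (auto simp: W'_def)
      moreover have "y \<in> W'" using y by (simp add: W'_def)
      ultimately show "D \<subset> W'" using y by blast
      show "W' \<subseteq> U" using sub by (auto simp: W'_def)
      fix g u assume g: "g \<in> F" and u: "u \<in> W'"
      have uW: "u \<in> W" "u \<in> U" using u sub by (auto simp: W'_def)
      have U: "T f u \<in> U" "s z u \<in> U" using T(2)[OF f] uW S.subspace_scale[OF assms(2)] by auto
      have "T f (T g u) - s z (T g u) = T g (T f u - s z u)"
        using linear_on_diff[OF assms(1,1) T(1)[OF g] assms(2) U] linear_on_scale[OF T(1)[OF g]]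
          comm[OF f g] uW by simp
      also have "\<dots> \<in> D" using T(3)[OF g] u by (simp add: W'_def)
      finally show "T g u \<in> W'" using W g uW by (auto simp: W'_def P_def)
    qed
    then have "W' = W"
      using S.dim_strict_mono[OF sub(1) _ _ assms(5) sub(4), of W'] min[of W']
      unfolding P_def by (metis (no_types, lifting) W'_def leD mem_Collect_eq psubsetI subsetI)
    then show ?thesis using x by (auto simp: W'_def)
  qed
  then show ?thesis using x sub by blast
qed

section \<open>Simple vertex operator algebras\<close>

sublocale voa \<subseteq> VV: vector_space "vscale V"
  by (rule vector_space_scale)

context voa
begin

lemma mode_add [simp]: "mode V u n (v + w) = mode V u n v + mode V u n w"
  and mode_scale [simp]: "mode V u n (vscale V c v) = vscale V c (mode V u n v)"
  and state_add [simp]: "mode V (u + u') n v = mode V u n v + mode V u' n v"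
  and state_scale [simp]: "mode V (vscale V c u) n v = vscale V c (mode V u n v)"
  using mode_linear state_linear by (auto simp: linear_on_def)

lemma mode_zero [simp]: "mode V u n 0 = 0"
  and state_zero [simp]: "mode V 0 n v = 0"
  using mode_scale[of u n 0 0] state_scale[of 0 0 n v] by simp_all

lemma mode_sum: "mode V u n (sum f I) = (\<Sum>i\<in>I. mode V u n (f i))"
  and state_sum: "mode V (sum f I) n v = (\<Sum>i\<in>I. mode V (f i) n v)"
  by (induction I rule: infinite_finite_induct) auto

lemma Sum_any_lessThan:
  assumes "\<And>i. i \<ge> M \<Longrightarrow> f i = 0"
  shows "Sum_any f = (\<Sum>i<M::nat. f i :: 'v)"
  by (rule Sum_any.expand_superset) (use assms in \<open>auto simp: not_less[symmetric]\<close>)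

lemma finite_truncation:
  assumes "finite K"
  obtains N :: nat where "\<And>k n. k \<in> K \<Longrightarrow> n \<ge> int N \<Longrightarrow> mode V (u k) n (v k) = 0"
proof -
  have "\<forall>k. \<exists>N. \<forall>n\<ge>N. mode V (u k) n (v k) = 0" by (intro allI truncation)
  from choice[OF this] obtain N where N: "\<And>k n. n \<ge> N k \<Longrightarrow> mode V (u k) n (v k) = 0"
    by auto
  \<comment> \<open>The sum of the absolute values serves as a common upper bound of all
    \<open>N k\<close>.\<close>
  have "mode V (u k) n (v k) = 0" if "k \<in> K" "n \<ge> int (\<Sum>k\<in>K. nat \<bar>N k\<bar>)" for k n
  proof -
    have "nat \<bar>N k\<bar> \<le> (\<Sum>k\<in>K. nat \<bar>N k\<bar>)" using assms that by (intro member_le_sum) auto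
    then show ?thesis using that N[of k n] by linarith
  qed
  then show thesis by (rule that)
qed

text \<open>The coefficient of z to the power \<open>i\<close> in Y(x, z) applied to the vacuum. The
  Jacobi identity applied to the vacuum produces exactly these expressions.\<close>

definition vac_coeff :: "nat \<Rightarrow> 'v \<Rightarrow> 'v"
  where "vac_coeff i x = mode V x (- 1 - int i) (vac V)"

lemma vac_coeff_0 [simp]: "vac_coeff 0 x = x"
  by (simp add: vac_coeff_def creation)

text \<open>Hence \<open>vac_coeff i\<close> is the divided power of \<open>L(- 1)\<close>.\<close>

lemma vac_coeff_Suc: "vac_coeff (Suc i) x = vscale V (1 / of_nat (Suc i)) (vac_coeff i (Vir V (- 1) x))"
proof -
  have "- 1 - int i - 1 = - 1 - int (Suc i)" by simp
  then have "vac_coeff i (Vir V (- 1) x) = vscale V (of_nat (Suc i)) (vac_coeff (Suc i) x)"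
    using L_derivative[of x "- 1 - int i" "vac V"] by (simp add: vac_coeff_def)
  then show ?thesis by (simp del: of_nat_Suc)
qed

text \<open>This is the Jacobi identity with \<open>m = - 1\<close>, \<open>n = 0\<close> and
  \<open>w = vac V\<close>. Regularity kills the first sum and all terms but \<open>i = 0\<close> of
  the second, and the binomial coefficient of \<open>- 1\<close> over \<open>i\<close> is
  \<open>(- 1) ^ i\<close>. In generating functions: Y(v, z) u = exp(z L(-1)) Y(u, -z) v.\<close>

lemma skew_symmetry:
  "mode V v l u = vscale V (- ((- 1) powi l))
    (Sum_any (\<lambda>i. vscale V ((- 1) ^ i) (vac_coeff i (mode V u (l + int i) v))))"
proof -
  have gb: "(- 1 gchoose i :: complex) = (- 1) ^ i" for i
    using gbinomial_minus[of "1 :: complex" i] by (simp add: binomial_gbinomial[symmetric])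
  have second: "(\<lambda>i. vscale V ((of_int l gchoose i) * (- 1) powi (l - int i))
      (mode V v (0 + l - int i) (mode V u (- 1 + int i) (vac V)))) =
    (\<lambda>i. if i = 0 then vscale V ((- 1) powi l) (mode V v l u) else 0)"
    by (auto simp: fun_eq_iff creation creation_regular)
  have "- vscale V ((- 1) powi l) (mode V v l u) =
      Sum_any (\<lambda>i. vscale V ((- 1) ^ i) (vac_coeff i (mode V u (l + int i) v)))"
    using jacobi[of l u "- 1" v 0 "vac V"] unfolding second
    by (simp add: creation_regular gb vac_coeff_def)
  then have "vscale V (- ((- 1) powi l)) (- vscale V ((- 1) powi l) (mode V v l u)) =
     vscale V (- ((- 1) powi l)) (Sum_any (\<lambda>i. vscale V ((- 1) ^ i) (vac_coeff i (mode V u (l + int i) v))))"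
    by simp
  moreover have "(- 1 :: complex) powi l * (- 1) powi l = 1"
    by (simp add: power_int_mult_distrib[symmetric])
  ultimately show ?thesis by simp
qed

text \<open>Closure in the other argument comes from skew symmetry: \<open>I\<close> is closed under
  L(-1), a mode of \<open>conf V\<close>, hence under every \<open>vac_coeff i\<close>.\<close>

lemma voa_idealI:
  assumes "VV.subspace I" "\<And>u w n. w \<in> I \<Longrightarrow> mode V u n w \<in> I"
  shows "voa_ideal V I"
proof -
  have vc: "vac_coeff i x \<in> I" if "x \<in> I" for i x
    using that
  proof (induction i arbitrary: x)
    case (Suc i)
    then have "vac_coeff i (Vir V (- 1) x) \<in> I" using assms(2) by (simp add: Vir_def)
    then show ?case unfolding vac_coeff_Suc by (rule VV.subspace_scale[OF assms(1)])
  qed simp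
  have "mode V w n u \<in> I" if "w \<in> I" for u w n
    unfolding skew_symmetry[of w n u] Sum_any.expand_set
    using assms(2) vc that
    by (intro VV.subspace_scale[OF assms(1)] VV.subspace_sum[OF assms(1)]) auto
  then show ?thesis using assms by (auto simp: voa_ideal_def)
qed

section \<open>Schur's lemma and injectivity of vertex operators on tensors\<close>

lemma vac_nonzero: "simple_voa V \<Longrightarrow> vac V \<noteq> 0"
  using vacuum[of "- 1"] by (auto simp: simple_voa_def)

text \<open>The map \<theta> commutes with L(0) and so preserves the weight zero space, which is
  finite dimensional and contains the nonzero vacuum. It has an eigenvector there, and its
  eigenspace in \<open>V\<close> is a nonzero ideal.\<close>

lemma schur:
  assumes "simple_voa V" "linear_on UNIV (vscale V) (vscale V) \<theta>"
    and comm: "\<And>a m x. \<theta> (mode V a m x) = mode V a m (\<theta> x)"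
  obtains c where "\<And>x. \<theta> x = vscale V c x"
proof -
  obtain B where B: "finite B" "VV.span B = grade V 0"
    using grade_finite_dim[of 0] by (auto simp: finite_dim_def)
  have "{0} \<subset> grade V 0"
    using vac_nonzero[OF assms(1)] vac_grade VV.subspace_0[OF grade_subspace] by blast
  moreover have "\<theta> x \<in> grade V 0" if "x \<in> grade V 0" for x
    using that comm linear_on_scale[OF assms(2)] by (auto simp: grade_eq Vir_def) (metis comm UNIV_I VV.scale_zero_left)
  moreover have "\<theta> 0 = 0"
    using linear_on_zero[OF vector_space_scale vector_space_scale assms(2)] by simp
  ultimately obtain y z where y: "y \<noteq> 0" "\<theta> y - vscale V z y = 0"
    using eigenvector_mod[OF vector_space_scale grade_subspace VV.subspace_single_0 _ B(1) _
        linear_on_subset[OF assms(2)], of 0] B(2) by auto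
  have lin: "linear_on UNIV (vscale V) (vscale V) (\<lambda>x. \<theta> x - vscale V z x)"
    using assms(2) by (auto simp: linear_on_def algebra_simps)
  let ?I = "{x \<in> UNIV. \<theta> x - vscale V z x \<in> {0}}"
  have "voa_ideal V ?I"
    by (rule voa_idealI[OF subspace_linear_on_vimage[OF vector_space_scale vector_space_scale lin
        VV.subspace_UNIV VV.subspace_single_0]]) (simp add: comm)
  moreover have "y \<in> ?I" using y by simp
  ultimately have "?I = UNIV" using assms(1) y(1) unfolding simple_voa_def by blast
  then have "\<theta> x = vscale V z x" for x by auto
  then show thesis by (rule that)
qed

text \<open>Formally, \<open>(z\<^sub>0 + z\<^sub>2)\<^sup>N Y(Y(a, z\<^sub>0) u, z\<^sub>2) v = (z\<^sub>0 + z\<^sub>2)\<^sup>N Y(a, z\<^sub>0 + z\<^sub>2) Y(u, z\<^sub>2) v\<close> for large \<open>N\<close>,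
  and the power of \<open>z\<^sub>0 + z\<^sub>2\<close> can be cancelled because the expansion in \<open>z\<^sub>0\<close> is bounded below.\<close>

lemma vanishing_mode_left:
  assumes "finite K" and zero: "\<And>n. (\<Sum>k\<in>K. mode V (u k) n (v k)) = 0"
  shows "(\<Sum>k\<in>K. mode V (mode V a l (u k)) n (v k)) = 0"
proof -
  define F where "F l n = (\<Sum>k\<in>K. mode V (mode V a l (u k)) n (v k))" for l n
  obtain N :: nat where N: "\<And>k n. k \<in> K \<Longrightarrow> n \<ge> int N \<Longrightarrow> mode V a n (v k) = 0"
    using finite_truncation[OF assms(1), where u = "\<lambda>k. a" and v = v] by blast
  obtain L :: nat where L: "\<And>k n. k \<in> K \<Longrightarrow> n \<ge> int L \<Longrightarrow> mode V a n (u k) = 0"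
    using finite_truncation[OF assms(1), where u = "\<lambda>k. a" and v = u] by blast
  obtain M :: nat where M: "\<And>k n. k \<in> K \<Longrightarrow> n \<ge> int M \<Longrightarrow> mode V (u k) n (v k) = 0"
    using finite_truncation[OF assms(1), where u = u and v = v] by blast
  have "\<forall>n. F l n = 0"
  \<comment> \<open>Downward induction on \<open>l\<close>: for \<open>l \<ge> int L\<close> all
    terms vanish, and the factor is cancelled starting from the lowest power of
    \<open>z\<^sub>0\<close>.\<close>
  proof (induction "nat (int L - l)" arbitrary: l rule: less_induct)
    case less
    have F0: "F (l + int i) p = 0" if "i \<noteq> 0" for i p
    proof (cases "l + int i \<ge> int L")
      case True
      then show ?thesis using L by (simp add: F_def)
    next
      case False
      then show ?thesis using less[of "l + int i"] that by auto
    qed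
    show ?case
    proof
      fix n
      \<comment> \<open>The Jacobi identity is used with \<open>m = int N\<close>: the modes of
        \<open>a\<close> from \<open>N\<close> on kill \<open>v k\<close>, which removes its second
        sum. The shift by \<open>N\<close> turns the term \<open>i = 0\<close> of its right-hand
        side into mode \<open>n\<close>; \<open>P\<close> and \<open>Q\<close> bound the two
        remaining sums.\<close>
      define n' where "n' = n - int N"
      define P where "P = nat (int M - n')"
      define Q where "Q = Suc (nat (int L - l))"
      have "(\<Sum>i<P. vscale V ((of_int l gchoose i) * (- 1) ^ i)
          (mode V a (int N + l - int i) (mode V (u k) (n' + int i) (v k)))) =
        (\<Sum>i<Q. vscale V (of_int (int N) gchoose i)
          (mode V (mode V a (l + int i) (u k)) (int N + n' - int i) (v k)))" if k: "k \<in> K" for k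
      proof -
        have "Sum_any (\<lambda>i::nat. vscale V ((of_int l gchoose i) * (- 1) ^ i)
            (mode V a (int N + l - int i) (mode V (u k) (n' + int i) (v k)))) =
          (\<Sum>i<P. vscale V ((of_int l gchoose i) * (- 1) ^ i)
            (mode V a (int N + l - int i) (mode V (u k) (n' + int i) (v k))))"
          by (rule Sum_any_lessThan) (use M[OF k] in \<open>simp add: P_def\<close>)
        moreover have "Sum_any (\<lambda>i::nat. vscale V (of_int (int N) gchoose i)
            (mode V (mode V a (l + int i) (u k)) (int N + n' - int i) (v k))) =
          (\<Sum>i<Q. vscale V (of_int (int N) gchoose i)
            (mode V (mode V a (l + int i) (u k)) (int N + n' - int i) (v k)))"
          by (rule Sum_any_lessThan) (use L[OF k] in \<open>simp add: Q_def\<close>)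
        ultimately show ?thesis
          using jacobi[of l a "int N" "u k" n' "v k"] N[OF k] by simp
      qed
      then have "(\<Sum>k\<in>K. \<Sum>i<P. vscale V ((of_int l gchoose i) * (- 1) ^ i)
          (mode V a (int N + l - int i) (mode V (u k) (n' + int i) (v k)))) =
        (\<Sum>k\<in>K. \<Sum>i<Q. vscale V (of_int (int N) gchoose i)
          (mode V (mode V a (l + int i) (u k)) (int N + n' - int i) (v k)))"
        by (rule sum.cong[OF refl])
      also have "(\<Sum>k\<in>K. \<Sum>i<P. vscale V ((of_int l gchoose i) * (- 1) ^ i)
          (mode V a (int N + l - int i) (mode V (u k) (n' + int i) (v k)))) =
        (\<Sum>i<P. vscale V ((of_int l gchoose i) * (- 1) ^ i)
          (mode V a (int N + l - int i) (\<Sum>k\<in>K. mode V (u k) (n' + int i) (v k))))"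
        by (subst sum.swap) (simp add: mode_sum VV.scale_sum_right)
      also have "\<dots> = 0" by (simp add: zero)
      also have "(\<Sum>k\<in>K. \<Sum>i<Q. vscale V (of_int (int N) gchoose i)
          (mode V (mode V a (l + int i) (u k)) (int N + n' - int i) (v k))) =
        (\<Sum>i<Q. vscale V (of_int (int N) gchoose i) (F (l + int i) (int N + n' - int i)))"
        by (subst sum.swap) (simp add: F_def VV.scale_sum_right)
      \<comment> \<open>By induction only \<open>i = 0\<close> survives, with binomial coefficient
        one.\<close>
      also have "\<dots> = (\<Sum>i<Q. if i = 0 then F l n else 0)"
        by (rule sum.cong) (auto simp: F0 n'_def)
      also have "\<dots> = F l n" by (simp add: Q_def)
      finally show "F l n = 0" by simp
    qed
  qed
  then show ?thesis by (simp add: F_def)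
qed

text \<open>The tuples satisfying the assumed relation form a space \<open>L\<close> stable under
  all modes. By induction on the number of vectors a tuple is determined by its entry at
  \<open>b0\<close>, and these entries form an ideal. If the ideal is zero, so is \<open>u\<close>.
  If it is \<open>V\<close>, every entry is a linear function of the entry at \<open>b0\<close>
  commuting with all modes, hence a scalar multiple of it; the tuple over the vacuum then
  contradicts independence.\<close>

lemma vanishing_imp_zero:
  assumes "simple_voa V" "finite K" "VV.independent K"
    and "\<And>n. (\<Sum>b\<in>K. mode V (u b) n b) = 0" "b \<in> K"
  shows "u b = 0"
  using assms(2-5)
proof (induction K arbitrary: u b rule: finite_induct)
  case (insert b0 K)
  define L where "L = {u. \<forall>n. (\<Sum>b\<in>insert b0 K. mode V (u b) n b) = 0}"
  have uniq: "w b = 0" if "w \<in> L" "w b0 = 0" "b \<in> insert b0 K" for w b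
  proof (cases "b = b0")
    case False
    have "VV.independent K" using insert.prems(1) by (rule VV.independent_mono) auto
    then show ?thesis
      using insert.IH[of w b] that insert.hyps False by (simp add: L_def)
  qed (use that in simp)
  have Ladd: "(\<lambda>b. w b + w' b) \<in> L" if "w \<in> L" "w' \<in> L" for w w'
    using that by (simp add: L_def sum.distrib del: sum.insert)
  have Lscale: "(\<lambda>b. vscale V c (w b)) \<in> L" if "w \<in> L" for c w
    using that by (simp add: L_def VV.scale_sum_right[symmetric] del: sum.insert)
  have Lmode: "(\<lambda>b. mode V a m (w b)) \<in> L" if "w \<in> L" for a m w
    unfolding L_def mem_Collect_eq
    by (rule allI, rule vanishing_mode_left) (use that insert.hyps in \<open>auto simp: L_def\<close>)
  have L0: "(\<lambda>b. 0) \<in> L" by (simp add: L_def)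
  have eq: "w b = w' b" if "w \<in> L" "w' \<in> L" "w b0 = w' b0" "b \<in> insert b0 K" for w w' b
    using uniq[OF Ladd[OF that(1) Lscale[OF that(2), of "-1"]], of b] that(3,4) by simp
  have "u \<in> L" using insert.prems(2) by (simp add: L_def del: sum.insert)
  let ?I = "(\<lambda>w. w b0) ` L"
  have "voa_ideal V ?I"
  proof (rule voa_idealI)
    show "VV.subspace ?I"
    proof (rule VV.subspaceI)
      show "0 \<in> ?I" using L0 by (intro image_eqI[where x = "\<lambda>b. 0"]) auto
    next
      fix x y assume "x \<in> ?I" "y \<in> ?I"
      then obtain w w' where "x = w b0" "w \<in> L" "y = w' b0" "w' \<in> L" by auto
      then show "x + y \<in> ?I" using Ladd[of w w'] by (intro image_eqI[where x = "\<lambda>b. w b + w' b"]) auto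
    next
      fix c x assume "x \<in> ?I"
      then obtain w where "x = w b0" "w \<in> L" by auto
      then show "vscale V c x \<in> ?I" using Lscale[of w c] by (intro image_eqI[where x = "\<lambda>b. vscale V c (w b)"]) auto
    qed
    fix a x m assume "x \<in> ?I"
    then obtain w where "x = w b0" "w \<in> L" by auto
    then show "mode V a m x \<in> ?I" using Lmode[of w a m] by (intro image_eqI[where x = "\<lambda>b. mode V a m (w b)"]) auto
  qed
  then consider "?I = {0}" | "?I = UNIV" using assms(1) by (auto simp: simple_voa_def)
  then show ?case
  proof cases
    case 1
    then have "u b0 = 0" using \<open>u \<in> L\<close> by blast
    then show ?thesis using uniq[OF \<open>u \<in> L\<close>] insert.prems(3) by simp
  next
    case 2
    then have "\<forall>x. \<exists>w. w \<in> L \<and> w b0 = x" by (metis UNIV_I imageE)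
    \<comment> \<open>\<open>\<Theta> x\<close> is a tuple of \<open>L\<close> with entry
      \<open>x\<close> at \<open>b0\<close>; by \<open>eq\<close> its entries on
      \<open>insert b0 K\<close> are unique, which makes them linear in \<open>x\<close> and
      compatible with all modes.\<close>
    then obtain \<Theta> where \<Theta>: "\<And>x. \<Theta> x \<in> L" "\<And>x. \<Theta> x b0 = x" by metis
    have "\<exists>c. \<forall>x. \<Theta> x b = vscale V c x" if b: "b \<in> insert b0 K" for b
    proof -
      have "\<Theta> (x + y) b = \<Theta> x b + \<Theta> y b" for x y
        using eq[OF \<Theta>(1) Ladd[OF \<Theta>(1) \<Theta>(1)] _ b] \<Theta>(2) by simp
      moreover have "\<Theta> (vscale V c x) b = vscale V c (\<Theta> x b)" for c x
        using eq[OF \<Theta>(1) Lscale[OF \<Theta>(1)] _ b] \<Theta>(2) by simp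
      moreover have "\<Theta> (mode V a m x) b = mode V a m (\<Theta> x b)" for a m x
        using eq[OF \<Theta>(1) Lmode[OF \<Theta>(1)] _ b] \<Theta>(2) by simp
      ultimately obtain c where "\<And>x. \<Theta> x b = vscale V c x"
        using schur[OF assms(1), of "\<lambda>x. \<Theta> x b", OF linear_onI] by blast
      then show ?thesis by blast
    qed
    then have "\<forall>b\<in>insert b0 K. \<exists>c. \<forall>x. \<Theta> x b = vscale V c x" by blast
    from bchoice[OF this] obtain c
      where c: "\<And>b x. b \<in> insert b0 K \<Longrightarrow> \<Theta> x b = vscale V (c b) x" by blast
    \<comment> \<open>Mode \<open>- 1\<close> of the vacuum is the identity, so the tuple over the
      vacuum becomes a linear relation between the vectors \<open>b\<close>. Independence gives
      \<open>c b0 = 0\<close>, although the entry at \<open>b0\<close> is the vacuum itself.\<close>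
    have "(\<Sum>b\<in>insert b0 K. mode V (\<Theta> (vac V) b) (- 1) b) = 0"
      using \<Theta>(1) by (simp add: L_def del: sum.insert)
    then have "(\<Sum>b\<in>insert b0 K. vscale V (c b) b) = 0"
      by (simp add: c vacuum del: sum.insert)
    then have "c b0 = 0"
      using insert.hyps insert.prems(1) VV.independentD[of "insert b0 K" "insert b0 K" c b0] by blast
    then have "vac V = 0" using c[of b0 "vac V"] \<Theta>(2) by simp
    then show ?thesis using vac_nonzero[OF assms(1)] by simp
  qed
qed simp

text \<open>The conclusion is the vanishing of the tensor with summands u_k \<otimes> v_k, read off
  by coordinates in the second factor. Only finitely many basis vectors, collected in
  \<open>C\<close>, occur in the \<open>v k\<close>; regrouping along them makes the second factors
  independent.\<close>

lemma vanishing_imp_tensor_zero: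
  assumes "simple_voa V" "finite K" "VV.independent B" "VV.span B = UNIV"
    and zero: "\<And>n. (\<Sum>k\<in>K. mode V (u k) n (v k)) = 0"
  shows "(\<Sum>k\<in>K. vscale V (VV.representation B (v k) b) (u k)) = 0"
proof -
  define C where "C = (\<Union>k\<in>K. {b. VV.representation B (v k) b \<noteq> 0})"
  have C: "finite C" "C \<subseteq> B"
    using assms(2) VV.finite_representation VV.representation_ne_zero by (auto simp: C_def)
  show ?thesis
  proof (cases "b \<in> C")
    case True
    define w where "w b = (\<Sum>k\<in>K. vscale V (VV.representation B (v k) b) (u k))" for b
    have v: "v k = (\<Sum>b\<in>C. vscale V (VV.representation B (v k) b) b)" if "k \<in> K" for k
    proof -
      have "(\<Sum>b | VV.representation B (v k) b \<noteq> 0. vscale V (VV.representation B (v k) b) b) = v k"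
        using VV.sum_nonzero_representation_eq[OF assms(3)] assms(4) by simp
      moreover have "(\<Sum>b\<in>C. vscale V (VV.representation B (v k) b) b) =
          (\<Sum>b | VV.representation B (v k) b \<noteq> 0. vscale V (VV.representation B (v k) b) b)"
        using C(1) that by (intro sum.mono_neutral_right) (auto simp: C_def)
      ultimately show ?thesis by simp
    qed
    have "(\<Sum>b\<in>C. mode V (w b) n b) = 0" for n
    proof -
      have "(\<Sum>b\<in>C. mode V (w b) n b) =
          (\<Sum>k\<in>K. \<Sum>b\<in>C. vscale V (VV.representation B (v k) b) (mode V (u k) n b))"
        unfolding w_def by (subst sum.swap) (simp add: state_sum)
      also have "\<dots> = (\<Sum>k\<in>K. mode V (u k) n (\<Sum>b\<in>C. vscale V (VV.representation B (v k) b) b))"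
        by (simp add: mode_sum)
      also have "\<dots> = (\<Sum>k\<in>K. mode V (u k) n (v k))"
        by (rule sum.cong[OF refl]) (simp add: v[symmetric])
      finally show ?thesis by (simp add: zero)
    qed
    then have "w b = 0"
      using vanishing_imp_zero[OF assms(1) C(1) VV.independent_mono[OF assms(3) C(2)]] True by blast
    then show ?thesis by (simp add: w_def)
  next
    case False
    then show ?thesis by (auto simp: C_def intro!: sum.neutral)
  qed
qed

end

section \<open>Hopf ideals of finite dimensional Hopf algebras\<close>

context hopf_algebra
begin

section \<open>Convolution powers of the identity\<close>

primrec conv_power :: "nat \<Rightarrow> 'h \<Rightarrow> 'h" where
  "conv_power 0 h = hscale H (counit H h) \<one>"
| "conv_power (Suc n) h = sw (hscale H) (\<lambda>a b. a \<otimes> conv_power n b) h"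

lemma counit_dual: "dual (counit H)"
  by (rule counit_linear)

lemma conv_power_carrier [simp]: "h \<in> carrier H \<Longrightarrow> conv_power n h \<in> carrier H"
  by (induction n arbitrary: h) (auto intro: sw_carrier)

lemma conv_power_linear: "linear_on (carrier H) (hscale H) (hscale H) (conv_power n)"
proof (induction n)
  case 0
  show ?case
    using counit_linear by (auto simp: linear_on_def VS.scale_left_distrib)
next
  case (Suc n)
  have "bilinear_on (carrier H) (hscale H) (hscale H) (\<lambda>a b. a \<otimes> conv_power n b)"
    using Suc by (auto simp: bilinear_on_def linear_on_def)
  then show ?case
    by (simp add: sw_linear[OF vector_space_scale])
qed

lemma conv_power_1: "h \<in> carrier H \<Longrightarrow> conv_power (Suc 0) h = h"
  using sw_cong[of h "\<lambda>a b. a \<otimes> conv_power 0 b" "\<lambda>a b. hscale H (counit H b) a" "hscale H"]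
    sw_counit_right by simp

lemma antipode_add: "x \<in> carrier H \<Longrightarrow> y \<in> carrier H \<Longrightarrow> antipode H (x + y) = antipode H x + antipode H y"
  and antipode_scale: "x \<in> carrier H \<Longrightarrow> antipode H (hscale H c x) = hscale H c (antipode H x)"
  using antipode_linear by (auto simp: linear_on_def)

lemma antipode_conv_0:
  assumes "h \<in> carrier H"
  shows "sw (hscale H) (\<lambda>a b. antipode H a \<otimes> conv_power 0 b) h = antipode H h"
proof -
  have "sw (hscale H) (\<lambda>a b. antipode H a \<otimes> conv_power 0 b) h =
      sw (hscale H) (\<lambda>a b. antipode H (hscale H (counit H b) a)) h"
    by (rule sw_cong[OF assms]) (simp add: antipode_closed antipode_scale)
  also have "\<dots> = antipode H (sw (hscale H) (\<lambda>a b. hscale H (counit H b) a) h)"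
    using assms
    by (intro sw_apply[OF vector_space_scale vector_space_scale antipode_linear subspace_carrier, symmetric]) auto
  finally show ?thesis using sw_counit_right[OF assms] by simp
qed

text \<open>Convolution is associative and the antipode is a left convolution inverse of the
  identity, so convolving with it from the left lowers the exponent by one.\<close>

lemma antipode_conv_Suc:
  assumes h: "h \<in> carrier H"
  shows "sw (hscale H) (\<lambda>a b. antipode H a \<otimes> conv_power (Suc n) b) h = conv_power n h"
proof -
  let ?s = "hscale H"
  note vs = vector_space_scale
  have "sw ?s (\<lambda>a b. antipode H a \<otimes> conv_power (Suc n) b) h =
      sw ?s (\<lambda>a b. sw ?s (\<lambda>b1 b2. antipode H a \<otimes> (b1 \<otimes> conv_power n b2)) b) h"
    unfolding conv_power.simps
    by (intro sw_cong[OF h] sw_apply[OF vs vs mult_linear_right subspace_carrier]) (auto simp: antipode_closed)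
  also have "\<dots> = sw ?s (\<lambda>a b. sw ?s (\<lambda>a1 a2. antipode H a1 \<otimes> (a2 \<otimes> conv_power n b)) a) h"
    using conv_power_linear[of n]
    by (intro sw_coassoc[OF vs _ h, symmetric])
      (auto simp: trilinear_on_def linear_on_def antipode_closed antipode_add antipode_scale)
  also have "\<dots> = sw ?s (\<lambda>a b. sw ?s (\<lambda>a1 a2. antipode H a1 \<otimes> a2) a \<otimes> conv_power n b) h"
    by (intro sw_cong[OF h])
      (subst sw_apply[OF vs vs mult_linear_left subspace_carrier];
       auto intro!: sw_cong simp: antipode_closed m_assoc)
  also have "\<dots> = sw ?s (\<lambda>a b. conv_power n (?s (counit H a) b)) h"
    by (intro sw_cong[OF h]) (simp add: sw_antipode_left linear_on_scale[OF conv_power_linear])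
  also have "\<dots> = conv_power n (sw ?s (\<lambda>a b. ?s (counit H a) b) h)"
    using h by (intro sw_apply[OF vs vs conv_power_linear subspace_carrier, symmetric]) auto
  finally show ?thesis using sw_counit_left[OF h] by simp
qed

lemma antipode_conv_relation:
  assumes rel: "\<And>h. h \<in> carrier H \<Longrightarrow> (\<Sum>n\<le>N. hscale H (c n) (conv_power n h)) = 0"
    and h: "h \<in> carrier H"
  shows "(\<Sum>n\<le>N. hscale H (c n) (sw (hscale H) (\<lambda>a b. antipode H a \<otimes> conv_power n b) h)) = 0"
proof -
  have "(\<Sum>n\<le>N. hscale H (c n) (sw (hscale H) (\<lambda>a b. antipode H a \<otimes> conv_power n b) h)) =
      sw (hscale H) (\<lambda>a b. \<Sum>n\<le>N. hscale H (c n) (antipode H a \<otimes> conv_power n b)) h"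
    by (simp add: sw_sum_fun[OF vector_space_scale] sw_scale_fun[OF vector_space_scale])
  also have "\<dots> = sw (hscale H) (\<lambda>a b. antipode H a \<otimes> (\<Sum>n\<le>N. hscale H (c n) (conv_power n b))) h"
    by (rule sw_cong[OF h]) (simp add: mult_sum_right antipode_closed)
  also have "\<dots> = sw (hscale H) (\<lambda>a b. antipode H a \<otimes> 0) h"
    by (rule sw_cong[OF h]) (simp add: rel)
  also have "\<dots> = sw (hscale H) (\<lambda>a b. 0) h"
    using linear_on_zero[OF vector_space_scale vector_space_scale mult_linear_right subspace_carrier]
    by (intro sw_cong[OF h]) (simp add: antipode_closed)
  also have "\<dots> = 0" by (rule sw_zero_fun[OF vector_space_scale])
  finally show ?thesis .
qed

lemma finite_basis:
  assumes "finite_dim (hscale H) (carrier H)"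
  obtains B where "finite B" "B \<subseteq> carrier H" "VS.independent B" "VS.span B = carrier H"
  using assms VS.finite_basis_of_finite_dim[OF subspace_carrier _ _ _ _ subspace_carrier]
  by (metis finite_dim_def subset_refl)

lemma conv_power_relation:
  assumes "finite_dim (hscale H) (carrier H)"
  obtains c N where "c N \<noteq> 0"
    "\<And>h. h \<in> carrier H \<Longrightarrow> (\<Sum>n\<le>N. hscale H (c n) (conv_power n h)) = 0"
proof -
  obtain B where B: "finite B" "B \<subseteq> carrier H" "VS.independent B" "VS.span B = carrier H"
    by (rule finite_basis[OF assms])
  let ?r = "VS.representation B"
  \<comment> \<open>\<open>v n\<close> is the matrix of \<open>conv_power n\<close> in the basis
    \<open>B\<close>, encoded in the free space on \<open>B \<times> B\<close> so that a dependence
    between endomorphisms is one between vectors.\<close>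
  define v where "v n = (\<Sum>p\<in>B \<times> B. Poly_Mapping.single p (?r (conv_power n (fst p)) (snd p)))" for n
  have lookup_v: "Poly_Mapping.lookup (v n) (i, j) = ?r (conv_power n i) j"
    if "i \<in> B" "j \<in> B" for n i j
  proof -
    have "Poly_Mapping.lookup (v n) (i, j) =
        (\<Sum>p\<in>B \<times> B. if p = (i, j) then ?r (conv_power n i) j else 0)"
      unfolding v_def lookup_sum by (rule sum.cong) (auto simp: lookup_single when_def)
    then show ?thesis using that B(1) by simp
  qed
  have "v n \<in> free.span (free_gen ` (B \<times> B))" for n
    unfolding v_def
  proof (rule free.span_sum)
    fix p assume "p \<in> B \<times> B"
    then have "free_scale (?r (conv_power n (fst p)) (snd p)) (free_gen p) \<in> free.span (free_gen ` (B \<times> B))"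
      by (intro free.span_scale free.span_base) auto
    then show "Poly_Mapping.single p (?r (conv_power n (fst p)) (snd p)) \<in> free.span (free_gen ` (B \<times> B))"
      by (simp add: free_scale_single)
  qed
  then obtain n where "v n \<in> free.span (v ` {..<n})"
    using free.finite_dim_imp_relation[of "free_gen ` (B \<times> B)" v] B(1) by auto
  then obtain c where c: "v n = (\<Sum>i<n. free_scale (c i) (v i))"
    by (rule free.in_span_image_lessThan)
  \<comment> \<open>The coefficient \<open>- 1\<close> brings \<open>v n\<close> to the other side
    and is the nonzero leading coefficient.\<close>
  define c' where "c' = c(n := -1)"
  have "(\<Sum>k\<le>n. hscale H (c' k) (conv_power k h)) = 0" if h: "h \<in> carrier H" for h
  proof -
    let ?f = "\<lambda>h. \<Sum>k\<le>n. hscale H (c' k) (conv_power k h)"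
    have lin: "linear_on (carrier H) (hscale H) (hscale H) ?f"
    proof (rule linear_onI)
      show "?f (x + y) = ?f x + ?f y" if "x \<in> carrier H" "y \<in> carrier H" for x y
        using that by (simp only: linear_on_add[OF conv_power_linear] VS.scale_right_distrib sum.distrib)
      show "?f (hscale H d x) = hscale H d (?f x)" if "x \<in> carrier H" for d x
        using that
        by (simp only: linear_on_scale[OF conv_power_linear] VS.scale_left_commute[of _ d] VS.scale_sum_right)
    qed
    have "?f b = 0" if b: "b \<in> B" for b
    proof -
      have bA: "b \<in> carrier H" using b B by blast
      have "?r (?f b) j = 0" if j: "j \<in> B" for j
      proof -
        have "?r (?f b) j = (\<Sum>k\<le>n. c' k * ?r (conv_power k b) j)"
          using bA B(3,4) by (simp add: VS.representation_sum VS.representation_scale VS.span_scale)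
        also have "\<dots> = (\<Sum>k<n. c k * ?r (conv_power k b) j) - ?r (conv_power n b) j"
          by (simp add: c'_def lessThan_Suc_atMost[symmetric])
        also have "\<dots> = 0"
          using arg_cong[OF c, of "\<lambda>v. Poly_Mapping.lookup v (b, j)"] b j
          by (simp add: lookup_sum lookup_free_scale lookup_v)
        finally show ?thesis .
      qed
      moreover have "?f b \<in> VS.span B" unfolding B(4) using bA by (intro carrier_sum) simp
      ultimately show ?thesis
        using VS.sum_representation[OF B(3,1), of "?f b"] by simp
    qed
    moreover have "?f h = (\<Sum>b\<in>B. hscale H (?r h b) (?f b))"
    proof -
      have "?f h = ?f (\<Sum>b\<in>B. hscale H (?r h b) b)"
        using VS.sum_representation[OF B(3,1)] h B(4) by simp
      also have "\<dots> = (\<Sum>b\<in>B. ?f (hscale H (?r h b) b))"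
        using B(2) by (intro linear_on_sum[OF vector_space_scale vector_space_scale lin subspace_carrier]) auto
      also have "\<dots> = (\<Sum>b\<in>B. hscale H (?r h b) (?f b))"
        using B(2) by (intro sum.cong linear_on_scale[OF lin]) auto
      finally show ?thesis .
    qed
    ultimately show ?thesis by simp
  qed
  moreover have "c' n \<noteq> 0" by (simp add: c'_def)
  ultimately show thesis using that by blast
qed

text \<open>In a finite dimensional Hopf algebra, the convolution inverse \<open>S\<close> of the identity is a
  polynomial in the convolution powers of the identity. This comes from a relation of minimal
  degree between these powers.\<close>

lemma conv_power_relation_unit:
  assumes "finite_dim (hscale H) (carrier H)"
  obtains c N where "c 0 \<noteq> 0"
    "\<forall>h\<in>carrier H. (\<Sum>n\<le>N. hscale H (c n) (conv_power n h)) = 0"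
proof -
  define P where "P N \<longleftrightarrow> (\<exists>c. c N \<noteq> 0 \<and>
    (\<forall>h\<in>carrier H. (\<Sum>n\<le>N. hscale H (c n) (conv_power n h)) = 0))" for N
  have "\<exists>N. P N"
    using conv_power_relation[OF assms] unfolding P_def by metis
  then obtain N where N: "P N" "\<And>M. M < N \<Longrightarrow> \<not> P M"
    using exists_least_iff[of P] by blast
  then obtain c where c: "c N \<noteq> 0" "\<And>h. h \<in> carrier H \<Longrightarrow> (\<Sum>n\<le>N. hscale H (c n) (conv_power n h)) = 0"
    by (auto simp: P_def)
  have "c 0 \<noteq> 0"
  proof
    \<comment> \<open>Without a constant term, convolving with the antipode would lower all
      exponents and leave a relation of smaller degree.\<close>
    assume c0: "c 0 = 0"
    with c(1) obtain M where M: "N = Suc M" by (cases N) auto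
    have "(\<Sum>n\<le>M. hscale H (c (Suc n)) (conv_power n h)) = 0" if h: "h \<in> carrier H" for h
      using antipode_conv_relation[OF c(2) h] c0
      unfolding M sum.atMost_Suc_shift by (simp only: antipode_conv_Suc[OF h]) simp
    then have "P M" using c(1) M by (auto simp: P_def intro!: exI[of _ "\<lambda>n. c (Suc n)"])
    then show False using N(2) M by blast
  qed
  then show thesis using that c(2) by blast
qed

lemma biideal_imp_hopf_ideal:
  assumes fd: "finite_dim (hscale H) (carrier H)"
    and K: "K \<subseteq> carrier H" "VS.subspace K" "\<one> \<notin> K"
    and ideal: "\<And>x h. x \<in> K \<Longrightarrow> h \<in> carrier H \<Longrightarrow> x \<otimes> h \<in> K"
      "\<And>x h. x \<in> K \<Longrightarrow> h \<in> carrier H \<Longrightarrow> h \<otimes> x \<in> K"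
    and coideal: "\<And>x. x \<in> K \<Longrightarrow>
      \<exists>t\<in>comult H x. Poly_Mapping.keys t \<subseteq> carrier H \<times> K \<union> K \<times> carrier H"
  shows "hopf_ideal H K"
proof -
  obtain c N where "c 0 \<noteq> 0" "\<forall>h\<in>carrier H. (\<Sum>n\<le>N. hscale H (c n) (conv_power n h)) = 0"
    by (rule conv_power_relation_unit[OF fd])
  then have c: "c 0 \<noteq> 0"
    "\<And>h. h \<in> carrier H \<Longrightarrow> (\<Sum>n\<le>N. hscale H (c n) (conv_power n h)) = 0"
    by blast+
  \<comment> \<open>Each pure tensor in a suitable expression has a factor in \<open>K\<close>, and
    applying the smaller power keeps the second factor there, so the product lies in the ideal.
    Exponent \<open>0\<close> is left out: it yields multiples of \<open>\<one>\<close> as long as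
    the counit is not known to vanish on \<open>K\<close>.\<close>
  have pos: "conv_power (Suc n) x \<in> K" if "x \<in> K" for n x
    using that
  proof (induction n arbitrary: x)
    case 0
    then show ?case using K conv_power_1 by auto
  next
    case (Suc n)
    obtain t where t: "t \<in> comult H x" "Poly_Mapping.keys t \<subseteq> carrier H \<times> K \<union> K \<times> carrier H"
      using coideal[OF Suc.prems] by blast
    have bil: "bilinear_on (carrier H) (hscale H) (hscale H) (\<lambda>a b. a \<otimes> conv_power (Suc n) b)"
      using conv_power_linear[of "Suc n"]
      by (auto simp: bilinear_on_def linear_on_def simp del: conv_power.simps)
    have x: "x \<in> carrier H" using Suc.prems K by blast
    have "lin_ext (hscale H) (\<lambda>(a, b). a \<otimes> conv_power (Suc n) b) t \<in> K"
    proof (rule lin_ext_in_subspace[OF vector_space_scale K(2)])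
      fix k assume "k \<in> Poly_Mapping.keys t"
      then show "(case k of (a, b) \<Rightarrow> a \<otimes> conv_power (Suc n) b) \<in> K"
        using t(2) Suc.IH ideal by (auto simp del: conv_power.simps)
    qed
    then show ?case using sw_eq[OF vector_space_scale bil x t(1)] by simp
  qed
  note Kadd = VS.subspace_add[OF K(2)] and Kscale = VS.subspace_scale[OF K(2)]
    and Ksum = VS.subspace_sum[OF K(2)] and Kneg = VS.subspace_neg[OF K(2)]
  have counit: "counit H x = 0" if x: "x \<in> K" for x
  proof (rule ccontr)
    assume e: "counit H x \<noteq> 0"
    have "hscale H (c 0) (conv_power 0 x) + (\<Sum>n<N. hscale H (c (Suc n)) (conv_power (Suc n) x)) = 0"
      using c(2)[of x] x K(1) by (auto simp: sum.atMost_shift simp del: conv_power.simps)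
    then have "hscale H (c 0) (conv_power 0 x) = - (\<Sum>n<N. hscale H (c (Suc n)) (conv_power (Suc n) x))"
      by (simp add: eq_neg_iff_add_eq_0)
    also have "\<dots> \<in> K" by (intro Kneg Ksum Kscale pos x)
    finally have "hscale H (c 0 * counit H x) \<one> \<in> K" by simp
    then have "hscale H (inverse (c 0 * counit H x)) (hscale H (c 0 * counit H x) \<one>) \<in> K"
      by (rule Kscale)
    moreover have "inverse (c 0 * counit H x) * (c 0 * counit H x) = 1"
      using e c(1) by (intro left_inverse) simp
    ultimately show False using K(3) by (simp only: VS.scale_scale VS.scale_one)
  qed
  have "antipode H x \<in> K" if x: "x \<in> K" for x
  proof -
    have xA: "x \<in> carrier H" using x K by blast
    \<comment> \<open>Now that the counit vanishes at \<open>x\<close>, exponent \<open>0\<close>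
      contributes \<open>0\<close>; the relation convolved with the antipode involves this
      exponent.\<close>
    have "conv_power n x \<in> K" for n
      using pos[OF x] counit[OF x] VS.subspace_0[OF K(2)] by (cases n) auto
    then have "- (\<Sum>n<N. hscale H (c (Suc n)) (conv_power n x)) \<in> K"
      by (intro Kneg Ksum Kscale)
    moreover have "hscale H (c 0) (antipode H x) + (\<Sum>n<N. hscale H (c (Suc n)) (conv_power n x)) = 0"
      using antipode_conv_relation[OF c(2) xA]
      unfolding sum.atMost_shift by (simp only: antipode_conv_Suc[OF xA] antipode_conv_0[OF xA])
    ultimately have "hscale H (c 0) (antipode H x) \<in> K" by (simp add: eq_neg_iff_add_eq_0[symmetric])
    then have "hscale H (inverse (c 0)) (hscale H (c 0) (antipode H x)) \<in> K" by (rule Kscale)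
    then show ?thesis using c(1) by simp
  qed
  then show ?thesis
    using K ideal coideal counit by (auto simp: hopf_ideal_def)
qed

end

section \<open>Cocommutative Hopf algebras\<close>

context hopf_algebra
begin

text \<open>The action on \<open>H\<close> of the functional \<open>f\<close> as an element of the
  dual algebra. It turns statements about the comultiplication into statements about operators on
  \<open>H\<close>.\<close>

definition slice :: "('h \<Rightarrow> complex) \<Rightarrow> 'h \<Rightarrow> 'h"
  where "slice f h = sw (hscale H) (\<lambda>a b. hscale H (f b) a) h"

lemma bilinear_slice: "dual f \<Longrightarrow> bilinear_on (carrier H) (hscale H) (hscale H) (\<lambda>a b. hscale H (f b) a)"
  by (auto simp: bilinear_on_def linear_on_def VS.scale_left_distrib VS.scale_right_distrib mult.commute)

lemma slice_carrier [simp]: "h \<in> carrier H \<Longrightarrow> slice f h \<in> carrier H"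
  unfolding slice_def by (rule sw_carrier) auto

lemma slice_linear: "dual f \<Longrightarrow> linear_on (carrier H) (hscale H) (hscale H) (slice f)"
  unfolding slice_def[abs_def] by (rule sw_linear[OF vector_space_scale bilinear_slice])

lemma slice_add: "dual f \<Longrightarrow> x \<in> carrier H \<Longrightarrow> y \<in> carrier H \<Longrightarrow> slice f (x + y) = slice f x + slice f y"
  and slice_scale: "dual f \<Longrightarrow> x \<in> carrier H \<Longrightarrow> slice f (hscale H c x) = hscale H c (slice f x)"
  using slice_linear by (auto simp: linear_on_def)

lemma slice_sum: "dual f \<Longrightarrow> (\<And>i. i \<in> I \<Longrightarrow> g i \<in> carrier H) \<Longrightarrow> slice f (sum g I) = (\<Sum>i\<in>I. slice f (g i))"
  by (rule linear_on_sum[OF vector_space_scale vector_space_scale slice_linear subspace_carrier])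

lemma slice_diff: "dual f \<Longrightarrow> x \<in> carrier H \<Longrightarrow> y \<in> carrier H \<Longrightarrow> slice f (x - y) = slice f x - slice f y"
  by (rule linear_on_diff[OF vector_space_scale vector_space_scale slice_linear subspace_carrier])

lemma dual_slice:
  assumes "dual f" "h \<in> carrier H"
  shows "f (slice f' h) = sw (*) (\<lambda>a b. f a * f' b) h"
proof -
  have "f (slice f' h) = sw (*) (\<lambda>a b. f (hscale H (f' b) a)) h"
    unfolding slice_def
    using assms by (intro sw_apply[OF vector_space_scale vector_space_complex _ subspace_carrier]) auto
  also have "\<dots> = sw (*) (\<lambda>a b. f a * f' b) h"
    using assms by (intro sw_cong) (auto simp: dual_scale)
  finally show ?thesis .
qed

lemma slice_counit: "h \<in> carrier H \<Longrightarrow> slice (counit H) h = h"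
  by (simp add: slice_def sw_counit_right)

lemma counit_slice:
  assumes "dual f" "h \<in> carrier H"
  shows "counit H (slice f h) = f h"
proof -
  have "counit H (slice f h) = sw (*) (\<lambda>a b. f (hscale H (counit H a) b)) h"
    unfolding dual_slice[OF counit_dual assms(2)]
    using assms by (intro sw_cong) (auto simp: dual_scale)
  also have "\<dots> = f (sw (hscale H) (\<lambda>a b. hscale H (counit H a) b) h)"
    using assms
    by (intro sw_apply[OF vector_space_scale vector_space_complex _ subspace_carrier, symmetric]) auto
  finally show ?thesis using assms by (simp add: sw_counit_left)
qed

lemma dual_comp_slice: "dual f \<Longrightarrow> dual f' \<Longrightarrow> dual (\<lambda>x. f (slice f' x))"
  by (rule linear_onI) (auto simp: slice_add slice_scale dual_add dual_scale)

text \<open>Coassociativity in the form that slicing is an action: the functional on the right-hand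
  side is the convolution product of \<open>f\<close> and \<open>f'\<close>.\<close>

lemma slice_slice:
  assumes f: "dual f" "dual f'" and h: "h \<in> carrier H"
  shows "slice f (slice f' h) = slice (\<lambda>x. f (slice f' x)) h"
proof -
  let ?s = "hscale H"
  note vs = vector_space_scale
  have "slice f (slice f' h) = sw ?s (\<lambda>a b. slice f (?s (f' b) a)) h"
    unfolding slice_def[of f']
    using h by (intro sw_apply[OF vs vs slice_linear[OF f(1)] subspace_carrier]) auto
  also have "\<dots> = sw ?s (\<lambda>a b. sw ?s (\<lambda>a1 a2. ?s (f a2 * f' b) a1) a) h"
    by (rule sw_cong[OF h])
      (simp add: slice_scale[OF f(1)] mult.commute, simp add: slice_def sw_scale_fun[OF vs, symmetric] mult.commute)
  also have "\<dots> = sw ?s (\<lambda>a b. sw ?s (\<lambda>b1 b2. ?s (f b1 * f' b2) a) b) h"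
    using f by (intro sw_coassoc[OF vs _ h])
      (auto simp: trilinear_on_def linear_on_def algebra_simps)
  also have "\<dots> = sw ?s (\<lambda>a b. ?s (f (slice f' b)) a) h"
  proof (rule sw_cong[OF h])
    fix a b assume "a \<in> carrier H" "b \<in> carrier H"
    have "linear_on UNIV (*) ?s (\<lambda>c. ?s c a)"
      by (auto simp: linear_on_def VS.scale_left_distrib)
    then show "sw ?s (\<lambda>b1 b2. ?s (f b1 * f' b2) a) b = ?s (f (slice f' b)) a"
      using \<open>b \<in> carrier H\<close> dual_slice[OF f(1)]
        sw_apply[OF vector_space_complex vs, of UNIV "\<lambda>c. ?s c a" "\<lambda>a b. f a * f' b" b]
        module.subspace_UNIV[OF vector_space_complex[folded module_iff_vector_space]]
      by simp
  qed
  finally show ?thesis by (simp add: slice_def)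
qed

lemma comult_memI_slice:
  assumes "finite_dim (hscale H) (carrier H)" "h \<in> carrier H"
    and "Poly_Mapping.keys u \<subseteq> carrier H \<times> carrier H"
    and "\<And>f f'. dual f \<Longrightarrow> dual f' \<Longrightarrow> lin_ext (*) (\<lambda>(a, b). f a * f' b) u = f (slice f' h)"
  shows "u \<in> comult H h"
  by (rule comult_memI[OF assms(1-3)]) (simp add: assms(2,4) dual_slice)

section \<open>Grouplike elements\<close>

definition grouplikes :: "'h set"
  where "grouplikes = {g \<in> carrier H. g \<noteq> 0 \<and> free_gen (g, g) \<in> comult H g}"

lemma grouplike_intro:
  "g \<in> carrier H \<Longrightarrow> g \<noteq> 0 \<Longrightarrow> free_gen (g, g) \<in> comult H g \<Longrightarrow> g \<in> grouplikes"
  by (simp add: grouplikes_def)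

lemma grouplike_carrier [simp]: "g \<in> grouplikes \<Longrightarrow> g \<in> carrier H"
  and grouplike_nonzero: "g \<in> grouplikes \<Longrightarrow> g \<noteq> 0"
  and grouplike_comult: "g \<in> grouplikes \<Longrightarrow> free_gen (g, g) \<in> comult H g"
  by (auto simp: grouplikes_def)

lemma sw_grouplike:
  "vector_space s \<Longrightarrow> bilinear_on (carrier H) (hscale H) s \<beta> \<Longrightarrow> g \<in> grouplikes \<Longrightarrow> sw s \<beta> g = \<beta> g g"
  by (rule sw_free_gen) (auto simp: grouplike_comult)

lemma slice_grouplike: "dual f \<Longrightarrow> g \<in> grouplikes \<Longrightarrow> slice f g = hscale H (f g) g"
  unfolding slice_def by (rule sw_grouplike[OF vector_space_scale bilinear_slice])

lemma counit_grouplike: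
  assumes "g \<in> grouplikes"
  shows "counit H g = 1"
proof -
  have "hscale H (counit H g) g = hscale H 1 g"
    using slice_grouplike[OF counit_dual assms] assms by (simp add: slice_counit)
  then show ?thesis using grouplike_nonzero[OF assms] by (simp only: VS.scale_cancel_right) simp
qed

lemma grouplikeI:
  assumes "finite_dim (hscale H) (carrier H)" "g \<in> carrier H" "g \<noteq> 0"
    and "\<And>f. dual f \<Longrightarrow> slice f g = hscale H (f g) g"
  shows "g \<in> grouplikes"
proof -
  have "free_gen (g, g) \<in> comult H g"
    using assms
    by (intro comult_memI_slice[OF assms(1,2)]) (auto simp: lin_ext_single[OF vector_space_complex] dual_scale)
  then show ?thesis using assms by (intro grouplike_intro) auto
qed

lemma one_neq_zero: "\<one> \<noteq> 0"
  using counit_one dual_zero[OF counit_dual] by auto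

lemma one_grouplike: "\<one> \<in> grouplikes"
  using comult_one one_neq_zero by (intro grouplike_intro) auto

lemma mult_grouplike:
  assumes "g \<in> grouplikes" "k \<in> grouplikes"
  shows "g \<otimes> k \<in> grouplikes"
proof -
  have "free_gen (g \<otimes> k, g \<otimes> k) \<in> comult H (g \<otimes> k)"
    using comult_mult[OF _ _ grouplike_comult[OF assms(1)] grouplike_comult[OF assms(2)]] assms
    by (simp add: lin_ext_single[OF vector_space_free_scale])
  moreover have "counit H (g \<otimes> k) = 1" using assms by (simp add: counit_mult counit_grouplike)
  then have "g \<otimes> k \<noteq> 0" using dual_zero[OF counit_dual] by auto
  ultimately show ?thesis using assms by (intro grouplike_intro) auto
qed

lemma antipode_grouplike_mult:
  assumes "g \<in> grouplikes"
  shows "antipode H g \<otimes> g = \<one>" "g \<otimes> antipode H g = \<one>"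
  using antipode_left[OF _ grouplike_comult] antipode_right[OF _ grouplike_comult] assms
  by (simp_all add: lin_ext_single[OF vector_space_scale] counit_grouplike)

text \<open>The comultiplication of \<open>h\<close> is multiplied by the pure tensor of
  \<open>g\<close> with itself: one copy of \<open>g\<close> stays in the first factor, the other
  translates the functional.\<close>

lemma slice_mult_grouplike:
  assumes "dual f" "h \<in> carrier H" "g \<in> grouplikes"
  shows "slice f (h \<otimes> g) = slice (\<lambda>x. f (x \<otimes> g)) h \<otimes> g"
proof -
  let ?s = "hscale H"
  note vs = vector_space_scale
  have g: "g \<in> carrier H" using assms by simp
  have "slice f (h \<otimes> g) = sw ?s (\<lambda>a b. sw ?s (\<lambda>a' b'. ?s (f (b \<otimes> b')) (a \<otimes> a')) g) h"
    unfolding slice_def by (rule sw_mult[OF vs bilinear_slice[OF assms(1)] assms(2) g])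
  also have "\<dots> = sw ?s (\<lambda>a b. ?s (f (b \<otimes> g)) a \<otimes> g) h"
  proof (rule sw_cong[OF assms(2)])
    fix a b assume ab: "a \<in> carrier H" "b \<in> carrier H"
    have "bilinear_on (carrier H) ?s ?s (\<lambda>a' b'. ?s (f (b \<otimes> b')) (a \<otimes> a'))"
      using assms(1) ab by (auto simp: bilinear_on_def linear_on_def VS.scale_left_distrib VS.scale_right_distrib mult.commute)
    then show "sw ?s (\<lambda>a' b'. ?s (f (b \<otimes> b')) (a \<otimes> a')) g = ?s (f (b \<otimes> g)) a \<otimes> g"
      using sw_grouplike[OF vs _ assms(3)] ab g by simp
  qed
  also have "\<dots> = slice (\<lambda>x. f (x \<otimes> g)) h \<otimes> g"
    unfolding slice_def using assms(2) g
    by (intro sw_apply[OF vs vs mult_linear_left subspace_carrier, symmetric]) auto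
  finally show ?thesis .
qed

lemma dual_mult_right: "dual f \<Longrightarrow> g \<in> carrier H \<Longrightarrow> dual (\<lambda>x. f (x \<otimes> g))"
  by (rule linear_onI) (auto simp: dual_add dual_scale)

text \<open>The slices of \<open>?y\<close> are read off from
  \<open>?y \<otimes> g = \<one>\<close>. Slicing the product by the translate \<open>f'\<close>
  gives \<open>slice f ?y \<otimes> g\<close>, while slices of \<open>\<one>\<close> are multiples
  of \<open>\<one>\<close>; multiplying by \<open>?y\<close> from the right gives the eigenvector
  equation.\<close>

lemma antipode_grouplike:
  assumes fd: "finite_dim (hscale H) (carrier H)" and g: "g \<in> grouplikes"
  shows "antipode H g \<in> grouplikes"
proof (rule grouplikeI[OF fd])
  let ?y = "antipode H g"
  have [simp]: "g \<in> carrier H" using g by simp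
  show y: "?y \<in> carrier H" by (simp add: antipode_closed)
  show "?y \<noteq> 0"
  proof
    assume "?y = 0"
    then have "\<one> = 0 \<otimes> g" using antipode_grouplike_mult(1)[OF g] by simp
    also have "\<dots> = 0"
      by (rule linear_on_zero[OF vector_space_scale vector_space_scale mult_linear_left subspace_carrier]) simp
    finally show False using one_neq_zero by simp
  qed
  fix f assume f: "dual f"
  define f' where "f' = (\<lambda>x. f (x \<otimes> ?y))"
  have f': "dual f'" unfolding f'_def using f y by (rule dual_mult_right)
  have "f' (x \<otimes> g) = f x" if "x \<in> carrier H" for x
    using that y g by (simp add: f'_def m_assoc antipode_grouplike_mult)
  then have sl: "slice (\<lambda>x. f' (x \<otimes> g)) ?y = slice f ?y"
    unfolding slice_def using y by (intro sw_cong) auto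
  have "slice f' (?y \<otimes> g) = hscale H (f' \<one>) \<one>"
    by (simp add: antipode_grouplike_mult[OF g] slice_grouplike[OF f' one_grouplike])
  then have "slice f ?y \<otimes> g = hscale H (f ?y) \<one>"
    using slice_mult_grouplike[OF f' y g] y by (simp add: sl) (simp add: f'_def)
  then have "slice f ?y \<otimes> g \<otimes> ?y = hscale H (f ?y) ?y"
    using y by simp
  then show "slice f ?y = hscale H (f ?y) ?y"
    using y g by (simp add: m_assoc antipode_grouplike_mult)
qed

text \<open>Grouplikes are eigenvectors of all slices, and functionals separate them; this is the
  usual argument for eigenvectors with distinct eigenvalues.\<close>

lemma independent_grouplikes: "VS.independent grouplikes"
proof -
  have "VS.independent X" if "finite X" "X \<subseteq> grouplikes" for X
    using that
  proof (induction X rule: finite_induct)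
    case (insert g X)
    then have ind: "VS.independent X" and X: "X \<subseteq> grouplikes" and g: "g \<in> grouplikes" by auto
    have Xc: "x \<in> carrier H" if "x \<in> X" for x using X that by auto
    have "g \<notin> VS.span X"
    proof
      assume "g \<in> VS.span X"
      then have sum: "(\<Sum>x\<in>X. hscale H (VS.representation X g x) x) = g"
        by (rule VS.sum_representation[OF ind insert.hyps(1)])
      have "VS.representation X g x = 0" if x: "x \<in> X" for x
      proof -
        have "x \<noteq> g" using x insert.hyps by auto
        then obtain f where f: "dual f" "f x \<noteq> f g" using dual_eqI[of x g] Xc[OF x] g by auto
        have "(\<Sum>x\<in>X. hscale H (VS.representation X g x * f x) x) = slice f (\<Sum>x\<in>X. hscale H (VS.representation X g x) x)"
          using Xc X by (subst slice_sum[OF f(1)])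
            (auto simp: slice_scale[OF f(1)] slice_grouplike[OF f(1)] subset_iff intro!: sum.cong)
        also have "\<dots> = hscale H (f g) (\<Sum>x\<in>X. hscale H (VS.representation X g x) x)"
          unfolding sum by (rule slice_grouplike[OF f(1) g])
        also have "\<dots> = (\<Sum>x\<in>X. hscale H (VS.representation X g x * f g) x)"
          by (simp add: VS.scale_sum_right mult.commute)
        finally have "(\<Sum>x\<in>X. hscale H (VS.representation X g x * (f x - f g)) x) = 0"
          by (simp add: right_diff_distrib VS.scale_left_diff_distrib sum_subtractf)
        then have "VS.representation X g x * (f x - f g) = 0"
          using VS.independentD[OF ind insert.hyps(1) subset_refl _ x] by fastforce
        then show ?thesis using f(2) by simp
      qed
      then have "g = 0" using sum by simp
      then show False using grouplike_nonzero[OF g] by simp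
    qed
    then show ?case using ind by (rule VS.independent_insertI)
  qed (simp add: VS.independent_empty)
  then show ?thesis
    unfolding VS.independent_explicit_module
    using VS.independentD[OF _ _ subset_refl] by blast
qed

lemma finite_grouplikes:
  assumes "finite_dim (hscale H) (carrier H)"
  shows "finite grouplikes"
proof -
  obtain B where B: "finite B" "VS.span B = carrier H" by (rule finite_basis[OF assms])
  then show ?thesis
    using VS.independent_span_bound[OF B(1) independent_grouplikes] by (simp add: subset_iff)
qed

lemma lin_ext_add_single:
  assumes "vector_space s"
  shows "lin_ext s \<beta> (free_gen p + free_gen q) = \<beta> p + \<beta> q"
proof -
  interpret L: Vector_Spaces.linear free_scale s "lin_ext s \<beta>" by (rule linear_lin_ext[OF assms])
  show ?thesis by (simp add: L.add lin_ext_single[OF assms])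
qed

text \<open>A nonzero primitive element would have linearly independent powers: slicing by \<open>f\<close> with
  \<open>f \<one> = 0\<close> acts on them like the derivative multiplied by \<open>f P\<close>.\<close>

lemma primitive_zero:
  assumes fd: "finite_dim (hscale H) (carrier H)" and P: "P \<in> carrier H"
    and prim: "\<And>f. dual f \<Longrightarrow> slice f P = hscale H (f \<one>) P + hscale H (f P) \<one>"
  shows "P = 0"
proof (rule ccontr)
  assume P0: "P \<noteq> 0"
  let ?s = "hscale H"
  note vs = vector_space_scale
  have "free_gen (P, \<one>) + free_gen (\<one>, P) \<in> comult H P"
  proof (rule comult_memI_slice[OF fd P])
    show "Poly_Mapping.keys (free_gen (P, \<one>) + free_gen (\<one>, P)) \<subseteq> carrier H \<times> carrier H"
      using keys_add[of "free_gen (P, \<one>)" "free_gen (\<one>, P)"] P by auto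
    fix f f' assume f: "dual f" "dual f'"
    then show "lin_ext (*) (\<lambda>(a, b). f a * f' b) (free_gen (P, \<one>) + free_gen (\<one>, P)) = f (slice f' P)"
      using P by (simp add: lin_ext_add_single[OF vector_space_complex] prim dual_add dual_scale algebra_simps)
  qed
  note P_comult = this
  have swP: "sw s \<beta> P = \<beta> P \<one> + \<beta> \<one> P"
    if "vector_space s" "bilinear_on (carrier H) (hscale H) s \<beta>" for s :: "complex \<Rightarrow> 'h \<Rightarrow> 'h" and \<beta>
    using sw_eq[OF that P P_comult] by (simp add: lin_ext_add_single[OF that(1)])
  \<comment> \<open>Multiplication by P \<otimes> 1 + 1 \<otimes> P gives two terms:
    \<open>P\<close> multiplies the first factor, or it translates the functional. The induction
    over powers therefore has to range over all functionals.\<close>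
  have slice_mult: "slice f (h \<otimes> P) = slice f h \<otimes> P + slice (\<lambda>x. f (x \<otimes> P)) h"
    if f: "dual f" and h: "h \<in> carrier H" for f h
  proof -
    have "slice f (h \<otimes> P) = sw ?s (\<lambda>a b. sw ?s (\<lambda>a' b'. ?s (f (b \<otimes> b')) (a \<otimes> a')) P) h"
      unfolding slice_def by (rule sw_mult[OF vs bilinear_slice[OF f] h P])
    also have "\<dots> = sw ?s (\<lambda>a b. ?s (f b) a \<otimes> P + ?s (f (b \<otimes> P)) a) h"
    proof (rule sw_cong[OF h])
      fix a b assume ab: "a \<in> carrier H" "b \<in> carrier H"
      have "bilinear_on (carrier H) ?s ?s (\<lambda>a' b'. ?s (f (b \<otimes> b')) (a \<otimes> a'))"
        using f ab by (auto simp: bilinear_on_def linear_on_def VS.scale_left_distrib VS.scale_right_distrib mult.commute)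
      then show "sw ?s (\<lambda>a' b'. ?s (f (b \<otimes> b')) (a \<otimes> a')) P = ?s (f b) a \<otimes> P + ?s (f (b \<otimes> P)) a"
        using swP[OF vs] ab P by simp
    qed
    also have "\<dots> = sw ?s (\<lambda>a b. ?s (f b) a \<otimes> P) h + slice (\<lambda>x. f (x \<otimes> P)) h"
      by (simp add: sw_add_fun[OF vs] slice_def)
    also have "sw ?s (\<lambda>a b. ?s (f b) a \<otimes> P) h = slice f h \<otimes> P"
      unfolding slice_def using h P
      by (intro sw_apply[OF vs vs mult_linear_left subspace_carrier, symmetric]) auto
    finally show ?thesis .
  qed
  define Q where "Q n = P [^] n" for n :: nat
  define W where "W n = VS.span (Q ` {..<n})" for n
  have Q [simp]: "Q n \<in> carrier H" for n using P by (simp add: Q_def)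
  have Q0: "Q 0 = \<one>" and QS: "Q n \<otimes> P = Q (Suc n)" for n by (simp_all add: Q_def)
  have QW: "Q m \<in> W n" if "m < n" for m n
    unfolding W_def using that by (intro VS.span_base) auto
  have Wmono: "W m \<subseteq> W n" if "m \<le> n" for m n
    unfolding W_def using that by (intro VS.span_mono) auto
  have Wadd: "x + y \<in> W n" if "x \<in> W n" "y \<in> W n" for x y n
    using that unfolding W_def by (rule VS.span_add)
  have Wscale: "?s c x \<in> W n" if "x \<in> W n" for c x n
    using that unfolding W_def by (rule VS.span_scale)
  have Wsub: "VS.subspace (W n)" for n by (simp add: W_def)
  have W0: "W 0 = {0}" by (simp add: W_def)
  have Wc: "W n \<subseteq> carrier H" for n
    unfolding W_def by (rule VS.span_minimal[OF _ subspace_carrier]) auto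
  have WP: "x \<otimes> P \<in> W (Suc n)" if "x \<in> W n" for x n
  proof -
    have "W n \<subseteq> {x \<in> carrier H. x \<otimes> P \<in> W (Suc n)}"
      unfolding W_def[of n]
      using subspace_linear_on_vimage[OF vs vs mult_linear_left[OF P] subspace_carrier, of "W (Suc n)"]
      by (intro VS.span_minimal) (use Q QS QW[of _ "Suc n"] Wsub in auto)
    then show ?thesis using that by blast
  qed
  \<comment> \<open>The binomial formula for the powers of \<open>P\<close>, kept to its two leading
    terms. For \<open>n = 0\<close> the truncated \<open>n - 1\<close> is \<open>0\<close>, which is
    harmless: the coefficient \<open>of_nat n\<close> vanishes and \<open>W 0 = {0}\<close>.\<close>
  have main: "\<exists>w. w \<in> W (n - 1) \<and> slice f (Q n) = ?s (f \<one>) (Q n) + ?s (of_nat n * f P) (Q (n - 1)) + w"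
    if "dual f" for f n
    using that
  proof (induction n arbitrary: f)
    case 0
    then show ?case by (simp add: Q0 W0 slice_grouplike[OF _ one_grouplike])
  next
    case (Suc n)
    define fP where "fP = (\<lambda>x. f (x \<otimes> P))"
    have fP: "dual fP" unfolding fP_def by (rule dual_mult_right[OF Suc.prems P])
    have fP1: "fP \<one> = f P" using P by (simp add: fP_def)
    obtain w where w: "w \<in> W (n - 1)" "slice f (Q n) = ?s (f \<one>) (Q n) + ?s (of_nat n * f P) (Q (n - 1)) + w"
      using Suc.IH[OF Suc.prems] by blast
    obtain w' where w': "w' \<in> W (n - 1)" "slice fP (Q n) = ?s (fP \<one>) (Q n) + ?s (of_nat n * fP P) (Q (n - 1)) + w'"
      using Suc.IH[OF fP] by blast
    have wc: "w \<in> carrier H" using w Wc by blast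
    have "slice f (Q (Suc n)) = slice f (Q n) \<otimes> P + slice fP (Q n)"
      unfolding QS[symmetric] fP_def by (rule slice_mult[OF Suc.prems Q])
    also have "\<dots> = ?s (f \<one>) (Q (Suc n)) + ?s (of_nat n * f P) (Q (n - 1) \<otimes> P) + w \<otimes> P +
        (?s (f P) (Q n) + ?s (of_nat n * fP P) (Q (n - 1)) + w')"
      using P wc by (simp add: w(2) w'(2) QS fP1)
    also have "?s (of_nat n * f P) (Q (n - 1) \<otimes> P) = ?s (of_nat n * f P) (Q n)"
      by (cases n) (auto simp: QS)
    finally have eq: "slice f (Q (Suc n)) = ?s (f \<one>) (Q (Suc n)) + ?s (of_nat (Suc n) * f P) (Q n) +
        (w \<otimes> P + ?s (of_nat n * fP P) (Q (n - 1)) + w')"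
      by (simp add: algebra_simps)
    have "w \<otimes> P \<in> W n"
    proof (cases n)
      case 0
      then have "w = 0" using w(1) W0 by simp
      then show ?thesis
        using linear_on_zero[OF vs vs mult_linear_left[OF P] subspace_carrier] 0 W0 by simp
    next
      case (Suc m)
      then show ?thesis using WP w(1) by simp
    qed
    moreover have "?s (of_nat n * fP P) (Q (n - 1)) \<in> W n"
      by (cases n) (use W0 in \<open>auto intro!: Wscale QW\<close>)
    moreover have "w' \<in> W n" using w'(1) Wmono[of "n - 1" n] by auto
    ultimately show ?case using eq Wadd by (intro exI conjI) auto
  qed
  obtain B where B: "finite B" "VS.span B = carrier H" by (rule finite_basis[OF fd])
  obtain n0 where "Q n0 \<in> W n0"
    using VS.finite_dim_imp_relation[OF B(1), of Q] B(2) by (auto simp: W_def)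
  then obtain n where n: "Q n \<in> W n" "\<And>m. m < n \<Longrightarrow> Q m \<notin> W m"
    using exists_least_iff[of "\<lambda>n. Q n \<in> W n"] by blast
  have eP: "counit H P = 0"
  proof -
    have "?s (counit H P) \<one> = 0"
      using prim[OF counit_dual] P by (simp add: slice_counit counit_one)
    then show ?thesis using one_neq_zero by simp
  qed
  obtain k where k: "n = Suc (Suc k)"
  proof (cases n)
    case 0
    then show thesis using n(1) W0 Q0 one_neq_zero by simp
  next
    case (Suc m)
    show thesis
    proof (cases m)
      case 0
      have "W 1 = range (\<lambda>k. ?s k \<one>)" by (simp add: W_def lessThan_Suc Q0 VS.span_singleton)
      moreover have "Q 1 = P" using P by (simp add: Q_def)
      ultimately obtain c where "P = ?s c \<one>" using n(1) Suc 0 by auto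
      moreover from this have "c = 0" using eP by (simp add: dual_scale[OF counit_dual] counit_one)
      ultimately show thesis using P0 by simp
    qed (use Suc that in blast)
  qed
  obtain f0 where f0: "dual f0" "f0 P \<noteq> 0"
    using dual_eqI[OF P carrier_zero] P0 dual_zero by metis
  \<comment> \<open>Subtracting a multiple of the counit makes the functional vanish at
    \<open>\<one>\<close> and keeps its value at \<open>P\<close>.\<close>
  define f where "f = (\<lambda>x. f0 x - f0 \<one> * counit H x)"
  have f: "dual f" unfolding f_def
    using f0(1) counit_dual by (auto simp: linear_on_def algebra_simps)
  have f1: "f \<one> = 0" and fP: "f P \<noteq> 0" using f0 eP by (auto simp: f_def counit_one)
  have lower: "slice f (Q m) \<in> W m" for m
  proof -
    obtain w where "w \<in> W (m - 1)" "slice f (Q m) = ?s (f \<one>) (Q m) + ?s (of_nat m * f P) (Q (m - 1)) + w"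
      using main[OF f] by blast
    moreover have "?s (of_nat m * f P) (Q (m - 1)) \<in> W m"
      by (cases m) (use W0 in \<open>auto intro!: Wscale QW\<close>)
    ultimately show ?thesis using Wmono[of "m - 1" m] by (auto simp: f1 intro!: Wadd)
  qed
  \<comment> \<open>Slicing by \<open>f\<close> lowers the filtration \<open>W\<close>. For the
    first power \<open>Q n\<close> lying in \<open>W n\<close>, it leaves
    \<open>of_nat n * f P\<close> times \<open>Q (n - 1)\<close> as leading term; in characteristic
    zero this scalar is invertible, so the preceding power would already be dependent.\<close>
  have "W n \<subseteq> {x \<in> carrier H. slice f x \<in> W (n - 1)}"
    unfolding W_def[of n]
  proof (rule VS.span_minimal)
    show "Q ` {..<n} \<subseteq> {x \<in> carrier H. slice f x \<in> W (n - 1)}"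
    proof clarify
      fix m assume "m < n"
      then have "W m \<subseteq> W (n - 1)" by (intro Wmono) simp
      then show "Q m \<in> carrier H \<and> slice f (Q m) \<in> W (n - 1)" using lower by auto
    qed
    show "VS.subspace {x \<in> carrier H. slice f x \<in> W (n - 1)}"
      by (rule subspace_linear_on_vimage[OF vs vs slice_linear[OF f] subspace_carrier]) (simp add: W_def)
  qed
  then have sQ: "slice f (Q n) \<in> W (n - 1)" using n(1) by blast
  obtain w where w: "w \<in> W (n - 1)" "slice f (Q n) = ?s (f \<one>) (Q n) + ?s (of_nat n * f P) (Q (n - 1)) + w"
    using main[OF f] by blast
  have "slice f (Q n) - w \<in> W (n - 1)" by (rule VS.subspace_diff[OF Wsub sQ w(1)])
  then have "?s (of_nat n * f P) (Q (n - 1)) \<in> W (n - 1)" by (simp add: w(2) f1)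
  then have "?s (inverse (of_nat n * f P)) (?s (of_nat n * f P) (Q (n - 1))) \<in> W (n - 1)"
    by (rule Wscale)
  moreover have "inverse (of_nat n * f P) * (of_nat n * f P) = 1"
    using fP k by (intro left_inverse) (simp del: of_nat_Suc)
  ultimately have "Q (n - 1) \<in> W (n - 1)" by (simp only: VS.scale_scale VS.scale_one)
  then show False using n(2)[of "n - 1"] k by simp
qed

text \<open>A common eigenvector of all slices modulo the span of the grouplikes has a grouplike
  eigenvalue. Translating this eigenvalue to \<open>\<one>\<close> and subtracting a suitable combination of
  grouplikes turns the eigenvector into a primitive element.\<close>

lemma cocommutative_span_grouplikes:
  assumes fd: "finite_dim (hscale H) (carrier H)"
    and coc: "\<And>h f f'. h \<in> carrier H \<Longrightarrow> dual f \<Longrightarrow> dual f' \<Longrightarrow> f (slice f' h) = f' (slice f h)"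
  shows "VS.span grouplikes = carrier H"
proof (rule ccontr)
  assume neq: "VS.span grouplikes \<noteq> carrier H"
  let ?s = "hscale H" and ?r = "VS.representation grouplikes"
  define D where "D = VS.span grouplikes"
  note vs = vector_space_scale
  have DA: "D \<subseteq> carrier H"
    unfolding D_def by (rule VS.span_minimal[OF _ subspace_carrier]) auto
  have Dsub: "VS.subspace D" by (simp add: D_def)
  note Dadd = VS.subspace_add[OF Dsub] and Dscale = VS.subspace_scale[OF Dsub]
    and Ddiff = VS.subspace_diff[OF Dsub] and Dsum = VS.subspace_sum[OF Dsub]
  have GD: "g \<in> D" if "g \<in> grouplikes" for g
    unfolding D_def using that by (rule VS.span_base)
  have Dslice: "slice f x \<in> D" if f: "dual f" and x: "x \<in> D" for f x
  proof -
    have "D \<subseteq> {x \<in> carrier H. slice f x \<in> D}"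
      unfolding D_def
      using subspace_linear_on_vimage[OF vs vs slice_linear[OF f] subspace_carrier VS.subspace_span]
      by (intro VS.span_minimal) (auto simp: slice_grouplike[OF f] intro!: VS.span_scale intro: VS.span_base)
    then show ?thesis using x by blast
  qed
  have Dmult: "x \<otimes> g \<in> D" if g: "g \<in> grouplikes" and x: "x \<in> D" for g x
  proof -
    have "D \<subseteq> {x \<in> carrier H. x \<otimes> g \<in> D}"
      unfolding D_def
      using subspace_linear_on_vimage[OF vs vs mult_linear_left subspace_carrier VS.subspace_span] g
      by (intro VS.span_minimal) (auto intro: VS.span_base mult_grouplike)
    then show ?thesis using x by blast
  qed
  obtain B where B: "finite B" "B \<subseteq> carrier H" "VS.independent B" "VS.span B = carrier H"
    by (rule finite_basis[OF fd])
  \<comment> \<open>By cocommutativity the convolution product of functionals is commutative, and so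
    are their actions.\<close>
  have "slice f (slice f' x) = slice f' (slice f x)" if "dual f" "dual f'" "x \<in> carrier H" for f f' x
    using that coc unfolding slice_slice[OF that] slice_slice[OF that(2,1,3)]
    by (auto simp: slice_def[of _ x] intro!: sw_cong)
  then obtain x where x: "x \<in> carrier H" "x \<notin> D" "\<And>f. dual f \<Longrightarrow> \<exists>z. slice f x - ?s z x \<in> D"
    using common_eigenvector_mod[OF vs subspace_carrier Dsub _ B(1), of "Collect dual" slice]
      neq DA B(4) Dslice slice_linear D_def by auto
  have uniq: "c = d" if "?s c x - ?s d x \<in> D" for c d
  proof (rule ccontr)
    assume "c \<noteq> d"
    have "?s (c - d) x \<in> D" using that by (simp add: VS.scale_left_diff_distrib)
    then have "?s (inverse (c - d)) (?s (c - d) x) \<in> D" by (rule Dscale)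
    then show False using \<open>c \<noteq> d\<close> x(2) by simp
  qed
  have "\<forall>b. \<exists>z. slice (\<lambda>h. VS.representation B h b) x - ?s z x \<in> D"
    using x(3)[OF linear_on_representation[OF vs B(3,4)]] by blast
  then obtain \<chi> where \<chi>: "\<And>b. slice (\<lambda>h. VS.representation B h b) x - ?s (\<chi> b) x \<in> D" by metis
  \<comment> \<open>The eigenvalue depends linearly on the functional, and a linear form on the dual
    of a finite dimensional space is evaluation at an element. This element is assembled from the
    eigenvalues \<chi> of the coordinate functionals.\<close>
  define g where "g = (\<Sum>b\<in>B. ?s (\<chi> b) b)"
  have g: "g \<in> carrier H" unfolding g_def using B(2) by (intro carrier_sum) auto
  have slice_x: "slice f x - ?s (f g) x \<in> D" if f: "dual f" for f
  proof -
    have "slice f x = sw ?s (\<lambda>a b. \<Sum>c\<in>B. ?s (f c) (?s (VS.representation B b c) a)) x"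
      unfolding slice_def
    proof (rule sw_cong[OF x(1)])
      fix a b assume ab: "a \<in> carrier H" "b \<in> carrier H"
      have "f b = f (\<Sum>c\<in>B. ?s (VS.representation B b c) c)"
        using VS.sum_representation[OF B(3,1)] ab B(4) by simp
      also have "\<dots> = (\<Sum>c\<in>B. VS.representation B b c * f c)"
        using B(2) by (subst dual_sum[OF f]) (auto simp: dual_scale[OF f] intro!: sum.cong)
      finally show "?s (f b) a = (\<Sum>c\<in>B. ?s (f c) (?s (VS.representation B b c) a))"
        by (simp add: VS.scale_sum_left mult.commute)
    qed
    also have "\<dots> = (\<Sum>c\<in>B. ?s (f c) (slice (\<lambda>h. VS.representation B h c) x))"
      by (simp add: sw_sum_fun[OF vs] sw_scale_fun[OF vs] slice_def del: VS.scale_scale)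
    finally have "slice f x = (\<Sum>c\<in>B. ?s (f c) (slice (\<lambda>h. VS.representation B h c) x))" .
    moreover have "f g = (\<Sum>c\<in>B. f c * \<chi> c)"
      unfolding g_def using B(2)
      by (subst dual_sum[OF f]) (auto simp: dual_scale[OF f] mult.commute intro!: sum.cong)
    ultimately have "slice f x - ?s (f g) x =
        (\<Sum>c\<in>B. ?s (f c) (slice (\<lambda>h. VS.representation B h c) x - ?s (\<chi> c) x))"
      by (simp add: VS.scale_right_diff_distrib sum_subtractf VS.scale_sum_left)
    also have "\<dots> \<in> D" by (intro Dsum Dscale \<chi>)
    finally show ?thesis .
  qed
  have eg: "counit H g = 1"
    using uniq[of 1 "counit H g"] slice_x[OF counit_dual] by (simp add: slice_counit x(1))
  \<comment> \<open>Slicing by a convolution product is slicing twice, so the eigenvalue is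
    multiplicative: \<open>f (slice f' g) = f' g * f g\<close>. This is the dual form of being
    grouplike.\<close>
  have g_in: "g \<in> grouplikes"
  proof (rule grouplikeI[OF fd g])
    show "g \<noteq> 0" using eg dual_zero[OF counit_dual] by auto
    fix f' assume f': "dual f'"
    show "slice f' g = ?s (f' g) g"
    proof (rule dual_eqI)
      fix f assume f: "dual f"
      let ?d = "slice f' x - ?s (f' g) x"
      have "slice f ?d = slice (\<lambda>x. f (slice f' x)) x - ?s (f' g) (slice f x)"
        using x(1) by (simp add: slice_diff[OF f] slice_scale[OF f] slice_slice[OF f f'])
      then have 1: "slice (\<lambda>x. f (slice f' x)) x - ?s (f' g) (slice f x) \<in> D"
        using Dslice[OF f slice_x[OF f']] by simp
      have 2: "slice (\<lambda>x. f (slice f' x)) x - ?s (f (slice f' g)) x \<in> D"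
        by (rule slice_x[OF dual_comp_slice[OF f f']])
      have 3: "?s (f' g) (slice f x - ?s (f g) x) \<in> D"
        by (rule Dscale[OF slice_x[OF f]])
      have "slice (\<lambda>x. f (slice f' x)) x - ?s (f' g) (slice f x) -
          (slice (\<lambda>x. f (slice f' x)) x - ?s (f (slice f' g)) x) +
          ?s (f' g) (slice f x - ?s (f g) x) \<in> D"
        by (rule Dadd[OF Ddiff[OF 1 2] 3])
      then have "?s (f (slice f' g)) x - ?s (f' g * f g) x \<in> D"
        by (simp add: VS.scale_right_diff_distrib)
      then show "f (slice f' g) = f (?s (f' g) g)"
        using uniq g by (simp add: dual_scale[OF f])
    qed (use g in auto)
  qed
  define g' where "g' = antipode H g"
  have g': "g' \<in> grouplikes" unfolding g'_def by (rule antipode_grouplike[OF fd g_in])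
  have gg': "g \<otimes> g' = \<one>" "g' \<otimes> g = \<one>" by (simp_all add: g'_def antipode_grouplike_mult[OF g_in])
  define y where "y = x \<otimes> g'"
  have y: "y \<in> carrier H" using x g' by (simp add: y_def)
  have yD: "y \<notin> D"
  proof
    assume "y \<in> D"
    then have "y \<otimes> g \<in> D" by (rule Dmult[OF g_in])
    then show False using x g' g by (simp add: y_def m_assoc gg')
  qed
  have slice_y: "slice f y - ?s (f \<one>) y \<in> D" if f: "dual f" for f
  proof -
    let ?f = "\<lambda>h. f (h \<otimes> g')"
    have "slice f y - ?s (f \<one>) y = (slice ?f x - ?s (?f g) x) \<otimes> g'"
      using x g' by (simp add: y_def slice_mult_grouplike[OF f] gg' mult_diff_left)
    also have "\<dots> \<in> D" using g' by (intro Dmult slice_x dual_mult_right f) auto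
    finally show ?thesis .
  qed
  \<comment> \<open>\<open>d f e\<close> is the coordinate at \<open>e\<close> of the failure of
    \<open>y\<close> to be an eigenvector with eigenvalue \<open>f \<one>\<close>.\<close>
  define d where "d f e = ?r (slice f y - ?s (f \<one>) y) e" for f e
  note fin = finite_grouplikes[OF fd] and ind = independent_grouplikes
  have slice_y_eq: "slice f y = ?s (f \<one>) y + (\<Sum>e\<in>grouplikes. ?s (d f e) e)" if f: "dual f" for f
    using VS.sum_representation[OF ind fin, of "slice f y - ?s (f \<one>) y"] slice_y[OF f]
    by (simp add: d_def D_def)
  \<comment> \<open>A cocycle condition: the slices by \<open>f\<close> and \<open>f'\<close>
    commute on \<open>y\<close>, and both orders are compared at the coordinate
    \<open>e\<close>.\<close>
  have d_eq: "d f e * (f' e - f' \<one>) = d f' e * (f e - f \<one>)"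
    if f: "dual f" "dual f'" and e: "e \<in> grouplikes" for f f' e
  proof -
    have expand: "slice f' (slice f y) = ?s (f \<one> * f' \<one>) y +
        (\<Sum>e\<in>grouplikes. ?s (f \<one> * d f' e + d f e * f' e) e)" if f: "dual f" "dual f'" for f f'
    proof -
      have "slice f' (slice f y) = ?s (f \<one>) (slice f' y) + (\<Sum>e\<in>grouplikes. ?s (d f e) (slice f' e))"
        unfolding slice_y_eq[OF f(1)] using y f(2)
        by (subst slice_add[OF f(2)]) (auto simp: slice_scale slice_sum intro!: carrier_sum sum.cong)
      also have "(\<Sum>e\<in>grouplikes. ?s (d f e) (slice f' e)) = (\<Sum>e\<in>grouplikes. ?s (d f e * f' e) e)"
        by (rule sum.cong) (auto simp: slice_grouplike[OF f(2)])
      finally show ?thesis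
        unfolding slice_y_eq[OF f(2)]
        by (simp add: VS.scale_right_distrib VS.scale_left_distrib VS.scale_sum_right sum.distrib algebra_simps)
    qed
    have "slice f' (slice f y) = slice f (slice f' y)"
      using coc f unfolding slice_slice[OF f(2,1) y] slice_slice[OF f y]
      by (auto simp: slice_def[of _ y] y intro!: sw_cong)
    then have "(\<Sum>e\<in>grouplikes. ?s (f \<one> * d f' e + d f e * f' e - (f' \<one> * d f e + d f' e * f e)) e) = 0"
      unfolding expand[OF f] expand[OF f(2,1)]
      by (simp add: VS.scale_left_diff_distrib sum_subtractf mult.commute)
    then have "f \<one> * d f' e + d f e * f' e - (f' \<one> * d f e + d f' e * f e) = 0"
      using VS.independentD[OF ind fin subset_refl, where u = "\<lambda>e. f \<one> * d f' e + d f e * f' e - (f' \<one> * d f e + d f' e * f e)"] e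
      by blast
    then show ?thesis by (simp add: algebra_simps)
  qed
  \<comment> \<open>Away from \<open>\<one>\<close> the cocycle is a coboundary: fix
    \<open>f'\<close> separating \<open>e\<close> from \<open>\<one>\<close> and divide.\<close>
  have "\<exists>c. \<forall>f. dual f \<longrightarrow> d f e = c * (f e - f \<one>)" if e: "e \<in> grouplikes" "e \<noteq> \<one>" for e
  proof -
    obtain f' where f': "dual f'" "f' e \<noteq> f' \<one>"
      using dual_eqI[of e \<one>] e by auto
    have "d f e = d f' e / (f' e - f' \<one>) * (f e - f \<one>)" if f: "dual f" for f
      using d_eq[OF f f'(1) e(1)] f'(2) by (simp add: field_simps)
    then show ?thesis by blast
  qed
  then have "\<forall>e\<in>grouplikes - {\<one>}. \<exists>c. \<forall>f. dual f \<longrightarrow> d f e = c * (f e - f \<one>)" by blast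
  from bchoice[OF this] obtain c
    where c: "\<And>e f. e \<in> grouplikes - {\<one>} \<Longrightarrow> dual f \<Longrightarrow> d f e = c e * (f e - f \<one>)" by blast
  \<comment> \<open>Subtracting \<open>w\<close> removes these coboundaries and leaves only the
    defect at \<open>\<one>\<close>.\<close>
  define w where "w = (\<Sum>e\<in>grouplikes - {\<one>}. ?s (c e) e)"
  have wD: "w \<in> D" unfolding w_def by (intro Dsum Dscale GD) auto
  have w: "w \<in> carrier H" using wD DA by blast
  have slice_yw: "slice f (y - w) = ?s (f \<one>) (y - w) + ?s (d f \<one>) \<one>" if f: "dual f" for f
  proof -
    have "slice f w = (\<Sum>e\<in>grouplikes - {\<one>}. ?s (c e * f e) e)"
      unfolding w_def by (subst slice_sum[OF f]) (auto simp: slice_scale[OF f] slice_grouplike[OF f] intro!: sum.cong)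
    moreover have "(\<Sum>e\<in>grouplikes. ?s (d f e) e) =
        ?s (d f \<one>) \<one> + (\<Sum>e\<in>grouplikes - {\<one>}. ?s (d f e) e)"
      by (rule sum.remove[OF fin one_grouplike])
    moreover have "(\<Sum>e\<in>grouplikes - {\<one>}. ?s (d f e) e) =
        (\<Sum>e\<in>grouplikes - {\<one>}. ?s (c e * f e) e) - ?s (f \<one>) w"
      unfolding w_def VS.scale_sum_right sum_subtractf[symmetric]
      by (rule sum.cong) (auto simp: c f algebra_simps VS.scale_left_diff_distrib)
    ultimately show ?thesis
      using y w by (simp add: slice_diff[OF f] slice_y_eq[OF f] VS.scale_right_diff_distrib)
  qed
  \<comment> \<open>Normalizing the counit to \<open>0\<close> identifies the remaining coefficient:
    applying the counit to the slice of \<open>P\<close> by \<open>f\<close> gives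
    \<open>d f \<one> = f P\<close>, as required of a primitive element.\<close>
  define P where "P = y - w - ?s (counit H (y - w)) \<one>"
  have yw: "y - w \<in> carrier H" using y w by simp
  have P: "P \<in> carrier H" using yw by (simp add: P_def)
  have eP: "counit H P = 0"
    unfolding P_def using yw by (simp add: dual_diff[OF counit_dual yw] dual_scale[OF counit_dual] counit_one)
  have slice_P: "slice f P = ?s (f \<one>) P + ?s (d f \<one>) \<one>" if f: "dual f" for f
    unfolding P_def
    by (simp add: slice_diff[OF f yw] slice_scale[OF f] slice_grouplike[OF f one_grouplike] slice_yw[OF f]
        VS.scale_right_diff_distrib mult.commute)
  have "slice f P = ?s (f \<one>) P + ?s (f P) \<one>" if f: "dual f" for f
  proof -
    have "f P = counit H (?s (f \<one>) P + ?s (d f \<one>) \<one>)"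
      using counit_slice[OF f P] slice_P[OF f] by simp
    also have "\<dots> = d f \<one>"
      using P by (simp add: dual_add[OF counit_dual] dual_scale[OF counit_dual] eP counit_one)
    finally show ?thesis using slice_P[OF f] by simp
  qed
  then have "P = 0" by (rule primitive_zero[OF fd P])
  then have "y = w + ?s (counit H (y - w)) \<one>" by (simp add: P_def algebra_simps)
  also have "\<dots> \<in> D" by (intro Dadd wD Dscale GD one_grouplike)
  finally show False using yD by simp
qed

end

section \<open>Hopf algebras spanned by grouplikes\<close>

lemma linear_on_eq_on_span:
  assumes "vector_space s" "vector_space s'" "linear_on A s s' f" "linear_on A s s' g"
    and "module.subspace s A" "module.span s G = A" "\<And>x. x \<in> G \<Longrightarrow> f x = g x" "x \<in> A"
  shows "f x = g x"
proof -
  interpret S: vector_space s by fact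
  interpret S': vector_space s' by fact
  have "linear_on A s s' (\<lambda>x. f x - g x)"
    using assms(3,4) by (auto simp: linear_on_def S'.scale_right_diff_distrib)
  then have "S.subspace {x \<in> A. f x - g x \<in> {0}}"
    by (rule subspace_linear_on_vimage[OF assms(1,2) _ assms(5) S'.subspace_single_0])
  moreover have "G \<subseteq> {x \<in> A. f x - g x \<in> {0}}"
    using assms(6,7) S.span_superset by auto
  ultimately have "A \<subseteq> {x \<in> A. f x - g x \<in> {0}}"
    using S.span_minimal assms(6) by metis
  then show ?thesis using assms(8) by auto
qed

context hopf_algebra
begin

definition grouplike_group :: "'h monoid"
  where "grouplike_group = \<lparr>carrier = grouplikes, monoid.mult = monoid.mult H, one = \<one>\<rparr>"

lemma group_grouplike_group:
  assumes "finite_dim (hscale H) (carrier H)"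
  shows "group grouplike_group"
proof (rule groupI)
  fix x assume "x \<in> carrier grouplike_group"
  then show "\<exists>y\<in>carrier grouplike_group. y \<otimes>\<^bsub>grouplike_group\<^esub> x = \<one>\<^bsub>grouplike_group\<^esub>"
    using antipode_grouplike[OF assms] antipode_grouplike_mult(1) by (auto simp: grouplike_group_def)
qed (auto simp: grouplike_group_def mult_grouplike one_grouplike m_assoc)

lemma inv_grouplike_group:
  assumes "finite_dim (hscale H) (carrier H)" "g \<in> grouplikes"
  shows "inv\<^bsub>grouplike_group\<^esub> g = antipode H g"
  using group.inv_equality[OF group_grouplike_group[OF assms(1)], of "antipode H g" g]
    antipode_grouplike_mult(1)[OF assms(2)] antipode_grouplike[OF assms] assms(2)
  by (simp add: grouplike_group_def)

definition grouplike_coords :: "'h \<Rightarrow> 'h \<Rightarrow>\<^sub>0 complex"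
  where "grouplike_coords h = (\<Sum>g\<in>grouplikes. Poly_Mapping.single g (VS.representation grouplikes h g))"

lemma comult_sum_grouplikes:
  assumes "finite X" "X \<subseteq> grouplikes"
  shows "(\<Sum>g\<in>X. free_scale (c g) (free_gen (g, g))) \<in> comult H (\<Sum>g\<in>X. hscale H (c g) g)"
  using assms
proof (induction X rule: finite_induct)
  case empty
  \<comment> \<open>Scaling \<open>comult_one\<close> by \<open>0\<close> shows that the zero
    expression represents the comultiplication of \<open>0\<close>.\<close>
  show ?case using comult_scale[OF one_closed comult_one, of 0] by simp
next
  case (insert g X)
  then have "free_scale (c g) (free_gen (g, g)) + (\<Sum>g\<in>X. free_scale (c g) (free_gen (g, g)))
      \<in> comult H (hscale H (c g) g + (\<Sum>g\<in>X. hscale H (c g) g))"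
    by (intro comult_add comult_scale carrier_sum grouplike_comult) (auto simp: subset_iff)
  then show ?case using insert.hyps by simp
qed

text \<open>The identities for product, counit and antipode are linear in each argument and hold on
  grouplikes, which span. The comultiplication is coset valued and needs an argument about the
  relations instead.\<close>

lemma hopf_iso_grouplike_group_algebra:
  assumes fd: "finite_dim (hscale H) (carrier H)" and span: "VS.span grouplikes = carrier H"
  shows "hopf_iso H (group_algebra grouplike_group) grouplike_coords"
proof -
  let ?G = grouplike_group and ?\<phi> = grouplike_coords and ?r = "VS.representation grouplikes"
  let ?K = "group_algebra ?G"
  let ?A = "{f :: 'h \<Rightarrow>\<^sub>0 complex. Poly_Mapping.keys f \<subseteq> grouplikes}"
  note fin = finite_grouplikes[OF fd] and ind = independent_grouplikes
  note vs = vector_space_scale and fvs = vector_space_free_scale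
  have lookup: "Poly_Mapping.lookup (?\<phi> h) = ?r h" for h
  proof
    fix k
    have "Poly_Mapping.lookup (?\<phi> h) k = (\<Sum>g\<in>grouplikes. if g = k then ?r h k else 0)"
      unfolding grouplike_coords_def lookup_sum by (rule sum.cong) (auto simp: lookup_single when_def)
    then show "Poly_Mapping.lookup (?\<phi> h) k = ?r h k"
      using fin VS.representation_ne_zero[of grouplikes h k] by auto
  qed
  have keys: "Poly_Mapping.keys (?\<phi> h) \<subseteq> grouplikes" for h
    using VS.representation_ne_zero[of grouplikes h] by (auto simp: in_keys_iff lookup)
  have lin: "linear_on (carrier H) (hscale H) free_scale ?\<phi>"
    using ind span
    by (intro linear_onI poly_mapping_eqI)
      (auto simp: lookup lookup_add lookup_free_scale VS.representation_add VS.representation_scale)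
  have gen: "?\<phi> g = free_gen g" if "g \<in> grouplikes" for g
    using that ind by (intro poly_mapping_eqI) (simp add: lookup VS.representation_basis lookup_single when_def)
  have sum: "(\<Sum>g\<in>grouplikes. hscale H (?r h g) g) = h" if "h \<in> carrier H" for h
    using VS.sum_representation[OF ind fin] that span by simp
  have lin_comp: "linear_on (carrier H) (hscale H) s (\<lambda>h. lin_ext s F (?\<phi> h))"
    if "vector_space s" for s :: "complex \<Rightarrow> 'b \<Rightarrow> 'b::ab_group_add" and F
    using lin linear_on_lin_ext[OF that, of UNIV F] by (simp add: linear_on_def)
  note eqI = linear_on_eq_on_span[OF vs _ _ _ subspace_carrier span]
  have mult: "?\<phi> (x \<otimes> y) = ?\<phi> x \<otimes>\<^bsub>?K\<^esub> ?\<phi> y" if xy: "x \<in> carrier H" "y \<in> carrier H" for x y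
  proof -
    have *: "?\<phi> (x \<otimes> y) = ?\<phi> x \<otimes>\<^bsub>?K\<^esub> ?\<phi> y" if y: "y \<in> grouplikes" and x: "x \<in> carrier H" for x y
    proof (rule eqI[OF fvs _ _ _ x])
      show "linear_on (carrier H) (hscale H) free_scale (\<lambda>x. ?\<phi> (x \<otimes> y))"
        using lin y by (simp add: linear_on_def)
      show "linear_on (carrier H) (hscale H) free_scale (\<lambda>x. ?\<phi> x \<otimes>\<^bsub>?K\<^esub> ?\<phi> y)"
        unfolding group_algebra_def by (simp add: lin_comp[OF fvs])
      show "?\<phi> (g \<otimes> y) = ?\<phi> g \<otimes>\<^bsub>?K\<^esub> ?\<phi> y" if "g \<in> grouplikes" for g
        using that y
        by (simp add: gen mult_grouplike group_algebra_def grouplike_group_def lin_ext_single[OF fvs])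
    qed
    show ?thesis
    proof (rule eqI[OF fvs _ _ _ xy(2)])
      show "linear_on (carrier H) (hscale H) free_scale (\<lambda>y. ?\<phi> (x \<otimes> y))"
        using lin xy by (simp add: linear_on_def)
      show "linear_on (carrier H) (hscale H) free_scale (\<lambda>y. ?\<phi> x \<otimes>\<^bsub>?K\<^esub> ?\<phi> y)"
        unfolding group_algebra_def
        by (rule linear_onI)
          (simp_all add: linear_on_add[OF lin_comp[OF fvs]] linear_on_scale[OF lin_comp[OF fvs]]
            lin_ext_add_fun[OF fvs] lin_ext_scale_fun[OF fvs])
    qed (rule *[OF _ xy(1)])
  qed
  have inj: "inj_on ?\<phi> (carrier H)"
    by (rule inj_onI) (metis lookup sum)
  have surj: "f \<in> ?\<phi> ` carrier H" if f: "f \<in> ?A" for f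
  proof (rule image_eqI)
    show "(\<Sum>g\<in>grouplikes. hscale H (Poly_Mapping.lookup f g) g) \<in> carrier H"
      by (intro carrier_sum) auto
    have "?\<phi> (\<Sum>g\<in>grouplikes. hscale H (Poly_Mapping.lookup f g) g) =
        (\<Sum>g\<in>grouplikes. free_scale (Poly_Mapping.lookup f g) (free_gen g))"
      by (subst linear_on_sum[OF vs fvs lin subspace_carrier])
        (auto simp: linear_on_scale[OF lin] gen intro!: sum.cong)
    also have "\<dots> = lin_ext free_scale free_gen f"
      using f fin by (simp add: lin_ext_superset[OF fvs])
    finally show "f = ?\<phi> (\<Sum>g\<in>grouplikes. hscale H (Poly_Mapping.lookup f g) g)"
      by (simp add: lin_ext_free_gen)
  qed
  have iso: "?\<phi> \<in> iso H ?K"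
    using inj surj mult
    by (auto simp: iso_def hom_def bij_betw_def group_algebra_def grouplike_group_def dest: subsetD[OF keys])
  have comult: "lin_ext free_scale (\<lambda>(a, b). free_gen (?\<phi> a, ?\<phi> b)) t \<in> comult ?K (?\<phi> h)"
    if h: "h \<in> carrier H" and t: "t \<in> comult H h" for h t
  proof -
    let ?L = "lin_ext free_scale (\<lambda>(a, b). free_gen (?\<phi> a, ?\<phi> b))"
    let ?R = "module.span free_scale (rels2 free_scale ?A)"
    interpret L: Vector_Spaces.linear free_scale free_scale ?L by (rule linear_lin_ext[OF fvs])
    let ?t = "\<Sum>g\<in>grouplikes. free_scale (?r h g) (free_gen (g, g))"
    have t0: "?t \<in> comult H h"
      using comult_sum_grouplikes[OF fin subset_refl, of "?r h"] sum[OF h] by simp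
    \<comment> \<open>The tensor square \<open>?L\<close> of the isomorphism maps relations to
      relations. Hence it suffices to treat one expression for the comultiplication of
      \<open>h\<close>, namely the diagonal one \<open>?t\<close>.\<close>
    have "rels2 (hscale H) (carrier H) \<subseteq> {r. ?L r \<in> ?R}"
    proof
      fix r assume "r \<in> rels2 (hscale H) (carrier H)"
      then have "?L r \<in> rels2 free_scale ?A"
        unfolding rels2_def using keys linear_on_add[OF lin] linear_on_scale[OF lin]
        by (elim UnE CollectE exE conjE)
          (simp add: L.diff L.scale lin_ext_single[OF fvs], blast)+
      then show "r \<in> {r. ?L r \<in> ?R}" by (simp add: free.span_base)
    qed
    then have "module.span free_scale (rels2 (hscale H) (carrier H)) \<subseteq> {r. ?L r \<in> ?R}"
      by (intro free.span_minimal L.subspace_linear_preimage) auto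
    moreover have "t - ?t \<in> module.span free_scale (rels2 (hscale H) (carrier H))"
      by (rule comult_iff[OF h t0, THEN iffD1, OF t])
    ultimately have "?L (t - ?t) \<in> ?R" by blast
    then have "?L t - ?L ?t \<in> ?R" by (simp only: L.diff)
    also have "?L ?t = lin_ext free_scale (\<lambda>g. free_gen (free_gen g, free_gen g)) (?\<phi> h)"
      unfolding lin_ext_superset[OF fvs fin keys] L.sum
      by (rule sum.cong) (auto simp: L.scale lin_ext_single[OF fvs] gen lookup)
    finally show ?thesis
      by (simp add: group_algebra_def grouplike_group_def tensor2_def)
  qed
  have "counit ?K (?\<phi> h) = counit H h" if h: "h \<in> carrier H" for h
  proof (rule eqI[OF vector_space_complex _ _ _ h])
    show "linear_on (carrier H) (hscale H) (*) (\<lambda>h. counit ?K (?\<phi> h))"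
      by (simp add: group_algebra_def lin_comp[OF vector_space_complex])
  qed (auto simp: counit_dual counit_grouplike gen group_algebra_def lin_ext_single[OF vector_space_complex])
  moreover have "?\<phi> (antipode H h) = antipode ?K (?\<phi> h)" if h: "h \<in> carrier H" for h
  proof (rule eqI[OF fvs _ _ _ h])
    show "linear_on (carrier H) (hscale H) free_scale (\<lambda>h. ?\<phi> (antipode H h))"
      using lin antipode_linear by (simp add: linear_on_def antipode_closed)
    show "linear_on (carrier H) (hscale H) free_scale (\<lambda>h. antipode ?K (?\<phi> h))"
      by (simp add: group_algebra_def lin_comp[OF fvs])
    show "?\<phi> (antipode H g) = antipode ?K (?\<phi> g)" if "g \<in> grouplikes" for g
      using that antipode_grouplike[OF fd that] inv_grouplike_group[OF fd that]
      by (simp add: gen group_algebra_def lin_ext_single[OF fvs])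
  qed
  moreover have "?\<phi> \<one> = \<one>\<^bsub>?K\<^esub>"
    by (simp add: gen one_grouplike group_algebra_def grouplike_group_def)
  moreover have "linear_on (carrier H) (hscale H) (hscale ?K) ?\<phi>"
    using lin by (simp add: group_algebra_def)
  ultimately show ?thesis
    using iso comult by (simp add: hopf_iso_def)
qed

end

section \<open>Hopf actions on simple vertex operator algebras\<close>

text \<open>An explicit range lets the action of \<open>H\<close> pass through the sum and lets
  several instances share one range.\<close>

lemma (in voa) skew_symmetry_finite:
  assumes "\<And>i. i \<ge> M \<Longrightarrow> mode V u (l + int i) v = 0"
  shows "mode V v l u = vscale V (- ((- 1) powi l))
    (\<Sum>i<M. vscale V ((- 1) ^ i) (vac_coeff i (mode V u (l + int i) v)))"
  unfolding skew_symmetry[of v l u]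
  by (subst Sum_any_lessThan[of M]) (simp_all add: assms vac_coeff_def)

context hopf_module_voa
begin

lemma act_add_left [simp]:
    "\<lbrakk>h \<in> carrier H; k \<in> carrier H\<rbrakk> \<Longrightarrow> act (h + k) v = act h v + act k v"
  and act_scale_left [simp]: "h \<in> carrier H \<Longrightarrow> act (hscale H c h) v = vscale V c (act h v)"
  and act_add_right [simp]: "h \<in> carrier H \<Longrightarrow> act h (v + w) = act h v + act h w"
  and act_scale_right [simp]: "h \<in> carrier H \<Longrightarrow> act h (vscale V c v) = vscale V c (act h v)"
  using act_linear_left[of v] act_linear_right[of h] by (simp_all add: linear_on_def)

lemma act_sum_left: "(\<And>i. i \<in> I \<Longrightarrow> p i \<in> carrier H) \<Longrightarrow> act (sum p I) v = (\<Sum>i\<in>I. act (p i) v)"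
  by (rule linear_on_sum[OF vector_space_scale module_vector_space act_linear_left subspace_carrier])

lemma act_sum_right:
  assumes "h \<in> carrier H"
  shows "act h (sum w I) = (\<Sum>i\<in>I. act h (w i))"
  by (rule linear_on_sum[OF module_vector_space module_vector_space act_linear_right[OF assms]]) simp_all

lemma act_zero_left: "act 0 v = 0"
  by (rule linear_on_zero[OF vector_space_scale module_vector_space act_linear_left subspace_carrier])

lemma act_zero_right: "h \<in> carrier H \<Longrightarrow> act h 0 = 0"
  using act_scale_right[of h 0 0] by simp

definition annihilator :: "'h set"
  where "annihilator = {h \<in> carrier H. \<forall>v. act h v = 0}"

lemma subspace_annihilator: "VS.subspace annihilator"
  by (rule VS.subspaceI) (auto simp: annihilator_def act_zero_left)

text \<open>Two contractions. Vanishing of the vertex operators makes the tensors of the vectors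
  \<open>act a u\<close> and \<open>act b v\<close> vanish. Contracting their second factor gives
  the elements \<open>?x\<close> of the annihilator, where \<open>f\<close> is zero; hence
  \<open>?y\<close>, the contraction of \<open>t\<close> with \<open>f\<close> in its first factor,
  also annihilates \<open>V\<close>, and \<open>f'\<close> is zero there. The expression
  \<open>t\<close> is arbitrary because the lemma is applied to a comultiplication and to the
  difference between one and its flip.\<close>

lemma lin_ext_vanish:
  assumes "simple_voa V" "Poly_Mapping.keys t \<subseteq> carrier H \<times> carrier H"
    and zero: "\<And>u v n. lin_ext (vscale V) (\<lambda>(a, b). mode V (act a u) n (act b v)) t = 0"
    and f: "dual f" "dual f'" "\<And>x. x \<in> annihilator \<Longrightarrow> f x = 0" "\<And>x. x \<in> annihilator \<Longrightarrow> f' x = 0"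
  shows "lin_ext (*) (\<lambda>(a, b). f a * f' b) t = 0"
proof -
  let ?K = "Poly_Mapping.keys t" and ?l = "Poly_Mapping.lookup t"
  have K: "fst k \<in> carrier H" "snd k \<in> carrier H" if "k \<in> ?K" for k
    using that assms(2) by auto
  obtain B where B: "VV.independent B" "VV.span B = UNIV"
    using VV.maximal_independent_subset[of UNIV] by (metis top.extremum_uniqueI)
  let ?r = "VV.representation B"
  have 1: "(\<Sum>k\<in>?K. ?l k * f (fst k) * ?r (act (snd k) v) b) = 0" for v b
  proof -
    let ?x = "\<Sum>k\<in>?K. hscale H (?r (act (snd k) v) b) (hscale H (?l k) (fst k))"
    have x: "?x \<in> carrier H" using K by (intro carrier_sum) simp
    have "act ?x u = 0" for u
    proof -
      have "(\<Sum>k\<in>?K. mode V (vscale V (?l k) (act (fst k) u)) n (act (snd k) v)) = 0" for n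
        using zero[of u n v] by (simp add: lin_ext_def case_prod_unfold)
      then have "(\<Sum>k\<in>?K. vscale V (?r (act (snd k) v) b) (vscale V (?l k) (act (fst k) u))) = 0"
        by (rule vanishing_imp_tensor_zero[OF assms(1) finite_keys B])
      then show ?thesis
        using K by (simp add: act_sum_left del: VS.scale_scale VV.scale_scale)
    qed
    then have "f ?x = 0" using x f(3) by (simp add: annihilator_def)
    also have "f ?x = (\<Sum>k\<in>?K. ?l k * f (fst k) * ?r (act (snd k) v) b)"
      using K by (subst dual_sum[OF f(1)]) (auto simp: dual_scale[OF f(1)] intro!: sum.cong)
    finally show ?thesis .
  qed
  let ?y = "\<Sum>k\<in>?K. hscale H (?l k * f (fst k)) (snd k)"
  have y: "?y \<in> carrier H" using K by (intro carrier_sum) simp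
  have "act ?y v = 0" for v
  proof -
    have "?r (act ?y v) b = 0" for b
      using 1[of v b] K B by (simp add: act_sum_left VV.representation_sum VV.representation_scale)
    then show ?thesis
      using VV.sum_nonzero_representation_eq[OF B(1), of "act ?y v"] B(2) by simp
  qed
  then have "f' ?y = 0" using y f(4) by (simp add: annihilator_def)
  also have "f' ?y = lin_ext (*) (\<lambda>(a, b). f a * f' b) t"
    using K by (subst dual_sum[OF f(2)]) (auto simp: dual_scale[OF f(2)] lin_ext_def case_prod_unfold intro!: sum.cong)
  finally show ?thesis .
qed

lemma hopf_ideal_annihilator:
  assumes "simple_voa V" and fd: "finite_dim (hscale H) (carrier H)"
  shows "hopf_ideal H annihilator"
proof (rule biideal_imp_hopf_ideal[OF fd])
  show sub: "annihilator \<subseteq> carrier H" by (auto simp: annihilator_def)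
  show "VS.subspace annihilator" by (rule subspace_annihilator)
  show "\<one> \<notin> annihilator"
    using vac_nonzero[OF assms(1)] act_one by (auto simp: annihilator_def)
  show "x \<otimes> h \<in> annihilator" "h \<otimes> x \<in> annihilator" if "x \<in> annihilator" "h \<in> carrier H" for x h
    using that by (auto simp: annihilator_def act_mult act_zero_right)
  fix x assume x: "x \<in> annihilator"
  then have xA: "x \<in> carrier H" using sub by blast
  let ?t = "SOME t. t \<in> comult H x"
  have t: "?t \<in> comult H x" by (rule some_comult[OF xA])
  have "lin_ext (vscale V) (\<lambda>(a, b). mode V (act a u) n (act b v)) ?t = 0" for u v n
    using act_mode[OF xA t, of u n v] x by (simp add: annihilator_def)
  then show "\<exists>t\<in>comult H x. Poly_Mapping.keys t \<subseteq> carrier H \<times> annihilator \<union> annihilator \<times> carrier H"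
    unfolding sw_def
    by (intro comult_coidealI[OF fd xA sub subspace_annihilator])
      (auto simp: sw_def intro!: lin_ext_vanish[OF assms(1) comult_keys[OF xA t]])
qed

text \<open>L(-1) is a mode of the conformal vector, on which \<open>H\<close> acts by the counit,
  so the Sweedler sum collapses to its second factor.\<close>

lemma act_Vir:
  assumes h: "h \<in> carrier H"
  shows "act h (Vir V (- 1) x) = Vir V (- 1) (act h x)"
proof -
  let ?t = "SOME t. t \<in> comult H h"
  have t: "?t \<in> comult H h" by (rule some_comult[OF h])
  have lin: "linear_on (carrier H) (hscale H) (vscale V) (\<lambda>h. mode V (conf V) 0 (act h x))"
    by (simp add: linear_on_def)
  have "act h (Vir V (- 1) x) = sw (vscale V) (\<lambda>a b. mode V (act a (conf V)) 0 (act b x)) h"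
    using act_mode[OF h t] by (simp add: Vir_def sw_def)
  also have "\<dots> = sw (vscale V) (\<lambda>a b. mode V (conf V) 0 (act (hscale H (counit H a) b) x)) h"
    by (rule sw_cong[OF h]) (simp add: act_conf)
  also have "\<dots> = mode V (conf V) 0 (act (sw (hscale H) (\<lambda>a b. hscale H (counit H a) b) h) x)"
    by (rule sw_apply[OF vector_space_scale module_vector_space lin subspace_carrier _ h, symmetric]) simp
  finally show ?thesis using h by (simp add: sw_counit_left Vir_def)
qed

lemma act_vac_coeff: "h \<in> carrier H \<Longrightarrow> act h (vac_coeff i x) = vac_coeff i (act h x)"
  by (induction i arbitrary: x) (simp_all add: vac_coeff_Suc act_Vir)

text \<open>Skew symmetry exchanges the two tensor factors, and it is preserved by the action because
  the action commutes with \<open>L(- 1)\<close>.\<close>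

lemma act_mode_swap:
  assumes h: "h \<in> carrier H" and t: "t \<in> comult H h"
  shows "act h (mode V v l u) = lin_ext (vscale V) (\<lambda>(a, b). mode V (act b v) l (act a u)) t"
proof -
  let ?K = "Poly_Mapping.keys t"
  obtain M0 where M0: "\<And>k n. k \<in> {()} \<Longrightarrow> n \<ge> int M0 \<Longrightarrow> mode V u n v = 0"
    using finite_truncation[of "{()}" "\<lambda>k. u" "\<lambda>k. v"] by auto
  obtain M1 where M1: "\<And>k n. k \<in> ?K \<Longrightarrow> n \<ge> int M1 \<Longrightarrow> mode V (act (fst k) u) n (act (snd k) v) = 0"
    using finite_truncation[of ?K "\<lambda>k. act (fst k) u" "\<lambda>k. act (snd k) v"] by auto
  \<comment> \<open>One range for all sums: from \<open>M\<close> on the modes vanish for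
    \<open>u\<close> and \<open>v\<close> as well as for every pair in the expression
    \<open>t\<close>.\<close>
  define M where "M = nat (int M0 + int M1 - l)"
  let ?c = "- ((- 1) powi l) :: complex"
  have "mode V v l u = vscale V ?c (\<Sum>i<M. vscale V ((- 1) ^ i) (vac_coeff i (mode V u (l + int i) v)))"
    by (rule skew_symmetry_finite) (use M0 in \<open>auto simp: M_def\<close>)
  then have "act h (mode V v l u) =
      vscale V ?c (\<Sum>i<M. vscale V ((- 1) ^ i) (vac_coeff i (act h (mode V u (l + int i) v))))"
    by (simp only: act_scale_right[OF h] act_sum_right[OF h] act_vac_coeff[OF h])
  also have "\<dots> = vscale V ?c (\<Sum>i<M. vscale V ((- 1) ^ i) (vac_coeff i
      (lin_ext (vscale V) (\<lambda>k. mode V (act (fst k) u) (l + int i) (act (snd k) v)) t)))"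
    by (simp add: act_mode[OF h t] case_prod_unfold)
  also have "\<dots> = lin_ext (vscale V) (\<lambda>k. vscale V ?c (\<Sum>i<M. vscale V ((- 1) ^ i) (vac_coeff i
      (mode V (act (fst k) u) (l + int i) (act (snd k) v))))) t"
  proof -
    have lin: "linear_on UNIV (vscale V) (vscale V) (vac_coeff i)" for i
      by (simp add: linear_on_def vac_coeff_def)
    have "vac_coeff i (lin_ext (vscale V) F t) = lin_ext (vscale V) (\<lambda>k. vac_coeff i (F k)) t"
      for i and F :: "'h \<times> 'h \<Rightarrow> 'v"
      by (rule linear_on_lin_ext_apply[OF module_vector_space module_vector_space lin]) auto
    then show ?thesis
      by (simp only: lin_ext_scale_fun[OF module_vector_space] lin_ext_sum_fun[OF module_vector_space])
  qed
  also have "\<dots> = lin_ext (vscale V) (\<lambda>k. mode V (act (snd k) v) l (act (fst k) u)) t"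
    by (rule lin_ext_cong, rule skew_symmetry_finite[symmetric]) (use M1 in \<open>auto simp: M_def\<close>)
  finally show ?thesis by (simp add: case_prod_unfold)
qed

lemma cocommutative_if_faithful:
  assumes "simple_voa V" "annihilator = {0}" and h: "h \<in> carrier H" and f: "dual f" "dual f'"
  shows "f (slice f' h) = f' (slice f h)"
proof -
  let ?t = "SOME t. t \<in> comult H h"
  have t: "?t \<in> comult H h" by (rule some_comult[OF h])
  \<comment> \<open>The action on a mode can be computed with either order of the tensor factors, so
    vertex operators kill \<open>?t - ?swap\<close>. With annihilator zero, every pair of
    functionals may be tested on this difference.\<close>
  let ?swap = "lin_ext free_scale (\<lambda>(a, b). free_gen (b, a)) ?t"
  have lin_ext_swap: "lin_ext s (\<lambda>(a, b). \<beta> a b) (?t - ?swap) =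
      lin_ext s (\<lambda>(a, b). \<beta> a b) ?t - lin_ext s (\<lambda>(a, b). \<beta> b a) ?t"
    if "vector_space s" for s :: "complex \<Rightarrow> 'b \<Rightarrow> 'b::ab_group_add" and \<beta>
  proof -
    interpret S: vector_space s by fact
    interpret L: Vector_Spaces.linear free_scale s "lin_ext s (\<lambda>(a, b). \<beta> a b)"
      by (rule linear_lin_ext) fact
    show ?thesis
      unfolding L.diff by (simp add: lin_ext_lin_ext[OF that] case_prod_unfold lin_ext_single[OF that])
  qed
  have keys: "Poly_Mapping.keys ?t \<subseteq> carrier H \<times> carrier H" by (rule comult_keys[OF h t])
  then have "?swap \<in> {t. Poly_Mapping.keys t \<subseteq> carrier H \<times> carrier H}"
    by (intro lin_ext_in_subspace[OF vector_space_free_scale subspace_keys]) auto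
  then have "?t - ?swap \<in> {t. Poly_Mapping.keys t \<subseteq> carrier H \<times> carrier H}"
    using keys by (intro free.subspace_diff[OF subspace_keys]) auto
  moreover have "lin_ext (vscale V) (\<lambda>(a, b). mode V (act a u) n (act b v)) (?t - ?swap) = 0" for u v n
    using act_mode[OF h t, of u n v] act_mode_swap[OF h t, of u n v]
    by (simp add: lin_ext_swap[OF module_vector_space])
  ultimately have "lin_ext (*) (\<lambda>(a, b). f a * f' b) (?t - ?swap) = 0"
    using f assms(1,2) by (intro lin_ext_vanish) (auto simp: dual_zero)
  then show ?thesis
    by (simp add: lin_ext_swap[OF vector_space_complex] dual_slice f h sw_def mult.commute)
qed

end

theorem theorem6p5:
  fixes H :: "'h::ab_group_add hopf"
    and V :: "'v::ab_group_add voa_data"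
    and act :: "'h \<Rightarrow> 'v \<Rightarrow> 'v"
  assumes "hopf_algebra H"
    and "finite_dim (hscale H) (carrier H)"
    and "voa V"
    and "simple_voa V"
    and "hopf_module_voa H V act"
    and "inner_faithful H act"
    and "semisimple_module H (vscale V) act"
  shows "faithful_action H act \<and>
    (\<exists>G :: 'h monoid. group G \<and> finite (carrier G) \<and> (\<exists>\<phi>. hopf_iso H (group_algebra G) \<phi>))"
proof -
  interpret hopf_module_voa H V act by fact
  note fd = assms(2) and simple = assms(4)
  have "annihilator = {0}"
    using hopf_ideal_annihilator[OF simple fd] assms(6) by (auto simp: inner_faithful_def annihilator_def)
  then have "faithful_action H act"
    by (auto simp: faithful_action_def annihilator_def)
  moreover have "VS.span grouplikes = carrier H"
    by (rule cocommutative_span_grouplikes[OF fd])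
      (rule cocommutative_if_faithful[OF simple \<open>annihilator = {0}\<close>])
  then have "hopf_iso H (group_algebra grouplike_group) grouplike_coords"
    by (rule hopf_iso_grouplike_group_algebra[OF fd])
  moreover have "finite (carrier grouplike_group)"
    using finite_grouplikes[OF fd] by (simp add: grouplike_group_def)
  ultimately show ?thesis using group_grouplike_group[OF fd] by blast
qed

end
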